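(* Let $F_n=F_{n,0}$ and $G_n=G_{n,2}$ be as in the context, and define for $n\ge0$ $$\widetilde F_n(z)=(-1)^n\Big(F_n(z)+\sum_{\ell=1}^n\binom{n+\ell}{n}F_{n-\ell}(z)\Big),\qquad \widetilde G_n(z)=G_n(z)+\sum_{\ell=1}^n(-1)^\ell\binom{n+\ell}{n}G_{n-\ell}(z),$$ and $\widetilde F_{-1}=\widetilde G_{-1}:=0$. Then for all $n\ge0$: (1) $\Delta_0\widetilde F_n=\widetilde F_{n-1}$ and $\xi_0\widetilde F_n=\widetilde G_n$; (2) $\Delta_2\widetilde G_n=\widetilde G_{n-1}$ and $\xi_2\widetilde G_n=\widetilde F_{n-1}$.
   Context: Write $z=x+iy\in\mathbb H$. For $k\in 2\mathbb Z$, $\Delta_k=y^2(\partial_x^2+\partial_y^2)-iky(\partial_x+i\partial_y)$, and the Bruinier–Funke operator is $\xi_k f=2iy^k\overline{\partial f/\partial\bar z}$ with $\partial/\partial\bar z=\frac12(\partial_x+i\partial_y)$. Eisenstein series: $E_k(z,s)=\frac12\sum_{(m,n)\ne(0,0)}\frac{y^s}{(mz+n)^k|mz+n|^{2s}}$ (for $\mathrm{Re}(2s+k)>2$, meromorphically continued in $s$); $\widehat E_k(z,s)=\pi^{-(s+k/2)}\Gamma(s+\frac k2+\frac{|k|}2)E_k(z,s)$; $\widehat{\widehat E}_k(z,s)=(s+\frac k2)(s+\frac k2-1)\widehat E_k(z,s)$, entire in $s$, with Taylor expansion at $s=0$ written $\sum_n F_{n,k}(z)s^n$ for $k\le0$ and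 $\sum_nG_{n,k}(z)s^n$ for $k\ge2$. Here $F_n:=F_{n,0}$, $G_n:=G_{n,2}$. *)

theory Defs
  imports "HOL-Analysis.Analysis"
begin

definition dX :: "(complex \<Rightarrow> complex) \<Rightarrow> complex \<Rightarrow> complex" where
  "dX f z = vector_derivative (\<lambda>t::real. f (z + of_real t)) (at 0)"

definition dY :: "(complex \<Rightarrow> complex) \<Rightarrow> complex \<Rightarrow> complex" where
  "dY f z = vector_derivative (\<lambda>t::real. f (z + \<i> * of_real t)) (at 0)"

definition Lap :: "int \<Rightarrow> (complex \<Rightarrow> complex) \<Rightarrow> complex \<Rightarrow> complex" where
  "Lap k f z = of_real ((Im z)\<^sup>2) * (dX (dX f) z + dY (dY f) z)
              - \<i> * of_int k * of_real (Im z) * (dX f z + \<i> * dY f z)"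

definition xiBF :: "int \<Rightarrow> (complex \<Rightarrow> complex) \<Rightarrow> complex \<Rightarrow> complex" where
  "xiBF k f z = 2 * \<i> * of_real (Im z powi k) * cnj ((dX f z + \<i> * dY f z) / 2)"

text \<open>E_k(z,s) = 1/2 sum over (m,n) \<noteq> (0,0) of y^s / ((mz+n)^k |mz+n|^(2s)),
  as given by the (absolutely convergent) series for Re(2s+k) > 2.\<close>
definition Eis :: "int \<Rightarrow> complex \<Rightarrow> complex \<Rightarrow> complex" where
  "Eis k z s = (1/2) * infsum (\<lambda>(m::int, n::int).
      of_real (Im z) powr s /
      ((of_int m * z + of_int n) powi k * of_real (cmod (of_int m * z + of_int n)) powr (2 * s)))
      (UNIV - {(0, 0)})"

definition EEhat_series :: "int \<Rightarrow> complex \<Rightarrow> complex \<Rightarrow> complex" where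
  "EEhat_series k z s = (s + of_int k / 2) * (s + of_int k / 2 - 1) *
      (of_real pi powr (- (s + of_int k / 2))) *
      Gamma (s + of_int k / 2 + of_int \<bar>k\<bar> / 2) * Eis k z s"

definition EEhat :: "int \<Rightarrow> complex \<Rightarrow> complex \<Rightarrow> complex" where
  "EEhat k z = (THE g. g holomorphic_on UNIV \<and>
      (\<forall>s. Re (2 * s + of_int k) > 2 \<longrightarrow> g s = EEhat_series k z s))"

definition TaylorE :: "nat \<Rightarrow> int \<Rightarrow> complex \<Rightarrow> complex" where
  "TaylorE n k z = (deriv ^^ n) (EEhat k z) 0 / of_nat (fact n)"

definition F :: "nat \<Rightarrow> complex \<Rightarrow> complex" where
  "F n = TaylorE n 0"

definition G :: "nat \<Rightarrow> complex \<Rightarrow> complex" where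
  "G n = TaylorE n 2"

definition Ft :: "nat \<Rightarrow> complex \<Rightarrow> complex" where
  "Ft n z = (-1) ^ n * (F n z + (\<Sum>l = 1..n. of_nat ((n + l) choose n) * F (n - l) z))"

definition Gt :: "nat \<Rightarrow> complex \<Rightarrow> complex" where
  "Gt n z = G n z + (\<Sum>l = 1..n. (-1) ^ l * of_nat ((n + l) choose n) * G (n - l) z)"

definition Ft_prev :: "nat \<Rightarrow> complex \<Rightarrow> complex" where
  "Ft_prev n = (if n = 0 then (\<lambda>_. 0) else Ft (n - 1))"

definition Gt_prev :: "nat \<Rightarrow> complex \<Rightarrow> complex" where
  "Gt_prev n = (if n = 0 then (\<lambda>_. 0) else Gt (n - 1))"

end

theory Submission
  imports Defs "HOL-Complex_Analysis.Complex_Analysis" "HOL-Probability.Probability"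
begin

text \<open>
  Let \<open>\<Theta>\<^sub>z(t)\<close> be the sum of \<open>exp (- \<pi> t |mz + n|\<^sup>2 / y)\<close> over all \<open>(m,n) \<noteq> (0,0)\<close>; the
  logarithmic variable \<open>t = e\<^sup>x\<close> is used throughout. Poisson summation gives
  \<open>\<Theta>\<^sub>z(1/t) + 1 = t (\<Theta>\<^sub>z(t) + 1)\<close>, and splitting the Mellin integral of \<open>\<Theta>\<^sub>z\<close> at \<open>t = 1\<close> shows that
  the completed weight 0 series is \<open>1/2 + s (s - 1)/2\<close> times the integral of
  \<open>\<Theta>\<^sub>z(t) (t\<^sup>s + t\<^sup>1\<^sup>-\<^sup>s) dt/t\<close> over \<open>[1,\<infinity>)\<close>. The weight 2 series has the same shape at \<open>- s\<close>,
  without the summand \<open>1/2\<close> and with \<open>\<xi>\<^sub>0 \<Theta>\<^sub>z\<close> in place of \<open>\<Theta>\<^sub>z\<close>. So the Taylor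
  coefficients are integrals of theta series against explicit weights, and \<open>z\<close>-derivatives
  may be taken under the integral. This yields \<open>\<xi>\<^sub>0 F\<^sub>n = (-1)\<^sup>n G\<^sub>n\<close>, while integrating
  \<open>\<Delta>\<^sub>0 \<Theta>\<^sub>z = (t\<^sup>2 \<partial>\<^sub>t\<^sup>2 + 2 t \<partial>\<^sub>t) \<Theta>\<^sub>z\<close> by parts yields \<open>\<Delta>\<^sub>0 F\<^sub>n = F\<^sub>n\<^sub>-\<^sub>2 - F\<^sub>n\<^sub>-\<^sub>1\<close>; the boundary term
  at \<open>t = 1\<close> is supplied by the derivative of the functional equation. Pascal's rule turns these
  recursions into the stated ones, using \<open>\<xi>\<^sub>2 \<xi>\<^sub>0 = \<Delta>\<^sub>0\<close> and \<open>\<xi>\<^sub>0 \<xi>\<^sub>2 = \<Delta>\<^sub>2\<close>.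
\<close>

section \<open>Uniqueness of Fourier coefficients\<close>

text \<open>The Eisenstein series of weight 0 is an eigenfunction of \<open>Lap 0\<close> with
  eigenvalue s(s-1), but its continuation has no termwise formula that could be differentiated in z
  near s = 0. Theta series decay doubly exponentially in x, so there every interchange can be
  dominated, and the eigenvalue reappears as W'' - W' = s(s-1) W for W = e^(sx) + e^((1-s)x). The
  functions \<open>tweight\<close> are the Taylor coefficients of this W in s.

  The binomials come from the same eigenvalue. With E(s) the sum of all F_n s^n, \<open>Ft n\<close>
  is (-1)^n times the coefficient of s^n in (1-s)^(-n-1) E(s), that is, minus the residue at 0 of
  E(s) / (s(s-1))^(n+1); multiplying E by s(s-1) lowers n by one. \<open>Gt n\<close> is the residue
  of the weight 2 series divided by (w(w+1))^(n+1).

  Poisson summation is reduced to uniqueness of Fourier coefficients by comparing two continuous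
  1-periodic functions.\<close>

definition fourier_null :: "(real \<Rightarrow> complex) \<Rightarrow> bool" where
  "fourier_null D \<longleftrightarrow> continuous_on {0..1} D \<and>
     (\<forall>k::int. integral {0..1} (\<lambda>x. D x * cis (2 * pi * of_int k * x)) = 0)"

lemma fourier_null_mult_cis:
  assumes "fourier_null D"
  shows "fourier_null (\<lambda>x. D x * cis (2 * pi * of_int j * x))"
proof -
  have "continuous_on {0..1} (\<lambda>x. D x * cis (2 * pi * of_int j * x))"
    using assms unfolding fourier_null_def by (auto intro!: continuous_intros)
  moreover have "integral {0..1} (\<lambda>x. D x * cis (2 * pi * of_int j * x) * cis (2 * pi * of_int k * x)) = 0"
    for k :: int
  proof -
    have "(\<lambda>x. D x * cis (2 * pi * of_int j * x) * cis (2 * pi * of_int k * x))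
        = (\<lambda>x. D x * cis (2 * pi * of_int (j + k) * x))"
      by (simp add: mult.assoc cis_mult algebra_simps)
    then show ?thesis using assms unfolding fourier_null_def by metis
  qed
  ultimately show ?thesis unfolding fourier_null_def by blast
qed

lemma fourier_null_add:
  assumes "fourier_null D" "fourier_null E"
  shows "fourier_null (\<lambda>x. D x + E x)"
proof -
  have [continuous_intros]: "continuous_on {0..1} D" "continuous_on {0..1} E"
    using assms unfolding fourier_null_def by auto
  have "integral {0..1} (\<lambda>x. (D x + E x) * cis (2 * pi * of_int k * x)) = 0" for k :: int
  proof -
    have "integral {0..1} (\<lambda>x. D x * cis (2 * pi * of_int k * x) + E x * cis (2 * pi * of_int k * x)) = 0"
      using assms unfolding fourier_null_def
      by (subst Henstock_Kurzweil_Integration.integral_add)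
         (auto intro!: integrable_continuous_interval continuous_intros)
    then show ?thesis by (simp add: algebra_simps)
  qed
  then show ?thesis unfolding fourier_null_def by (auto intro!: continuous_intros)
qed

lemma fourier_null_cmult:
  assumes "fourier_null D"
  shows "fourier_null (\<lambda>x. D x * c)"
proof -
  have "integral {0..1} (\<lambda>x. D x * c * cis (2 * pi * of_int k * x)) = 0" for k :: int
  proof -
    have "(\<lambda>x. D x * c * cis (2 * pi * of_int k * x)) = (\<lambda>x. (D x * cis (2 * pi * of_int k * x)) * c)"
      by (simp add: algebra_simps)
    then show ?thesis using assms unfolding fourier_null_def
      by simp
  qed
  then show ?thesis using assms unfolding fourier_null_def by (auto intro!: continuous_intros)
qed

text \<open>A real linear functional is a combination of w and \<open>cnj w\<close>, on the circle
  the characters of index 1 and -1, and null functions are stable under multiplication by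
  characters. \<open>D\<close> stays arbitrary because the product case applies the hypothesis for
  \<open>g\<close> to \<open>D\<close> times \<open>f\<close>.\<close>

lemma fourier_null_real_polynomial:
  assumes "real_polynomial_function p" "fourier_null D"
  shows "fourier_null (\<lambda>x. D x * of_real (p (cis (2 * pi * x))))"
  using assms
proof (induction arbitrary: D)
  case (linear f)
  interpret bounded_linear f by fact
  define a b where "a = complex_of_real (f 1)" and "b = complex_of_real (f \<i>)"
  have f: "f w = Re w * f 1 + Im w * f \<i>" for w
  proof -
    have "f w = f (Re w *\<^sub>R 1 + Im w *\<^sub>R \<i>)"
      by (rule arg_cong[of _ _ f]) (simp add: complex_eq_iff)
    then show ?thesis by (simp add: add scaleR)
  qed
  have eq: "D x * of_real (f (cis (2 * pi * x))) = D x * cis (2 * pi * of_int 1 * x) * ((a - \<i> * b) / 2)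
       + D x * cis (2 * pi * of_int (-1) * x) * ((a + \<i> * b) / 2)" for x
  proof -
    define w where "w = cis (2 * pi * x)"
    have "cis (2 * pi * of_int 1 * x) = w" "cis (2 * pi * of_int (-1) * x) = cnj w"
      unfolding w_def by (simp_all add: cis_cnj)
    moreover have "f w = Re w * f 1 + Im w * f \<i>" by (rule f)
    ultimately show ?thesis unfolding a_def b_def w_def [symmetric]
      by (simp add: complex_eq_iff field_simps)
  qed
  show ?case unfolding eq
    by (intro fourier_null_add fourier_null_cmult fourier_null_mult_cis linear.prems)
next
  case (const c)
  then show ?case by (intro fourier_null_cmult)
next
  case (add f g)
  have eq: "(\<lambda>x. D x * of_real (f (cis (2 * pi * x)) + g (cis (2 * pi * x)))) =
    (\<lambda>x. D x * of_real (f (cis (2 * pi * x))) + D x * of_real (g (cis (2 * pi * x))))"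
    by (simp add: algebra_simps)
  show ?case unfolding eq by (intro fourier_null_add add)
next
  case (mult f g)
  have eq: "(\<lambda>x. D x * of_real (f (cis (2 * pi * x)) * g (cis (2 * pi * x)))) =
    (\<lambda>x. D x * of_real (f (cis (2 * pi * x))) * of_real (g (cis (2 * pi * x))))"
    by (simp add: algebra_simps)
  show ?case unfolding eq by (intro mult)
qed

lemma fourier_null_polynomial:
  fixes g :: "complex \<Rightarrow> complex"
  assumes "polynomial_function g" "fourier_null D"
  shows "fourier_null (\<lambda>x. D x * g (cis (2 * pi * x)))"
proof -
  have "real_polynomial_function (\<lambda>w. Re (g w))" "real_polynomial_function (\<lambda>w. Im (g w))"
    using assms(1) unfolding polynomial_function_def
    using bounded_linear_Re bounded_linear_Im by (force simp: o_def)+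
  then have "fourier_null (\<lambda>x. D x * of_real (Re (g (cis (2 * pi * x)))) +
       D x * of_real (Im (g (cis (2 * pi * x)))) * \<i>)"
    by (intro fourier_null_add fourier_null_cmult fourier_null_real_polynomial assms(2))
  also have "(\<lambda>x. D x * of_real (Re (g (cis (2 * pi * x)))) +
       D x * of_real (Im (g (cis (2 * pi * x)))) * \<i>) = (\<lambda>x. D x * g (cis (2 * pi * x)))"
    by (auto simp: complex_eq_iff fun_eq_iff algebra_simps)
  finally show ?thesis .
qed

lemma cis_interval_surj: "norm w = 1 \<Longrightarrow> \<exists>x\<in>{0..1}. w = cis (2 * pi * x)"
proof -
  assume "norm w = 1"
  then have "w = cis (2 * pi * (Arg2pi w / (2 * pi)))"
    using Arg2pi_eq[of w] by (simp add: cis_conv_exp)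
  moreover have "Arg2pi w / (2 * pi) \<in> {0..1}"
    using Arg2pi_ge_0[of w] Arg2pi_lt_2pi[of w] by (auto simp: field_simps)
  ultimately show ?thesis by blast
qed

lemma Arg2pi_cis_interval:
  "0 \<le> x \<Longrightarrow> x < 1 \<Longrightarrow> Arg2pi (cis (2 * pi * x)) = 2 * pi * x"
  by (rule Arg2pi_unique[of 1]) (auto simp: cis_conv_exp)

text \<open>Carries a function with equal end values to the circle, where Stone-Weierstrass is
  applied. Continuity is tested on closed sets: the preimage of a closed set is the image of a
  compact subset of the interval.\<close>

lemma circle_factorization:
  fixes D :: "real \<Rightarrow> complex"
  assumes "continuous_on {0..1} D" "D 0 = D 1"
  obtains E where "continuous_on (sphere 0 1) E" "\<And>x. x \<in> {0..1} \<Longrightarrow> E (cis (2 * pi * x)) = D x"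
proof
  define E where "E w = D (Arg2pi w / (2 * pi))" for w
  show E: "E (cis (2 * pi * x)) = D x" if "x \<in> {0..1}" for x
  proof (cases "x = 1")
    case True
    then show ?thesis using assms(2) Arg2pi_cis_interval[of 0] by (simp add: E_def)
  next
    case False
    then show ?thesis using that by (simp add: E_def Arg2pi_cis_interval)
  qed
  show "continuous_on (sphere 0 1) E"
  proof (subst continuous_on_closed_vimage, simp, intro allI impI)
    fix B :: "complex set" assume "closed B"
    have "E -` B \<inter> sphere 0 1 = (\<lambda>x. cis (2 * pi * x)) ` (D -` B \<inter> {0..1})"
    proof (intro equalityI subsetI)
      fix w assume w: "w \<in> E -` B \<inter> sphere 0 1"
      then obtain x where "x \<in> {0..1}" "w = cis (2 * pi * x)"
        using cis_interval_surj[of w] by auto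
      then show "w \<in> (\<lambda>x. cis (2 * pi * x)) ` (D -` B \<inter> {0..1})"
        using E[of x] w by auto
    next
      fix w assume "w \<in> (\<lambda>x. cis (2 * pi * x)) ` (D -` B \<inter> {0..1})"
      then show "w \<in> E -` B \<inter> sphere 0 1"
        using E by auto
    qed
    moreover have "compact ((\<lambda>x. cis (2 * pi * x)) ` (D -` B \<inter> {0..1}))"
    proof (rule compact_continuous_image)
      show "continuous_on (D -` B \<inter> {0..1}) (\<lambda>x. cis (2 * pi * x))"
        by (intro continuous_intros)
      have "closed (D -` B \<inter> {0..1})"
        using assms(1) \<open>closed B\<close> by (subst (asm) continuous_on_closed_vimage) auto
      then show "compact (D -` B \<inter> {0..1})"
        by (metis compact_Icc compact_Int_closed inf_commute inf.idem inf.left_commute)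
    qed
    ultimately show "closed (E -` B \<inter> sphere 0 1)"
      by (simp add: compact_imp_closed)
  qed
qed

text \<open>Replacing \<open>cnj D\<close> by a polynomial in the circle variable turns the integral
  of |D|^2 into one that vanishes by \<open>fourier_null_polynomial\<close>, at the cost of an
  arbitrarily small error. So the integral is 0, and continuity gives the pointwise
  statement.\<close>

lemma fourier_null_eq_0:
  assumes D: "fourier_null D" and "D 0 = D 1" and x: "x \<in> {0..1}"
  shows "D x = 0"
proof -
  have cont [continuous_intros]: "continuous_on {0..1} D"
    using D unfolding fourier_null_def by auto
  have contc: "continuous_on {0..1} (\<lambda>x. cnj (D x))" "cnj (D 0) = cnj (D 1)"
    using \<open>D 0 = D 1\<close> by (auto intro!: continuous_intros)
  then obtain E where E: "continuous_on (sphere 0 1) E"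
      "\<And>x. x \<in> {0..1} \<Longrightarrow> E (cis (2 * pi * x)) = cnj (D x)"
    by (rule circle_factorization) auto
  have "compact (D ` {0..1})" using cont by (intro compact_continuous_image) auto
  then obtain M where M: "\<And>x. x \<in> {0..1} \<Longrightarrow> norm (D x) \<le> M" "M > 0"
    using compact_imp_bounded[of "D ` {0..1}"] unfolding bounded_pos by blast
  let ?I = "integral {0..1} (\<lambda>x. D x * cnj (D x))"
  have "norm ?I \<le> M * e" if "e > 0" for e
  proof -
    obtain g where g: "polynomial_function g" "\<And>w. w \<in> sphere 0 1 \<Longrightarrow> norm (E w - g w) < e"
      using Stone_Weierstrass_polynomial_function[OF _ E(1) \<open>e > 0\<close>] by auto
    have fn: "fourier_null (\<lambda>x. D x * g (cis (2 * pi * x)))"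
      by (rule fourier_null_polynomial) (use g D in auto)
    have [continuous_intros]: "continuous_on {0..1} (\<lambda>x. D x * g (cis (2 * pi * x)))"
      using fn unfolding fourier_null_def by auto
    have 0: "integral {0..1} (\<lambda>x. D x * g (cis (2 * pi * x))) = 0"
      using fn unfolding fourier_null_def by (auto dest: spec[of _ 0])
    have "?I = integral {0..1} (\<lambda>x. D x * cnj (D x) - D x * g (cis (2 * pi * x)))"
      by (subst integral_diff)
         (auto simp: 0 intro!: integrable_continuous_interval continuous_intros)
    also have "norm \<dots> \<le> M * e * (1 - 0)"
    proof (rule integral_bound)
      show "continuous_on {0..1} (\<lambda>x. D x * cnj (D x) - D x * g (cis (2 * pi * x)))"
        by (intro continuous_intros)
      fix x :: real assume x: "x \<in> {0..1}"
      have "norm (D x * cnj (D x) - D x * g (cis (2 * pi * x))) =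
          norm (D x) * norm (E (cis (2 * pi * x)) - g (cis (2 * pi * x)))"
        using E(2)[OF x] by (simp add: right_diff_distrib [symmetric] norm_mult)
      also have "\<dots> \<le> M * e"
        using M(1)[OF x] g(2)[of "cis (2 * pi * x)"] M(2)
        by (intro mult_mono) auto
      finally show "norm (D x * cnj (D x) - D x * g (cis (2 * pi * x))) \<le> M * e" .
    qed auto
    finally show ?thesis by simp
  qed
  then have "norm ?I / M \<le> e" if "e > 0" for e :: real
    using M(2) \<open>\<And>e. e > 0 \<Longrightarrow> norm ?I \<le> M * e\<close>[of e] \<open>e > 0\<close>
    by (metis mult.commute pos_divide_le_eq)
  then have "norm ?I / M \<le> 0"
    by (rule field_le_epsilon) simp
  then have I0: "?I = 0" using M(2) by (simp add: field_simps)
  have "((\<lambda>x. of_real ((norm (D x))\<^sup>2)) has_integral (of_real 0 :: complex)) {0..1}"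
  proof -
    have "((\<lambda>x. D x * cnj (D x)) has_integral ?I) {0..1}"
      by (intro integrable_integral integrable_continuous_interval continuous_intros)
    then show ?thesis unfolding I0 by (simp only: complex_norm_square of_real_0)
  qed
  then have "((\<lambda>x. (norm (D x))\<^sup>2) has_integral 0) {0..1}"
    using has_integral_Re[of "\<lambda>x. of_real ((norm (D x))\<^sup>2)" "of_real 0" "{0..1}"] by simp
  then have "(norm (D x))\<^sup>2 = 0"
    using x by (intro has_integral_0_cbox_imp_0[of 0 1 "\<lambda>x. (norm (D x))\<^sup>2"])
               (auto intro!: continuous_intros)
  then show ?thesis by simp
qed

section \<open>Poisson summation for Gaussians\<close>

lemma abs_of_int_le_square: "\<bar>real_of_int n\<bar> \<le> (real_of_int n)\<^sup>2"
proof -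
  have "\<bar>n\<bar> \<le> \<bar>n\<bar>\<^sup>2"
    using self_le_power[of "\<bar>n\<bar>" 2] by (cases "n = 0") auto
  then have "of_int \<bar>n\<bar> \<le> (of_int (\<bar>n\<bar>\<^sup>2) :: real)"
    by (simp only: of_int_le_iff)
  then show ?thesis by simp
qed

lemma summable_on_exp_abs_int:
  assumes "\<beta> > 0"
  shows "(\<lambda>n::int. exp (- \<beta> * \<bar>real_of_int n\<bar>)) summable_on UNIV"
proof -
  have "summable (\<lambda>n. exp (-\<beta>) ^ n)"
    using assms by (intro summable_geometric) auto
  then have "summable (\<lambda>n::nat. exp (- \<beta> * real n))"
    by (simp add: exp_of_nat_mult [symmetric] mult_ac)
  then have s: "(\<lambda>n::nat. exp (- \<beta> * real n)) summable_on UNIV"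
    by (subst summable_on_UNIV_nonneg_real_iff) auto
  have "(\<lambda>n::int. exp (- \<beta> * \<bar>real_of_int n\<bar>)) summable_on (range int)"
    by (subst summable_on_reindex) (use s in \<open>auto simp: inj_on_def o_def\<close>)
  moreover have "(\<lambda>n::int. exp (- \<beta> * \<bar>real_of_int n\<bar>)) summable_on (range (\<lambda>n. - int n))"
    by (subst summable_on_reindex) (use s in \<open>auto simp: inj_on_def o_def\<close>)
  then have "(\<lambda>n::int. exp (- \<beta> * \<bar>real_of_int n\<bar>)) summable_on (range (\<lambda>n. - int n) - range int)"
    by (rule summable_on_subset_banach) auto
  ultimately have "(\<lambda>n::int. exp (- \<beta> * \<bar>real_of_int n\<bar>)) summable_on
      (range int \<union> (range (\<lambda>n. - int n) - range int))"
    by (rule summable_on_Un_disjoint) auto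
  also have "range int \<union> (range (\<lambda>n. - int n) - range int) = UNIV"
    by (auto simp: image_iff) (metis int_cases2)
  finally show ?thesis .
qed

text \<open>Weierstrass M-test along the finite subsets of the index set. The interchange is stated
  with \<open>has_sum\<close> so that it also yields the summability demanded by
  \<open>has_sum_unit_translates\<close>.\<close>

lemma infsum_unit_interval:
  fixes f :: "'a \<Rightarrow> real \<Rightarrow> complex"
  assumes "\<And>n. continuous_on {0..1} (f n)"
    and "\<And>n x. x \<in> {0..1} \<Longrightarrow> norm (f n x) \<le> M n" and "M summable_on A"
  shows "continuous_on {0..1} (\<lambda>x. \<Sum>\<^sub>\<infinity>n\<in>A. f n x)"
    and "((\<lambda>n. integral {0..1} (f n)) has_sum integral {0..1} (\<lambda>x. \<Sum>\<^sub>\<infinity>n\<in>A. f n x)) A"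
proof -
  have u: "uniform_limit {0..1} (\<lambda>X x. \<Sum>n\<in>X. f n x) (\<lambda>x. \<Sum>\<^sub>\<infinity>n\<in>A. f n x) (finite_subsets_at_top A)"
    by (rule Weierstrass_m_test_general) (use assms in auto)
  have c: "continuous_on {0..1} (\<lambda>x. \<Sum>n\<in>X. f n x)" for X
    by (intro continuous_on_sum assms)
  show "continuous_on {0..1} (\<lambda>x. \<Sum>\<^sub>\<infinity>n\<in>A. f n x)"
    using u by (rule uniform_limit_theorem[rotated]) (use c in auto)
  obtain I J where I: "\<And>X. ((\<lambda>x. \<Sum>n\<in>X. f n x) has_integral I X) {0..1}"
      and J: "((\<lambda>x. \<Sum>\<^sub>\<infinity>n\<in>A. f n x) has_integral J) {0..1}"
      and lim: "(I \<longlongrightarrow> J) (finite_subsets_at_top A)"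
    using uniform_limit_integral[OF u c] by auto
  have "I X = (\<Sum>n\<in>X. integral {0..1} (f n))" if "finite X" for X
  proof -
    have "((\<lambda>x. \<Sum>n\<in>X. f n x) has_integral (\<Sum>n\<in>X. integral {0..1} (f n))) {0..1}"
      using that by (intro has_integral_sum integrable_integral integrable_continuous_interval assms)
    then show ?thesis using I[of X] by (rule has_integral_unique[rotated])
  qed
  then have "eventually (\<lambda>X. I X = (\<Sum>n\<in>X. integral {0..1} (f n))) (finite_subsets_at_top A)"
    by (intro eventually_finite_subsets_at_top_weakI) auto
  then have "((\<lambda>X. (\<Sum>n\<in>X. integral {0..1} (f n))) \<longlongrightarrow> J) (finite_subsets_at_top A)"
    using lim by (rule Lim_transform_eventually[rotated])
  then show "((\<lambda>n. integral {0..1} (f n)) has_sum integral {0..1} (\<lambda>x. \<Sum>\<^sub>\<infinity>n\<in>A. f n x)) A"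
    unfolding has_sum_def using J by (simp add: integral_unique)
qed

text \<open>The Fourier transform of a Gaussian, obtained by rescaling the characteristic function
  of the standard normal law.\<close>

lemma has_bochner_integral_gaussian_cis:
  fixes a t :: real
  assumes "a > 0"
  shows "has_bochner_integral lborel (\<lambda>x. of_real (exp (- (pi * a * x\<^sup>2))) * cis (2 * pi * t * x))
     (of_real (exp (- (pi * t\<^sup>2 / a)) / sqrt a))"
proof -
  \<comment> \<open>Chosen so that (c x)^2 / 2 = pi a x^2; the frequency \<open>s\<close> is then
    fixed by s c = 2 pi t.\<close>
  define c where "c = sqrt (2 * pi * a)"
  have c: "c > 0" "c\<^sup>2 = 2 * pi * a" using assms by (auto simp: c_def)
  define s where "s = 2 * pi * t / c"
  interpret std: prob_space std_normal_distribution
    by (rule prob_space_normal_density) simp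
  have int: "integrable std_normal_distribution (\<lambda>x. iexp (s * x))"
    by (rule std.integrable_const_bound[of _ 1]) auto
  have "(CLINT x|std_normal_distribution. iexp (s * x)) = exp (- (s\<^sup>2) / 2)"
    using char_std_normal_distribution unfolding char_def by (metis of_real_exp)
  then have "has_bochner_integral std_normal_distribution (\<lambda>x. iexp (s * x)) (of_real (exp (- (s\<^sup>2) / 2)))"
    using int by (simp add: has_bochner_integral_iff exp_of_real)
  then have "has_bochner_integral lborel (\<lambda>x. std_normal_density x *\<^sub>R iexp (s * x)) (of_real (exp (- (s\<^sup>2) / 2)))"
    by (simp add: has_bochner_integral_iff integrable_density integral_density normal_density_nonneg)
  then have "has_bochner_integral lborel (\<lambda>x. std_normal_density (c * x) *\<^sub>R iexp (s * (c * x)))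
      (of_real (exp (- (s\<^sup>2) / 2)) /\<^sub>R \<bar>c\<bar>)"
    using lborel_has_bochner_integral_real_affine_iff[of c "\<lambda>x. std_normal_density x *\<^sub>R iexp (s * x)" _ 0] c(1)
    by simp
  then have "has_bochner_integral lborel (\<lambda>x. of_real (sqrt (2 * pi)) * (std_normal_density (c * x) *\<^sub>R iexp (s * (c * x))))
      (of_real (sqrt (2 * pi)) * (of_real (exp (- (s\<^sup>2) / 2)) /\<^sub>R \<bar>c\<bar>))"
    by (rule has_bochner_integral_mult_right[rotated])
  moreover have "of_real (sqrt (2 * pi)) * (std_normal_density (c * x) *\<^sub>R iexp (s * (c * x))) =
     of_real (exp (- (pi * a * x\<^sup>2))) * cis (2 * pi * t * x)" for x
  proof -
    have "std_normal_density (c * x) = exp (- (pi * a * x\<^sup>2)) / sqrt (2 * pi)"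
      using c by (simp add: std_normal_density_def power_mult_distrib)
    moreover have "iexp (s * (c * x)) = cis (2 * pi * t * x)"
      using c by (simp add: s_def cis_conv_exp mult.assoc)
    ultimately show ?thesis by (simp add: scaleR_conv_of_real)
  qed
  moreover have "of_real (sqrt (2 * pi)) * (of_real (exp (- (s\<^sup>2) / 2)) /\<^sub>R \<bar>c\<bar>) =
      complex_of_real (exp (- (pi * t\<^sup>2 / a)) / sqrt a)"
  proof -
    have "s\<^sup>2 / 2 = pi * t\<^sup>2 / a"
      unfolding s_def power_divide c(2) using assms by (simp add: power_mult_distrib field_simps power2_eq_square)
    moreover have "sqrt (2 * pi) / c = 1 / sqrt a"
      unfolding c_def using assms by (simp add: real_sqrt_mult)
    ultimately show ?thesis using c(1)
      by (simp add: scaleR_conv_of_real field_simps flip: of_real_mult of_real_divide)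
  qed
  ultimately show ?thesis by simp
qed

text \<open>Summability in the unordered sense is assumed, so the value may be computed along one
  exhaustion: the intervals from -N to N, with dominated convergence.\<close>

lemma has_sum_unit_translates:
  fixes \<phi> :: "real \<Rightarrow> complex"
  assumes cont: "continuous_on UNIV \<phi>" and int: "integrable lborel \<phi>"
    and summ: "(\<lambda>n::int. integral {0..1} (\<lambda>x. \<phi> (of_int n + x))) summable_on UNIV"
  shows "((\<lambda>n::int. integral {0..1} (\<lambda>x. \<phi> (of_int n + x))) has_sum integral\<^sup>L lborel \<phi>) UNIV"
proof -
  let ?c = "\<lambda>n::int. integral {0..1} (\<lambda>x. \<phi> (of_int n + x))"
  have c: "?c n = integral {of_int n..of_int n + 1} \<phi>" for n
    using integral_shift[where a = 0 and b = 1 and c = "of_int n" and f = \<phi>] continuous_on_subset[OF cont]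
    by (simp add: o_def add.commute)
  have part: "(\<Sum>n\<in>{-int N..<int N}. ?c n) = integral {- real N..real N} \<phi>" for N
  proof (induction N)
    case 0
    then show ?case by simp
  next
    case (Suc N)
    have on: "\<phi> integrable_on {a..b}" for a b
      using continuous_on_subset[OF cont] by (intro integrable_continuous_interval) auto
    have "{-int (Suc N)..<int (Suc N)} = insert (- int (Suc N)) (insert (int N) {-int N..<int N})"
      by auto
    then have "(\<Sum>n\<in>{-int (Suc N)..<int (Suc N)}. ?c n) =
        ?c (- int (Suc N)) + ((\<Sum>n\<in>{-int N..<int N}. ?c n) + ?c (int N))"
      by (simp add: add.commute)
    also have "\<dots> = integral {- 1 - real N.. - real N} \<phi> +
        (integral {- real N..real N} \<phi> + integral {real N..real N + 1} \<phi>)"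
      unfolding Suc.IH unfolding c by simp
    also have "integral {- real N..real N} \<phi> + integral {real N..real N + 1} \<phi> = integral {- real N..real N + 1} \<phi>"
      by (rule Henstock_Kurzweil_Integration.integral_combine[OF _ _ on]) auto
    also have "integral {- 1 - real N.. - real N} \<phi> + \<dots> = integral {- 1 - real N..real N + 1} \<phi>"
      by (rule Henstock_Kurzweil_Integration.integral_combine[OF _ _ on]) auto
    finally show ?case by (simp add: add.commute)
  qed
  have "(\<lambda>N. LINT x|lborel. indicator {- real N..real N} x *\<^sub>R \<phi> x) \<longlonglongrightarrow> integral\<^sup>L lborel \<phi>"
  proof (rule integral_dominated_convergence[where w = "\<lambda>x. norm (\<phi> x)"])
    show "AE x in lborel. (\<lambda>N. indicator {- real N..real N} x *\<^sub>R \<phi> x) \<longlonglongrightarrow> \<phi> x"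
    proof (rule AE_I2)
      fix x :: real
      have "eventually (\<lambda>N. indicator {- real N..real N} x *\<^sub>R \<phi> x = \<phi> x) sequentially"
        using eventually_ge_at_top[of "nat \<lceil>\<bar>x\<bar>\<rceil>"]
        by eventually_elim (auto simp: indicator_def)
      then show "(\<lambda>N. indicator {- real N..real N} x *\<^sub>R \<phi> x) \<longlonglongrightarrow> \<phi> x"
        by (rule tendsto_eventually)
    qed
  qed (use int in \<open>auto simp: indicator_def\<close>)
  also have "(\<lambda>N. LINT x|lborel. indicator {- real N..real N} x *\<^sub>R \<phi> x) = (\<lambda>N. integral {- real N..real N} \<phi>)"
  proof
    fix N
    have "set_integrable lborel {- real N..real N} \<phi>"
      unfolding set_integrable_def using int by (intro integrable_mult_indicator) auto
    from set_borel_integral_eq_integral(2)[OF this]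
    show "(LINT x|lborel. indicator {- real N..real N} x *\<^sub>R \<phi> x) = integral {- real N..real N} \<phi>"
      unfolding set_lebesgue_integral_def .
  qed
  finally have 1: "(\<lambda>N. \<Sum>n\<in>{-int N..<int N}. ?c n) \<longlonglongrightarrow> integral\<^sup>L lborel \<phi>"
    unfolding part .
  have "filterlim (\<lambda>N. {-int N..<int N}) (finite_subsets_at_top UNIV) sequentially"
    unfolding filterlim_finite_subsets_at_top
  proof safe
    fix X :: "int set" assume "finite X"
    then have B: "\<bar>n\<bar> \<le> Max (abs ` X)" if "n \<in> X" for n
      using that by simp
    show "\<forall>\<^sub>F N in sequentially. finite {- int N..<int N} \<and> X \<subseteq> {- int N..<int N} \<and> {- int N..<int N} \<subseteq> UNIV"
      using eventually_gt_at_top[of "nat (Max (abs ` X))"]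
      by eventually_elim (use B in force)
  qed
  then have 2: "(\<lambda>N. \<Sum>n\<in>{-int N..<int N}. ?c n) \<longlonglongrightarrow> infsum ?c UNIV"
    using has_sum_infsum[OF summ] unfolding has_sum_def by (rule filterlim_compose[rotated])
  show ?thesis using has_sum_infsum[OF summ] LIMSEQ_unique[OF 1 2] by simp
qed

lemma integral_cis_unit_interval:
  "integral {0..1} (\<lambda>x. cis (2 * pi * of_int j * x)) = (if j = 0 then 1 else 0)" for j :: int
proof (cases "j = 0")
  case False
  let ?w = "2 * of_real pi * of_int j * \<i> :: complex"
  have w: "?w \<noteq> 0" using False by simp
  have eq: "cis (2 * pi * of_int j * x) = exp (?w * of_real x)" for x
    by (simp add: cis_conv_exp mult_ac)
  have "((\<lambda>x. exp (?w * of_real x)) has_integral exp (?w * of_real 1) / ?w - exp (?w * of_real 0) / ?w) {0..1}"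
  proof (rule fundamental_theorem_of_calculus)
    fix x :: real
    have "((\<lambda>z. exp (?w * z) / ?w) has_field_derivative exp (?w * of_real x)) (at (of_real x))"
      using w by (auto intro!: derivative_eq_intros)
    then show "((\<lambda>x. exp (?w * of_real x) / ?w) has_vector_derivative exp (?w * of_real x)) (at x within {0..1})"
      by (rule has_vector_derivative_real_field)
  qed auto
  moreover have "exp ?w = 1"
    using cis_multiple_2pi[of "of_int j"] by (simp add: cis_conv_exp mult_ac)
  ultimately show ?thesis unfolding eq using False by (simp add: integral_unique)
qed simp

text \<open>Both sides are continuous and 1-periodic in x. The Fourier coefficients of the left side
  unfold to Gaussian transforms, those of the right side follow from orthogonality, and they
  agree.\<close>

theorem gaussian_poisson_summation:
  fixes a x :: real
  assumes a: "a > 0"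
  shows "(\<Sum>\<^sub>\<infinity>n::int. complex_of_real (exp (- (pi * a * (of_int n + x)\<^sup>2)))) =
     of_real (1 / sqrt a) * (\<Sum>\<^sub>\<infinity>n::int. of_real (exp (- (pi * (of_int n)\<^sup>2 / a))) * cis (2 * pi * of_int n * x))"
proof -
  define f where "f n x = complex_of_real (exp (- (pi * a * (of_int n + x)\<^sup>2)))" for n :: int and x
  define g where "g n x = complex_of_real (exp (- (pi * (of_int n)\<^sup>2 / a)) / sqrt a) * cis (2 * pi * of_int n * x)"
    for n :: int and x
  \<comment> \<open>On [0,1] one has (n + x)^2 >= |n| - 1; the factor \<open>exp (pi * a)\<close>
    pays for the -1.\<close>
  define M1 where "M1 n = exp (pi * a) * exp (- (pi * a) * \<bar>of_int n\<bar>)" for n :: int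
  define M2 where "M2 n = 1 / sqrt a * exp (- (pi / a) * \<bar>of_int n\<bar>)" for n :: int
  have M1: "M1 summable_on UNIV" and M2: "M2 summable_on UNIV"
    unfolding M1_def M2_def using a
    by (intro summable_on_cmult_right summable_on_exp_abs_int; simp)+
  have f_le: "norm (f n x) \<le> M1 n" if "x \<in> {0..1}" for n x
  proof -
    have "\<bar>of_int n\<bar> - 1 \<le> (real_of_int n + x)\<^sup>2"
    proof (cases "n \<ge> 0")
      case True
      have "(real_of_int n)\<^sup>2 \<le> (real_of_int n + x)\<^sup>2"
        using True that by (intro power_mono) auto
      moreover have "\<bar>real_of_int n\<bar> - 1 \<le> (real_of_int n)\<^sup>2"
        using abs_of_int_le_square[of n] by linarith
      ultimately show ?thesis by linarith
    next
      case False
      \<comment> \<open>For negative n the point of [n, n+1] closest to 0 is n + 1 = -m, hence (n +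
        x)^2 >= m^2 >= |n| - 1.\<close>
      define m where "m = - n - 1"
      have m: "m \<ge> 0" "real_of_int n = - real_of_int m - 1" using False by (auto simp: m_def)
      have "(real_of_int m)\<^sup>2 \<le> (- (real_of_int n + x))\<^sup>2"
        using m that by (intro power_mono) auto
      moreover have "\<bar>real_of_int n\<bar> - 1 = \<bar>real_of_int m\<bar>"
        using m by simp
      moreover have "(- (real_of_int n + x))\<^sup>2 = (real_of_int n + x)\<^sup>2"
        by (rule power2_minus)
      ultimately show ?thesis using abs_of_int_le_square[of m] by linarith
    qed
    then have "pi * a * (\<bar>of_int n\<bar> - 1) \<le> pi * a * (real_of_int n + x)\<^sup>2"
      using a by (intro mult_left_mono) auto
    then show ?thesis
      unfolding f_def M1_def by (simp add: exp_add [symmetric] algebra_simps)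
  qed
  have g_le: "norm (g n x) \<le> M2 n" for n x
  proof -
    have "pi / a * \<bar>real_of_int n\<bar> \<le> pi / a * (real_of_int n)\<^sup>2"
      using a by (intro mult_left_mono abs_of_int_le_square) auto
    then have "exp (- (pi * (real_of_int n)\<^sup>2 / a)) / sqrt a \<le> exp (- (pi / a) * \<bar>real_of_int n\<bar>) / sqrt a"
      using a by (intro divide_right_mono) auto
    then show ?thesis using a
      unfolding g_def M2_def norm_mult norm_of_real norm_cis by simp
  qed
  have f_cont: "continuous_on A (f n)" and g_cont: "continuous_on A (g n)" for n A
    unfolding f_def g_def by (intro continuous_intros)+
  define D where "D x = (\<Sum>\<^sub>\<infinity>n. f n x) - (\<Sum>\<^sub>\<infinity>n. g n x)" for x
  note fi = infsum_unit_interval(1)[OF f_cont f_le M1]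
  note gi = infsum_unit_interval(1)[OF g_cont g_le M2]
  have "fourier_null D"
    unfolding fourier_null_def
  proof (intro conjI allI)
    show "continuous_on {0..1} D"
      unfolding D_def by (intro continuous_intros fi gi)
    fix k :: int
    let ?e = "\<lambda>x. cis (2 * pi * of_int k * x)"
    have ec: "continuous_on A ?e" for A by (intro continuous_intros)
    have F: "((\<lambda>n. integral {0..1} (\<lambda>x. f n x * ?e x)) has_sum
        integral {0..1} (\<lambda>x. \<Sum>\<^sub>\<infinity>n. f n x * ?e x)) UNIV"
      by (rule infsum_unit_interval(2)[OF continuous_on_mult[OF f_cont ec] _ M1])
         (use f_le in \<open>simp add: norm_mult\<close>)
    have G: "((\<lambda>n. integral {0..1} (\<lambda>x. g n x * ?e x)) has_sum
        integral {0..1} (\<lambda>x. \<Sum>\<^sub>\<infinity>n. g n x * ?e x)) UNIV"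
      by (rule infsum_unit_interval(2)[OF continuous_on_mult[OF g_cont ec] _ M2])
         (use g_le in \<open>simp add: norm_mult\<close>)
    let ?\<phi> = "\<lambda>x. of_real (exp (- (pi * a * x\<^sup>2))) * cis (2 * pi * of_int k * x)"
    have cf: "integral {0..1} (\<lambda>x. f n x * ?e x) = integral {0..1} (\<lambda>x. ?\<phi> (of_int n + x))" for n
    proof -
      have "?e (of_int n + x) = ?e x" for x
      proof -
        have "?e (of_int n + x) = cis (2 * pi * of_int (k * n)) * ?e x"
          unfolding cis_mult by (simp add: algebra_simps)
        also have "cis (2 * pi * of_int (k * n)) = 1"
          by (rule cis_multiple_2pi) auto
        finally show ?thesis by simp
      qed
      then show ?thesis unfolding f_def by simp
    qed
    have "((\<lambda>n::int. integral {0..1} (\<lambda>x. ?\<phi> (of_int n + x))) has_sum integral\<^sup>L lborel ?\<phi>) UNIV"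
    proof (rule has_sum_unit_translates)
      show "continuous_on UNIV ?\<phi>" by (intro continuous_intros)
      show "integrable lborel ?\<phi>"
        using has_bochner_integral_gaussian_cis[OF a, of "of_int k"] by (simp add: has_bochner_integral_iff)
      show "(\<lambda>n::int. integral {0..1} (\<lambda>x. ?\<phi> (of_int n + x))) summable_on UNIV"
        using F unfolding cf summable_on_def by blast
    qed
    then have "integral {0..1} (\<lambda>x. \<Sum>\<^sub>\<infinity>n. f n x * ?e x) = integral\<^sup>L lborel ?\<phi>"
      using F unfolding cf by (rule has_sum_unique[rotated])
    also have "\<dots> = of_real (exp (- (pi * (of_int k)\<^sup>2 / a)) / sqrt a)"
      using has_bochner_integral_gaussian_cis[OF a, of "of_int k"] by (simp add: has_bochner_integral_iff)
    finally have IF: "integral {0..1} (\<lambda>x. \<Sum>\<^sub>\<infinity>n. f n x * ?e x) = of_real (exp (- (pi * (of_int k)\<^sup>2 / a)) / sqrt a)" .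
    \<comment> \<open>Orthogonality leaves only n = -k. The Gaussian coefficient is even, so it can
      be written with k.\<close>
    have cg: "integral {0..1} (\<lambda>x. g n x * ?e x) =
        (if n = - k then of_real (exp (- (pi * (of_int k)\<^sup>2 / a)) / sqrt a) else 0)" for n
    proof -
      have "g n x * ?e x = of_real (exp (- (pi * (of_int n)\<^sup>2 / a)) / sqrt a) * cis (2 * pi * of_int (n + k) * x)" for x
        unfolding g_def by (simp add: mult.assoc cis_mult algebra_simps)
      then show ?thesis by (simp only: integral_mult_right integral_cis_unit_interval) auto
    qed
    have "((\<lambda>n. integral {0..1} (\<lambda>x. g n x * ?e x)) has_sum of_real (exp (- (pi * (of_int k)\<^sup>2 / a)) / sqrt a)) UNIV"
      unfolding cg by (rule has_sum_finite_neutralI[of "{-k}"]) auto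
    then have IG: "integral {0..1} (\<lambda>x. \<Sum>\<^sub>\<infinity>n. g n x * ?e x) = of_real (exp (- (pi * (of_int k)\<^sup>2 / a)) / sqrt a)"
      using G by (rule has_sum_unique[rotated])
    have "D x * ?e x = (\<Sum>\<^sub>\<infinity>n. f n x * ?e x) - (\<Sum>\<^sub>\<infinity>n. g n x * ?e x)" for x
      unfolding D_def by (simp add: infsum_cmult_left' left_diff_distrib)
    moreover have "continuous_on {0..1} (\<lambda>x. \<Sum>\<^sub>\<infinity>n. f n x * ?e x)" "continuous_on {0..1} (\<lambda>x. \<Sum>\<^sub>\<infinity>n. g n x * ?e x)"
      unfolding infsum_cmult_left'
      using continuous_on_mult[OF fi ec] continuous_on_mult[OF gi ec] by auto
    ultimately show "integral {0..1} (\<lambda>x. D x * ?e x) = 0"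
      using IF IG by (simp add: Henstock_Kurzweil_Integration.integral_diff integrable_continuous_interval)
  qed
  moreover have f1: "(\<Sum>\<^sub>\<infinity>n. f n (x + of_int k)) = (\<Sum>\<^sub>\<infinity>n. f n x)" for x k
  proof -
    have "bij_betw (\<lambda>n. n + k) UNIV UNIV"
      by (rule bij_betwI[of _ _ _ "\<lambda>n. n - k"]) auto
    from infsum_reindex_bij_betw[OF this, of "\<lambda>n. f n x"]
    show ?thesis by (simp add: f_def add_ac)
  qed
  moreover have g1: "g n (x + of_int k) = g n x" for n x k
  proof -
    have "cis (2 * pi * of_int n * (x + of_int k)) = cis (2 * pi * of_int n * x) * cis (2 * pi * of_int (n * k))"
      unfolding cis_mult by (simp add: algebra_simps)
    also have "cis (2 * pi * of_int (n * k)) = 1"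
      by (rule cis_multiple_2pi) auto
    finally show ?thesis by (simp add: g_def)
  qed
  moreover have "D 0 = D 1"
    using f1[of 0 1] g1[of _ 0 1] by (simp add: D_def)
  ultimately have D0: "D x = 0" if "x \<in> {0..1}" for x
    using that fourier_null_eq_0 by blast
  \<comment> \<open>\<open>fourier_null_eq_0\<close> speaks of [0,1] only; periodicity carries the
    result to every real x.\<close>
  have "D x = D (frac x)"
    using f1[of "frac x" "\<lfloor>x\<rfloor>"] g1[of _ "frac x" "\<lfloor>x\<rfloor>"] by (simp add: D_def frac_def)
  also have "\<dots> = 0"
    by (rule D0) (use frac_lt_1[of x] in \<open>auto simp: less_imp_le\<close>)
  finally have "(\<Sum>\<^sub>\<infinity>n. f n x) = (\<Sum>\<^sub>\<infinity>n. g n x)"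
    by (simp add: D_def)
  also have "(\<lambda>n. g n x) = (\<lambda>n. of_real (1 / sqrt a) * (of_real (exp (- (pi * (of_int n)\<^sup>2 / a))) * cis (2 * pi * of_int n * x)))"
    unfolding g_def by (simp add: mult_ac)
  finally show ?thesis unfolding f_def infsum_cmult_right' .
qed

section \<open>Lattice sums and the theta inversion formula\<close>

lemma has_vector_derivative_lebesgue_integral:
  fixes \<phi> \<phi>' :: "real \<Rightarrow> 'a \<Rightarrow> complex"
  assumes e: "e > 0"
    and d: "\<And>h p. \<bar>h\<bar> < e \<Longrightarrow> p \<in> space M \<Longrightarrow> ((\<lambda>h. \<phi> h p) has_vector_derivative \<phi>' h p) (at h)"
    and D: "\<And>h p. \<bar>h\<bar> < e \<Longrightarrow> p \<in> space M \<Longrightarrow> norm (\<phi>' h p) \<le> D p" "integrable M D"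
    and int: "\<And>h. \<bar>h\<bar> < e \<Longrightarrow> integrable M (\<phi> h)"
    and meas: "\<phi>' 0 \<in> borel_measurable M"
  shows "((\<lambda>h. LINT p|M. \<phi> h p) has_vector_derivative (LINT p|M. \<phi>' 0 p)) (at 0)"
proof -
  let ?S = "{-e<..<e}"
  have int': "integrable M (\<phi>' 0)"
    by (rule Bochner_Integration.integrable_bound[OF D(2) meas]) (use D(1)[of 0] e in force)
  have lip: "norm (\<phi> h p - \<phi> 0 p) \<le> D p * \<bar>h\<bar>" if h: "h \<in> ?S" and p: "p \<in> space M" for h p
  proof -
    \<comment> \<open>The mean value inequality turns the bound on the derivative over the whole
      interval into a bound on difference quotients. With the derivative at 0 subtracted, 2 D is the
      majorant used below.\<close>
    have "norm (\<phi> h p - \<phi> 0 p) \<le> D p * norm (h - 0)"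
    proof (rule differentiable_bound[where S = ?S and f = "\<lambda>h. \<phi> h p" and f' = "\<lambda>h t. t *\<^sub>R \<phi>' h p"])
      fix x assume "x \<in> ?S"
      then have x: "\<bar>x\<bar> < e" by auto
      show "((\<lambda>h. \<phi> h p) has_derivative (\<lambda>t. t *\<^sub>R \<phi>' x p)) (at x within ?S)"
        using d[OF x p] by (auto simp: has_vector_derivative_def intro: has_derivative_at_withinI)
      show "onorm (\<lambda>t. t *\<^sub>R \<phi>' x p) \<le> D p"
        by (rule onorm_bound) (use D(1)[OF x p] order_trans[OF norm_ge_zero D(1)[OF x p]] in
            \<open>auto simp: mult.commute[of "D p"] intro: mult_left_mono\<close>)
    qed (use h e in auto)
    then show ?thesis by simp
  qed
  let ?s = "\<lambda>h p. (1 / norm (h - 0)) *\<^sub>R (\<phi> h p - (\<phi> 0 p + (h - 0) *\<^sub>R \<phi>' 0 p))"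
  let ?G = "\<lambda>h. (1 / norm (h - 0)) *\<^sub>R ((LINT p|M. \<phi> h p) - ((LINT p|M. \<phi> 0 p) + (h - 0) *\<^sub>R (LINT p|M. \<phi>' 0 p)))"
  have eq: "?s h p = (1 / \<bar>h\<bar>) *\<^sub>R (\<phi> h p - \<phi> 0 p - h *\<^sub>R \<phi>' 0 p)" for h p
    by simp
  have bound: "norm (?s h p) \<le> 2 * D p" if h: "h \<in> ?S - {0}" and p: "p \<in> space M" for h p
  proof -
    have "norm (\<phi> h p - \<phi> 0 p - h *\<^sub>R \<phi>' 0 p) \<le> D p * \<bar>h\<bar> + \<bar>h\<bar> * D p"
      using lip[of h p] h p D(1)[of 0 p] e
      by (intro order_trans[OF norm_triangle_ineq4[of "\<phi> h p - \<phi> 0 p"]] add_mono) (auto intro: mult_left_mono)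
    then show ?thesis using h unfolding eq norm_scaleR by (simp add: field_simps)
  qed
  have "(?G \<longlongrightarrow> 0) (at 0 within ?S)"
    unfolding tendsto_at_iff_sequentially
  proof (intro allI impI)
    fix X :: "nat \<Rightarrow> real" assume X: "\<forall>i. X i \<in> ?S - {0}" "X \<longlonglongrightarrow> 0"
    have "(\<lambda>i. LINT p|M. ?s (X i) p) \<longlonglongrightarrow> (LINT p|M. 0)"
    proof (rule integral_dominated_convergence[where w = "\<lambda>p. 2 * D p"])
      show "integrable M (\<lambda>p. 2 * D p)" using D(2) by simp
      have "integrable M (?s (X i))" for i
        using spec[OF X(1), of i] int[of "X i"] int[of 0] int' e unfolding eq
        by (intro Bochner_Integration.integrable_diff integrable_scaleR_right) auto
      then show "?s (X i) \<in> borel_measurable M" for i by (rule borel_measurable_integrable)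
      show "AE p in M. (\<lambda>i. ?s (X i) p) \<longlonglongrightarrow> 0"
      proof (rule AE_I2)
        fix p assume "p \<in> space M"
        then have "((\<lambda>h. \<phi> h p) has_derivative (\<lambda>t. t *\<^sub>R \<phi>' 0 p)) (at 0 within ?S)"
          using d[of 0 p] e by (auto simp: has_vector_derivative_def intro: has_derivative_at_withinI)
        then have "((\<lambda>h. ?s h p) \<longlongrightarrow> 0) (at 0 within ?S)"
          unfolding has_derivative_within by blast
        then show "(\<lambda>i. ?s (X i) p) \<longlonglongrightarrow> 0"
          using X unfolding tendsto_at_iff_sequentially o_def by blast
      qed
      show "AE p in M. norm (?s (X i) p) \<le> 2 * D p" for i
        using bound X(1) by (intro AE_I2) blast
    qed auto
    moreover have "(LINT p|M. ?s (X i) p) = ?G (X i)" for i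
    proof -
      have "integrable M (\<phi> (X i))" "integrable M (\<phi> 0)" using int spec[OF X(1), of i] e by auto
      then show ?thesis using int'
        by (simp add: Bochner_Integration.integral_diff Bochner_Integration.integral_add)
    qed
    ultimately have "(\<lambda>i. ?G (X i)) \<longlonglongrightarrow> (LINT p|M. 0)" by (simp only:)
    then show "(?G \<circ> X) \<longlonglongrightarrow> 0"
      unfolding o_def by (simp only: Bochner_Integration.integral_zero)
  qed
  then have "((\<lambda>h. LINT p|M. \<phi> h p) has_vector_derivative (LINT p|M. \<phi>' 0 p)) (at 0 within ?S)"
    unfolding has_vector_derivative_def has_derivative_within
    by (simp add: bounded_linear_scaleR_left)
  moreover have "at 0 within ?S = at 0"
    by (rule at_within_open) (use e in auto)
  ultimately show ?thesis by simp
qed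

text \<open>Reads an absolutely convergent sum as an integral over counting measure, so that
  differentiation under the integral, domination and Fubini cover lattice sums and integrals in x
  alike.\<close>

lemma integral_count_space_eq_infsum:
  fixes f :: "'a \<Rightarrow> complex"
  assumes "(\<lambda>x. norm (f x)) summable_on A"
  shows "integrable (count_space A) f" "(LINT x|count_space A. f x) = infsum f A"
proof -
  have f: "Infinite_Set_Sum.abs_summable_on f A"
    using assms abs_summable_equivalent by blast
  then show "integrable (count_space A) f"
    by (simp add: Infinite_Set_Sum.abs_summable_on_def)
  from infsetsum_infsum[OF f] show "(LINT x|count_space A. f x) = infsum f A"
    by (simp add: infsetsum_def)
qed

lemma integrable_count_space_real:
  fixes D :: "'a \<Rightarrow> real"
  assumes "D summable_on A"
  shows "integrable (count_space A) D"
  using assms summable_on_iff_abs_summable_on_real abs_summable_equivalent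
    Infinite_Set_Sum.abs_summable_on_def by blast

lemma has_vector_derivative_infsum:
  fixes \<phi> \<phi>' :: "real \<Rightarrow> 'a \<Rightarrow> complex"
  assumes e: "e > 0"
    and d: "\<And>h p. \<bar>h\<bar> < e \<Longrightarrow> p \<in> A \<Longrightarrow> ((\<lambda>h. \<phi> h p) has_vector_derivative \<phi>' h p) (at h)"
    and D: "\<And>h p. \<bar>h\<bar> < e \<Longrightarrow> p \<in> A \<Longrightarrow> norm (\<phi>' h p) \<le> D p" "D summable_on A"
    and int: "\<And>h p. \<bar>h\<bar> < e \<Longrightarrow> p \<in> A \<Longrightarrow> norm (\<phi> h p) \<le> E p" "E summable_on A"
  shows "((\<lambda>h. infsum (\<phi> h) A) has_vector_derivative infsum (\<phi>' 0) A) (at 0)"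
proof -
  have sm: "(\<lambda>x. norm (\<phi> h x)) summable_on A" if "\<bar>h\<bar> < e" for h
    using int(1)[OF that] int(2) by (intro Infinite_Sum.abs_summable_on_comparison_test'[of E]) auto
  have sm': "(\<lambda>x. norm (\<phi>' 0 x)) summable_on A"
    using D e by (intro Infinite_Sum.abs_summable_on_comparison_test'[of D]) auto
  have "integrable (count_space A) D"
    by (rule integrable_count_space_real[OF D(2)])
  then have "((\<lambda>h. LINT p|count_space A. \<phi> h p) has_vector_derivative (LINT p|count_space A. \<phi>' 0 p)) (at 0)"
    using d D(1) sm by (intro has_vector_derivative_lebesgue_integral[OF e])
      (auto intro: integral_count_space_eq_infsum)
  then have "((\<lambda>h. LINT p|count_space A. \<phi> h p) has_vector_derivative infsum (\<phi>' 0) A) (at 0)"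
    using integral_count_space_eq_infsum(2)[OF sm'] by simp
  then show ?thesis
    by (rule has_vector_derivative_transform_within_open[of _ _ _ "{-e<..<e}"])
       (use e sm in \<open>auto simp: integral_count_space_eq_infsum(2)\<close>)
qed

section \<open>Lattice points, the quadratic form and locally uniform bounds\<close>

definition lattice_pt :: "complex \<Rightarrow> int \<times> int \<Rightarrow> complex" where
  "lattice_pt z p = of_int (fst p) * z + of_int (snd p)"

definition qform :: "complex \<Rightarrow> int \<times> int \<Rightarrow> real" where
  "qform z p = (cmod (lattice_pt z p))\<^sup>2 / Im z"

text \<open>A size of lattice points that is independent of z and for which
  \<open>exp (- \<beta> * height p)\<close> is a product over the two coordinates; such products
  dominate the theta sums.\<close>

definition height :: "int \<times> int \<Rightarrow> real" where
  "height p = \<bar>of_int (fst p)\<bar> + \<bar>of_int (snd p)\<bar>"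

lemma height_nonneg: "height p \<ge> 0"
  by (simp add: height_def)

lemma height_ge_1: "p \<noteq> (0, 0) \<Longrightarrow> height p \<ge> 1"
proof -
  assume "p \<noteq> (0, 0)"
  then have "\<bar>fst p\<bar> + \<bar>snd p\<bar> \<ge> 1" by (cases p) auto
  then have "real_of_int (\<bar>fst p\<bar> + \<bar>snd p\<bar>) \<ge> 1" by linarith
  then show ?thesis by (simp add: height_def)
qed

lemma height_le_square: "height p \<le> (height p)\<^sup>2"
  using height_ge_1[of p] self_le_power[of "height p" 2] by (cases "p = (0, 0)") (auto simp: height_def)

lemma summable_on_exp_height:
  assumes "\<beta> > 0"
  shows "(\<lambda>p. exp (- \<beta> * height p)) summable_on UNIV"
proof -
  let ?g = "\<lambda>n::int. exp (- \<beta> * \<bar>real_of_int n\<bar>)"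
  have s: "?g summable_on UNIV" by (rule summable_on_exp_abs_int) fact
  have "(\<lambda>p. exp (- \<beta> * height p)) summable_on (UNIV \<times> UNIV)"
  proof (rule summable_on_SigmaI)
    fix m :: int
    have "((\<lambda>n. ?g m * ?g n) has_sum (?g m * infsum ?g UNIV)) UNIV"
      by (intro has_sum_cmult_right has_sum_infsum s)
    then show "((\<lambda>n. exp (- \<beta> * height (m, n))) has_sum (?g m * infsum ?g UNIV)) UNIV"
      by (simp add: height_def exp_add [symmetric] algebra_simps)
    show "(\<lambda>m. ?g m * infsum ?g UNIV) summable_on UNIV"
      by (intro summable_on_cmult_left s)
  qed auto
  then show ?thesis by simp
qed

text \<open>With u = mz + n one has |m| <= |u| / Im z and |n| <= |u| + |m| |z|, so the height is
  bounded by a multiple of |u|, uniformly near z0. Integrality (\<open>height_le_square\<close>)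
  replaces the squared height by the height, which suffices for exponential sums.\<close>

lemma lattice_local_bound:
  assumes "Im z0 > 0"
  obtains r c B where "r > 0" "c > 0" "B > 0"
    and "\<And>z. z \<in> ball z0 r \<Longrightarrow> Im z > Im z0 / 2"
    and "\<And>z p. z \<in> ball z0 r \<Longrightarrow> c * height p \<le> qform z p"
    and "\<And>z p. z \<in> ball z0 r \<Longrightarrow> cmod (lattice_pt z p) \<le> B * height p"
proof -
  \<comment> \<open>Half of Im z0 keeps Im z between r and 3 r on the ball.\<close>
  define r where "r = Im z0 / 2"
  define X where "X = cmod z0 + r"
  define \<kappa> where "\<kappa> = 1 + (1 + X) / r"
  have r: "r > 0" using assms by (simp add: r_def)
  have X: "X \<ge> 0" using r by (simp add: X_def)
  have \<kappa>: "\<kappa> > 0" using r X by (simp add: \<kappa>_def add_pos_nonneg)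
  have im: "Im z > r" "Im z < 3 * r" "cmod z \<le> X" if "z \<in> ball z0 r" for z
  proof -
    have "\<bar>Im z - Im z0\<bar> < r"
      using that abs_Im_le_cmod[of "z0 - z"] by (simp add: dist_norm)
    then show "Im z > r" "Im z < 3 * r" unfolding r_def by (simp_all add: abs_if field_simps split: if_splits)
    show "cmod z \<le> X" using that norm_triangle_sub[of z z0]
      by (simp add: X_def dist_norm norm_minus_commute)
  qed
  show ?thesis
  proof (rule that[of r "1 / (\<kappa>\<^sup>2 * (3 * r))" "X + 1"])
    show "Im z > Im z0 / 2" if "z \<in> ball z0 r" for z using im[OF that] by (simp add: r_def)
    fix z p assume z: "z \<in> ball z0 r"
    let ?m = "real_of_int (fst p)" and ?n = "real_of_int (snd p)" and ?u = "lattice_pt z p"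
    have "\<bar>?m\<bar> * Im z \<le> cmod ?u"
      using abs_Im_le_cmod[of ?u] im(1)[OF z] r by (simp add: lattice_pt_def abs_mult)
    moreover have "\<bar>?m\<bar> * r \<le> \<bar>?m\<bar> * Im z" using im(1)[OF z] by (intro mult_left_mono) auto
    ultimately have m: "\<bar>?m\<bar> \<le> cmod ?u / r" using r by (simp add: field_simps)
    have "\<bar>?n\<bar> = cmod (?u - of_int (fst p) * z)" by (simp add: lattice_pt_def)
    also have "\<dots> \<le> cmod ?u + \<bar>?m\<bar> * cmod z"
      by (rule order_trans[OF norm_triangle_ineq4]) (simp add: norm_mult)
    also have "\<dots> \<le> cmod ?u + (cmod ?u / r) * X"
      using m im(3)[OF z] r X by (intro add_mono mult_mono) auto
    finally have "height p \<le> \<kappa> * cmod ?u" using m r unfolding height_def \<kappa>_def by (simp add: field_simps)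
    then have "(height p)\<^sup>2 \<le> (\<kappa> * cmod ?u)\<^sup>2" by (intro power_mono height_nonneg)
    then have h: "height p \<le> \<kappa>\<^sup>2 * (cmod ?u)\<^sup>2"
      using height_le_square[of p] by (simp add: power_mult_distrib)
    have "1 / (\<kappa>\<^sup>2 * (3 * r)) * height p \<le> 1 / (\<kappa>\<^sup>2 * (3 * r)) * (\<kappa>\<^sup>2 * (cmod ?u)\<^sup>2)"
      using h \<kappa> r by (intro mult_left_mono) auto
    also have "\<dots> = (cmod ?u)\<^sup>2 / (3 * r)" using \<kappa> by simp
    also have "\<dots> \<le> qform z p" unfolding qform_def
      using im[OF z] r by (intro divide_left_mono) auto
    finally show "1 / (\<kappa>\<^sup>2 * (3 * r)) * height p \<le> qform z p" .
    have "cmod ?u \<le> \<bar>?m\<bar> * cmod z + \<bar>?n\<bar>"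
      unfolding lattice_pt_def by (rule order_trans[OF norm_triangle_ineq]) (simp add: norm_mult)
    also have "\<dots> \<le> \<bar>?m\<bar> * (X + 1) + \<bar>?n\<bar> * (X + 1)"
      using im(3)[OF z] X by (intro add_mono mult_left_mono) (auto simp: mult_le_cancel_left1)
    finally show "cmod ?u \<le> (X + 1) * height p" by (simp add: height_def algebra_simps)
  qed (use r \<kappa> X in auto)
qed

text \<open>Half of the exponential is spent on the power: w^k / k! is one term of the series of exp
  w for w = \<delta> x / 2.\<close>

lemma power_mult_exp_le:
  fixes x \<delta> :: real
  assumes "x \<ge> 0" "\<delta> > 0"
  shows "x ^ k * exp (- (\<delta> * x)) \<le> fact k * (2 / \<delta>) ^ k * exp (- (\<delta> / 2 * x))"
proof -
  define w where "w = \<delta> / 2 * x"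
  have w: "w \<ge> 0" using assms by (simp add: w_def)
  have "w ^ k / fact k \<le> (\<Sum>n<Suc k. w ^ n / fact n)"
    using w by (intro member_le_sum) auto
  also have "\<dots> \<le> (\<Sum>n. w ^ n / fact n)"
    using w summable_exp[of w] by (intro sum_le_suminf) (auto simp: divide_inverse mult.commute)
  also have "\<dots> = exp w" by (simp add: exp_def scaleR_conv_of_real divide_inverse mult.commute)
  finally have "w ^ k \<le> fact k * exp w" by (simp add: field_simps)
  then have "(2 / \<delta>) ^ k * w ^ k * exp (- (2 * w)) \<le> (2 / \<delta>) ^ k * (fact k * exp w) * exp (- (2 * w))"
    using assms by (intro mult_right_mono mult_left_mono) auto
  also have "(2 / \<delta>) ^ k * w ^ k = x ^ k"
    using assms by (simp add: w_def power_mult_distrib [symmetric])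
  also have "(2 / \<delta>) ^ k * (fact k * exp w) * exp (- (2 * w)) = fact k * (2 / \<delta>) ^ k * (exp w * exp (- (2 * w)))"
    by (simp add: mult_ac)
  also have "exp w * exp (- (2 * w)) = exp (- w)" by (simp add: exp_add [symmetric])
  also have "2 * w = \<delta> * x" by (simp add: w_def)
  finally show ?thesis unfolding w_def .
qed

lemma summable_on_exp_qform:
  assumes "Im z > 0" "t > 0"
  shows "(\<lambda>p. exp (- (pi * t * qform z p))) summable_on UNIV"
proof -
  obtain r c B where "r > 0" "c > 0" and c: "\<And>w p. w \<in> ball z r \<Longrightarrow> c * height p \<le> qform w p"
    using lattice_local_bound[OF assms(1)] by metis
  have "(\<lambda>p. norm (exp (- (pi * t * qform z p)))) summable_on UNIV"
  proof (rule Infinite_Sum.abs_summable_on_comparison_test')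
    show "(\<lambda>p. exp (- (pi * t * c) * height p)) summable_on UNIV"
      using assms \<open>c > 0\<close> by (intro summable_on_exp_height) auto
    fix p
    have "pi * t * (c * height p) \<le> pi * t * qform z p"
      using c[of z p] assms \<open>r > 0\<close> by (intro mult_left_mono) auto
    then show "norm (exp (- (pi * t * qform z p))) \<le> exp (- (pi * t * c) * height p)"
      by (simp add: mult_ac)
  qed
  then show ?thesis by simp
qed

text \<open>One-dimensional Poisson summation in each of the two lattice coordinates.\<close>

theorem theta_inversion:
  assumes z: "Im z > 0" and t: "t > 0"
  shows "(\<Sum>\<^sub>\<infinity>p. complex_of_real (exp (- (pi * t * qform z p)))) =
     of_real (1 / t) * (\<Sum>\<^sub>\<infinity>p. complex_of_real (exp (- (pi * (1 / t) * qform z p))))"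
proof -
  define x y where "x = Re z" and "y = Im z"
  have y: "y > 0" using z by (simp add: y_def)
  have q: "qform z (m, n) = ((of_int n + of_int m * x)\<^sup>2 + (of_int m)\<^sup>2 * y\<^sup>2) / y" for m n
    unfolding qform_def lattice_pt_def cmod_power2 x_def y_def
    by (simp add: power_mult_distrib add.commute)
  define E where "E s m n = complex_of_real (exp (- (pi * s * qform z (m, n))))" for s m n
  have sE: "(\<lambda>(m, n). E s m n) summable_on UNIV \<times> UNIV" if "s > 0" for s
  proof -
    have "(\<lambda>p. complex_of_real (exp (- (pi * s * qform z p)))) summable_on UNIV"
      by (intro summable_on_of_real summable_on_exp_qform z that)
    then show ?thesis by (simp add: E_def case_prod_unfold)
  qed
  define A where "A m = complex_of_real (exp (- (pi * (t * y) * (of_int m)\<^sup>2)))" for m :: int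
  define B where "B n = complex_of_real (exp (- (pi * (y / t) * (of_int n)\<^sup>2)))" for n :: int
  define C where "C m n = cis (2 * pi * of_int m * (of_int n * x))" for m n :: int
  have C_sym: "C m n = C n m" for m n by (simp add: C_def mult_ac)
  \<comment> \<open>Poisson summation in n for fixed m; the shift by m x becomes the phase
    \<open>C n m\<close>.\<close>
  have inner1: "(\<Sum>\<^sub>\<infinity>n. E t m n) = of_real (sqrt (y / t)) * (\<Sum>\<^sub>\<infinity>n. A m * (B n * C n m))" for m
  proof -
    have "E t m n = A m * of_real (exp (- (pi * (t / y) * (of_int n + of_int m * x)\<^sup>2)))" for n
      unfolding E_def A_def q using y
      by (simp add: exp_add [symmetric] field_simps power2_eq_square flip: of_real_mult)
    then have "(\<Sum>\<^sub>\<infinity>n. E t m n) = A m * (\<Sum>\<^sub>\<infinity>n. of_real (exp (- (pi * (t / y) * (of_int n + of_int m * x)\<^sup>2))))"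
      by (simp add: infsum_cmult_right')
    also have "(\<Sum>\<^sub>\<infinity>n. complex_of_real (exp (- (pi * (t / y) * (of_int n + of_int m * x)\<^sup>2)))) =
        of_real (1 / sqrt (t / y)) * (\<Sum>\<^sub>\<infinity>n. of_real (exp (- (pi * (of_int n)\<^sup>2 / (t / y)))) * cis (2 * pi * of_int n * (of_int m * x)))"
      using y t by (intro gaussian_poisson_summation) auto
    also have "(\<lambda>n::int. of_real (exp (- (pi * (of_int n)\<^sup>2 / (t / y)))) * cis (2 * pi * of_int n * (of_int m * x))) = (\<lambda>n. B n * C n m)"
      unfolding B_def C_def by (simp add: mult_ac)
    also have "1 / sqrt (t / y) = sqrt (y / t)"
      by (simp add: real_sqrt_divide)
    finally show ?thesis by (simp add: infsum_cmult_right' mult_ac)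
  qed
  \<comment> \<open>The phase is symmetric in m and n, so the sum over m is the dual side of another
    Poisson formula, now read backwards. The frequency n takes over the role of the first lattice
    coordinate.\<close>
  have inner2: "(\<Sum>\<^sub>\<infinity>m. A m * (B n * C n m)) = of_real (1 / sqrt (t * y)) * (\<Sum>\<^sub>\<infinity>m. E (1 / t) n m)" for n
  proof -
    have "(\<Sum>\<^sub>\<infinity>m. complex_of_real (exp (- (pi * (1 / (t * y)) * (of_int m + of_int n * x)\<^sup>2)))) =
        of_real (1 / sqrt (1 / (t * y))) * (\<Sum>\<^sub>\<infinity>m. of_real (exp (- (pi * (of_int m)\<^sup>2 / (1 / (t * y))))) * cis (2 * pi * of_int m * (of_int n * x)))"
      using y t by (intro gaussian_poisson_summation) auto
    also have "(\<lambda>m::int. of_real (exp (- (pi * (of_int m)\<^sup>2 / (1 / (t * y))))) * cis (2 * pi * of_int m * (of_int n * x))) = (\<lambda>m. A m * C n m)"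
      unfolding A_def C_sym[of n] by (simp add: C_def mult_ac)
    also have "1 / sqrt (1 / (t * y)) = sqrt (t * y)"
      by (simp add: real_sqrt_divide)
    finally have "(\<Sum>\<^sub>\<infinity>m. A m * C n m) = of_real (1 / sqrt (t * y)) * (\<Sum>\<^sub>\<infinity>m. complex_of_real (exp (- (pi * (1 / (t * y)) * (of_int m + of_int n * x)\<^sup>2))))"
      using y t by (simp add: field_simps)
    then have "B n * (\<Sum>\<^sub>\<infinity>m. A m * C n m) = of_real (1 / sqrt (t * y)) * (\<Sum>\<^sub>\<infinity>m. B n * complex_of_real (exp (- (pi * (1 / (t * y)) * (of_int m + of_int n * x)\<^sup>2))))"
      by (simp add: infsum_cmult_right' mult_ac)
    also have "(\<lambda>m. B n * complex_of_real (exp (- (pi * (1 / (t * y)) * (of_int m + of_int n * x)\<^sup>2)))) = E (1 / t) n"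
      unfolding E_def B_def q using y t
      by (auto simp: exp_add [symmetric] field_simps power2_eq_square simp flip: of_real_mult)
    finally show ?thesis by (simp add: infsum_cmult_right' [symmetric] mult_ac)
  qed
  have "(\<Sum>\<^sub>\<infinity>p. complex_of_real (exp (- (pi * t * qform z p)))) = (\<Sum>\<^sub>\<infinity>m. \<Sum>\<^sub>\<infinity>n. E t m n)"
    using infsum_Sigma'_banach[OF sE[OF t]] by (simp add: E_def case_prod_unfold)
  also have "\<dots> = of_real (sqrt (y / t)) * (\<Sum>\<^sub>\<infinity>m. \<Sum>\<^sub>\<infinity>n. A m * (B n * C n m))"
    unfolding inner1 infsum_cmult_right' ..
  also have "(\<Sum>\<^sub>\<infinity>m. \<Sum>\<^sub>\<infinity>n. A m * (B n * C n m)) = (\<Sum>\<^sub>\<infinity>n. \<Sum>\<^sub>\<infinity>m. A m * (B n * C n m))"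
  proof (rule infsum_swap_banach)
    \<comment> \<open>The interchange rests on absolute convergence: the phase has modulus 1, and
      both Gaussians decay at least like an exponential of rate \<beta>.\<close>
    define \<beta> where "\<beta> = min (pi * (t * y)) (pi * (y / t))"
    have \<beta>: "\<beta> > 0" using y t by (simp add: \<beta>_def)
    have "(\<lambda>p. norm (case p of (m, n) \<Rightarrow> A m * (B n * C n m))) summable_on UNIV \<times> UNIV"
    proof (rule Infinite_Sum.abs_summable_on_comparison_test')
      show "(\<lambda>p. exp (- \<beta> * height p)) summable_on UNIV \<times> UNIV"
        using summable_on_exp_height[OF \<beta>] by simp
      fix p :: "int \<times> int" assume "p \<in> UNIV \<times> UNIV"
      obtain m n where p: "p = (m, n)" by force
      have "\<beta> * \<bar>real_of_int m\<bar> \<le> pi * (t * y) * (of_int m)\<^sup>2" "\<beta> * \<bar>real_of_int n\<bar> \<le> pi * (y / t) * (of_int n)\<^sup>2"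
        using y t abs_of_int_le_square \<beta> by (intro mult_mono; simp add: \<beta>_def)+
      then show "norm (case p of (m, n) \<Rightarrow> A m * (B n * C n m)) \<le> exp (- \<beta> * height p)"
        unfolding p A_def B_def C_def prod.case norm_mult norm_of_real norm_cis height_def
        by (simp add: exp_add [symmetric] algebra_simps)
    qed
    then show "(\<lambda>(m, n). A m * (B n * C n m)) summable_on UNIV \<times> UNIV"
      by (rule abs_summable_summable)
  qed
  also have "\<dots> = of_real (1 / sqrt (t * y)) * (\<Sum>\<^sub>\<infinity>n. \<Sum>\<^sub>\<infinity>m. E (1 / t) n m)"
    unfolding inner2 infsum_cmult_right' ..
  also have "(\<Sum>\<^sub>\<infinity>n. \<Sum>\<^sub>\<infinity>m. E (1 / t) n m) = (\<Sum>\<^sub>\<infinity>p. complex_of_real (exp (- (pi * (1 / t) * qform z p))))"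
    using infsum_Sigma'_banach[OF sE[of "1 / t"]] t by (simp add: E_def case_prod_unfold)
  also have "of_real (sqrt (y / t)) * (of_real (1 / sqrt (t * y)) * S) = of_real (1 / t) * S" for S :: complex
  proof -
    have "sqrt (y / t) * (1 / sqrt (t * y)) = 1 / t"
      using y t by (simp add: real_sqrt_divide real_sqrt_mult)
    then show ?thesis by (metis mult.assoc of_real_mult)
  qed
  finally show ?thesis .
qed

section \<open>Theta series with polynomial factors\<close>

abbreviation lattice :: "(int \<times> int) set" where
  "lattice \<equiv> UNIV - {(0, 0)}"

text \<open>With u = mz + n, differentiating the Gaussian in z, in its conjugate and in x brings
  down multiples of (cnj u)^2, u^2 and u cnj u; the exponents a and b keep track of these
  factors.\<close>

definition theta_term :: "nat \<Rightarrow> nat \<Rightarrow> complex \<Rightarrow> real \<Rightarrow> int \<times> int \<Rightarrow> complex" where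
  "theta_term a b z x p = lattice_pt z p ^ a * cnj (lattice_pt z p) ^ b *
     of_real (exp (- (pi * exp x * qform z p)))"

definition theta :: "nat \<Rightarrow> nat \<Rightarrow> complex \<Rightarrow> real \<Rightarrow> complex" where
  "theta a b z x = infsum (theta_term a b z x) lattice"

text \<open>The height is at least 1 away from the origin, so exp x times the height is at least the
  mean of exp x0 times the height and of exp x. The first half gives convergence over the lattice
  after absorbing the powers of u, the second gives doubly exponential decay in x.\<close>

lemma theta_term_local_bound:
  assumes "Im z0 > 0"
  obtains K \<delta> where "\<delta> > 0"
    and "\<forall>\<^sub>F z in nhds z0. \<forall>x\<ge>x0. \<forall>p\<in>lattice.
           norm (theta_term a b z x p) \<le> K * exp (- (\<delta> * exp x)) * exp (- \<delta> * height p)"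
proof -
  obtain r c B where r: "r > 0" "c > 0" "B > 0"
    and c: "\<And>z p. z \<in> ball z0 r \<Longrightarrow> c * height p \<le> qform z p"
    and B: "\<And>z p. z \<in> ball z0 r \<Longrightarrow> cmod (lattice_pt z p) \<le> B * height p"
    using lattice_local_bound[OF assms] by metis
  \<comment> \<open>\<open>\<delta>1\<close> is the decay rate in the height before the power of the
    height is absorbed, which halves it; \<open>\<delta>\<close> is one rate that serves both decay
    factors.\<close>
  define \<delta>1 where "\<delta>1 = pi * c * exp x0 / 2"
  define \<delta> where "\<delta> = min (\<delta>1 / 2) (pi * c / 2)"
  have \<delta>1: "\<delta>1 > 0" using r by (simp add: \<delta>1_def)
  have \<delta>: "\<delta> > 0" using r \<delta>1 by (simp add: \<delta>_def)
  define K where "K = B ^ (a + b) * (fact (a + b) * (2 / \<delta>1) ^ (a + b))"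
  have "norm (theta_term a b z x p) \<le> K * exp (- (\<delta> * exp x)) * exp (- \<delta> * height p)"
    if z: "z \<in> ball z0 r" and x: "x \<ge> x0" and p: "p \<in> lattice" for z x p
  proof -
    have h: "height p \<ge> 1" using p by (intro height_ge_1) auto
    have "exp x * height p \<ge> exp x0 * height p" "exp x * height p \<ge> exp x"
      using x h by (auto intro: mult_right_mono simp: mult_le_cancel_left1)
    then have "exp x0 / 2 * height p + exp x / 2 \<le> exp x * height p" by linarith
    then have "pi * c * (exp x0 / 2 * height p + exp x / 2) \<le> pi * c * (exp x * height p)"
      using r by (intro mult_left_mono) auto
    also have "\<dots> = pi * exp x * (c * height p)" by simp
    also have "\<dots> \<le> pi * exp x * qform z p"
      using c[OF z] by (intro mult_left_mono) auto
    finally have "\<delta>1 * height p + pi * c / 2 * exp x \<le> pi * exp x * qform z p"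
      by (simp add: \<delta>1_def algebra_simps)
    moreover have "\<delta> * exp x \<le> pi * c / 2 * exp x"
      by (intro mult_right_mono) (auto simp: \<delta>_def)
    ultimately have "- (pi * exp x * qform z p) \<le> - (\<delta>1 * height p) + - (\<delta> * exp x)"
      by linarith
    then have e: "exp (- (pi * exp x * qform z p)) \<le> exp (- (\<delta>1 * height p)) * exp (- (\<delta> * exp x))"
      unfolding exp_add [symmetric] by simp
    have "norm (theta_term a b z x p) = cmod (lattice_pt z p) ^ (a + b) * exp (- (pi * exp x * qform z p))"
      by (simp add: theta_term_def norm_mult norm_power power_add)
    also have "\<dots> \<le> (B * height p) ^ (a + b) * (exp (- (\<delta>1 * height p)) * exp (- (\<delta> * exp x)))"
      using e B[OF z] r h by (intro mult_mono power_mono) auto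
    also have "\<dots> = B ^ (a + b) * (height p ^ (a + b) * exp (- (\<delta>1 * height p))) * exp (- (\<delta> * exp x))"
      by (simp add: power_mult_distrib)
    also have "\<dots> \<le> B ^ (a + b) * (fact (a + b) * (2 / \<delta>1) ^ (a + b) * exp (- (\<delta>1 / 2 * height p))) * exp (- (\<delta> * exp x))"
      using r \<delta>1 h by (intro mult_right_mono mult_left_mono power_mult_exp_le) auto
    also have "\<dots> = K * exp (- (\<delta> * exp x)) * exp (- (\<delta>1 / 2 * height p))"
      by (simp add: K_def mult_ac)
    also have "\<dots> \<le> K * exp (- (\<delta> * exp x)) * exp (- \<delta> * height p)"
    proof -
      have "\<delta> * height p \<le> \<delta>1 / 2 * height p" using h by (intro mult_right_mono) (auto simp: \<delta>_def)
      then show ?thesis using r \<delta>1 by (intro mult_left_mono) (auto simp: K_def)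
    qed
    finally show ?thesis .
  qed
  moreover have "\<forall>\<^sub>F z in nhds z0. z \<in> ball z0 r"
    using r(1) by (intro eventually_nhds_in_open) auto
  ultimately have "\<forall>\<^sub>F z in nhds z0. \<forall>x\<ge>x0. \<forall>p\<in>lattice.
           norm (theta_term a b z x p) \<le> K * exp (- (\<delta> * exp x)) * exp (- \<delta> * height p)"
    by (elim eventually_mono) blast
  with \<delta> show ?thesis by (rule that)
qed

lemma summable_on_exp_height': "\<delta> > 0 \<Longrightarrow> (\<lambda>p. K * exp (- \<delta> * height p)) summable_on A"
  by (rule summable_on_subset_banach[OF summable_on_cmult_right[OF summable_on_exp_height]]) auto

lemma theta_term_abs_summable:
  assumes "Im z > 0"
  shows "(\<lambda>p. norm (theta_term a b z x p)) summable_on lattice"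
proof -
  obtain K \<delta> where \<delta>: "\<delta> > 0" and "\<forall>\<^sub>F w in nhds z. \<forall>t\<ge>x. \<forall>p\<in>lattice.
       norm (theta_term a b w t p) \<le> K * exp (- (\<delta> * exp t)) * exp (- \<delta> * height p)"
    using theta_term_local_bound[OF assms] .
  then show ?thesis
    by (intro Infinite_Sum.abs_summable_on_comparison_test'[OF summable_on_exp_height'[OF \<delta>, of "K * exp (- (\<delta> * exp x))"]])
       (auto dest: eventually_nhds_x_imp_x)
qed

lemma theta_term_summable:
  "Im z > 0 \<Longrightarrow> theta_term a b z x summable_on lattice"
  by (rule abs_summable_summable[OF theta_term_abs_summable])

lemma eventually_upper_half: "Im z > 0 \<Longrightarrow> \<forall>\<^sub>F w in nhds z. Im w > 0"
  by (intro order_tendstoD(1)[of Im "Im z"] tendsto_intros filterlim_ident)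

lemma theta_local_bound:
  assumes "Im z0 > 0"
  obtains K \<delta> where "\<delta> > 0"
    and "\<forall>\<^sub>F z in nhds z0. \<forall>x\<ge>x0. norm (theta a b z x) \<le> K * exp (- (\<delta> * exp x))"
proof -
  obtain K \<delta> where \<delta>: "\<delta> > 0" and K: "\<forall>\<^sub>F z in nhds z0. \<forall>x\<ge>x0. \<forall>p\<in>lattice.
       norm (theta_term a b z x p) \<le> K * exp (- (\<delta> * exp x)) * exp (- \<delta> * height p)"
    using theta_term_local_bound[OF assms] .
  let ?S = "\<Sum>\<^sub>\<infinity>p\<in>lattice. exp (- \<delta> * height p)"
  from K eventually_upper_half[OF assms]
  have "\<forall>\<^sub>F z in nhds z0. \<forall>x\<ge>x0. norm (theta a b z x) \<le> K * ?S * exp (- (\<delta> * exp x))"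
  proof eventually_elim
    case (elim z)
    show ?case
    proof (intro allI impI)
      fix x assume "x0 \<le> x"
      let ?D = "\<lambda>p. K * exp (- (\<delta> * exp x)) * exp (- \<delta> * height p)"
      have "norm (theta a b z x) \<le> infsum ?D lattice"
        unfolding theta_def
      proof (rule norm_infsum_le)
        show "(theta_term a b z x has_sum infsum (theta_term a b z x) lattice) lattice"
          by (intro has_sum_infsum theta_term_summable elim)
        show "(?D has_sum infsum ?D lattice) lattice"
          by (intro has_sum_infsum summable_on_exp_height' \<delta>)
      qed (use elim \<open>x0 \<le> x\<close> in auto)
      also have "\<dots> = K * exp (- (\<delta> * exp x)) * ?S" by (rule infsum_cmult_right')
      finally show "norm (theta a b z x) \<le> K * ?S * exp (- (\<delta> * exp x))" by (simp only: mult_ac)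
    qed
  qed
  with \<delta> show ?thesis by (rule that)
qed

text \<open>Wirtinger derivatives: \<open>A\<close> and \<open>B\<close> play the roles of \<open>\<partial>f/\<partial>z\<close> and \<open>\<partial>f/\<partial>\<bar>z\<close>.\<close>

definition has_wirtinger :: "(complex \<Rightarrow> complex) \<Rightarrow> complex \<Rightarrow> complex \<Rightarrow> complex \<Rightarrow> bool" where
  "has_wirtinger f A B z \<longleftrightarrow>
     (\<forall>v. ((\<lambda>h::real. f (z + of_real h * v)) has_vector_derivative v * A + cnj v * B) (at 0))"

text \<open>\<open>has_wirtinger\<close> differentiates at parameter 0 only, while differentiation
  under the integral asks for the derivative at every nearby point of the line.\<close>

lemma has_wirtingerD:
  assumes "has_wirtinger f A B (z + of_real h * v)"
  shows "((\<lambda>h::real. f (z + of_real h * v)) has_vector_derivative v * A + cnj v * B) (at h)"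
proof -
  have "((\<lambda>k::real. f (z + of_real h * v + of_real k * v)) has_vector_derivative v * A + cnj v * B) (at 0)"
    using assms unfolding has_wirtinger_def by blast
  then have "((\<lambda>k::real. f (z + of_real (k + h) * v)) has_vector_derivative v * A + cnj v * B) (at 0)"
    by (simp add: algebra_simps)
  then have "((\<lambda>h::real. f (z + of_real h * v)) \<circ> (\<lambda>k. k + h) has_vector_derivative v * A + cnj v * B) (at 0)"
    by (simp add: o_def)
  moreover have "((\<lambda>h. h - h0) has_vector_derivative 1) (at h)" for h0 :: real
    by (auto intro!: derivative_eq_intros)
  ultimately have "(((\<lambda>h::real. f (z + of_real h * v)) \<circ> (\<lambda>k. k + h)) \<circ> (\<lambda>k. k - h) has_vector_derivative 1 *\<^sub>R (v * A + cnj v * B)) (at h)"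
    by (intro vector_diff_chain_at) auto
  then show ?thesis by (simp add: o_def)
qed

text \<open>One integrable majorant for all w near z. The notion is stable under sums and continuous
  coefficients, so the domination of a long derivative formula reduces to that of its theta
  factors.\<close>

definition dominated_near :: "'a measure \<Rightarrow> complex \<Rightarrow> (complex \<Rightarrow> 'a \<Rightarrow> complex) \<Rightarrow> bool" where
  "dominated_near M z \<phi> \<longleftrightarrow>
     (\<exists>D. integrable M D \<and> (\<forall>\<^sub>F w in nhds z. \<forall>p\<in>space M. norm (\<phi> w p) \<le> (D p :: real)))"

lemma dominated_near_add:
  assumes "dominated_near M z \<phi>" "dominated_near M z \<psi>"
  shows "dominated_near M z (\<lambda>w p. \<phi> w p + \<psi> w p)"
proof -
  obtain D where D: "integrable M D" "\<forall>\<^sub>F w in nhds z. \<forall>p\<in>space M. norm (\<phi> w p) \<le> D p"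
    using assms(1) unfolding dominated_near_def by blast
  obtain E where E: "integrable M E" "\<forall>\<^sub>F w in nhds z. \<forall>p\<in>space M. norm (\<psi> w p) \<le> E p"
    using assms(2) unfolding dominated_near_def by blast
  from D(2) E(2) have "\<forall>\<^sub>F w in nhds z. \<forall>p\<in>space M. norm (\<phi> w p + \<psi> w p) \<le> D p + E p"
    by eventually_elim (auto intro: norm_triangle_mono)
  then show ?thesis using Bochner_Integration.integrable_add[OF D(1) E(1)]
    unfolding dominated_near_def by blast
qed

lemma dominated_near_mult:
  assumes "isCont c z" "dominated_near M z \<phi>"
  shows "dominated_near M z (\<lambda>w p. c w * \<phi> w p)"
proof -
  obtain D where "integrable M D" and D: "\<forall>\<^sub>F w in nhds z. \<forall>p\<in>space M. norm (\<phi> w p) \<le> D p"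
    using assms(2) unfolding dominated_near_def by blast
  have "((\<lambda>w. norm (c w)) \<longlongrightarrow> norm (c z)) (nhds z)"
    using assms(1) by (intro tendsto_norm) (simp add: isCont_def tendsto_nhds_iff)
  then have "\<forall>\<^sub>F w in nhds z. norm (c w) < norm (c z) + 1"
    by (rule order_tendstoD) simp
  with D have "\<forall>\<^sub>F w in nhds z. \<forall>p\<in>space M. norm (c w * \<phi> w p) \<le> (norm (c z) + 1) * D p"
  proof eventually_elim
    case (elim w)
    then show ?case by (auto simp: norm_mult intro!: mult_mono)
  qed
  then show ?thesis using \<open>integrable M D\<close> unfolding dominated_near_def
    by (intro exI[of _ "\<lambda>p. (norm (c z) + 1) * D p"]) auto
qed

lemma dominated_near_minus:
  "dominated_near M z \<phi> \<Longrightarrow> dominated_near M z (\<lambda>w p. - \<phi> w p)"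
  by (simp add: dominated_near_def)

lemma dominated_near_diff:
  "dominated_near M z \<phi> \<Longrightarrow> dominated_near M z \<psi> \<Longrightarrow> dominated_near M z (\<lambda>w p. \<phi> w p - \<psi> w p)"
  using dominated_near_add[OF _ dominated_near_minus] by simp

lemma dominated_near_integrable:
  assumes "dominated_near M z \<phi>" "\<phi> z \<in> borel_measurable M"
  shows "integrable M (\<phi> z)"
proof -
  obtain D where D: "integrable M D" and "\<forall>\<^sub>F w in nhds z. \<forall>p\<in>space M. norm (\<phi> w p) \<le> D p"
    using assms(1) unfolding dominated_near_def by blast
  then have "\<forall>p\<in>space M. norm (\<phi> z p) \<le> D p" by (blast dest: eventually_nhds_x_imp_x)
  then show ?thesis
    by (intro Bochner_Integration.integrable_bound[OF D assms(2)] AE_I2) force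
qed

text \<open>Each direction v gives an integral with a real parameter, and linearity of the integral
  separates the two coefficients again.\<close>

lemma has_wirtinger_lebesgue_integral:
  assumes \<phi>: "\<forall>\<^sub>F w in nhds z. \<forall>p\<in>space M. has_wirtinger (\<lambda>w. \<phi> w p) (A w p) (B w p) w"
    and dom: "dominated_near M z A" "dominated_near M z B"
    and int: "\<forall>\<^sub>F w in nhds z. integrable M (\<phi> w)"
    and meas: "A z \<in> borel_measurable M" "B z \<in> borel_measurable M"
  shows "has_wirtinger (\<lambda>w. LINT p|M. \<phi> w p) (LINT p|M. A z p) (LINT p|M. B z p) z"
  unfolding has_wirtinger_def
proof
  fix v :: complex
  have "dominated_near M z (\<lambda>w p. v * A w p + cnj v * B w p)"
    by (intro dominated_near_add dominated_near_mult dom continuous_const)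
  then obtain D where D: "integrable M D"
    and D': "\<forall>\<^sub>F w in nhds z. \<forall>p\<in>space M. norm (v * A w p + cnj v * B w p) \<le> D p"
    unfolding dominated_near_def by blast
  have "((\<lambda>h::real. z + of_real h * v) \<longlongrightarrow> z + of_real 0 * v) (nhds 0)"
    by (intro tendsto_intros filterlim_ident)
  then have lim: "filterlim (\<lambda>h::real. z + of_real h * v) (nhds z) (nhds 0)" by simp
  from eventually_compose_filterlim[OF eventually_conj[OF \<phi> eventually_conj[OF D' int]] lim]
  obtain e where e: "e > 0" and E: "\<And>h. \<bar>h\<bar> < e \<Longrightarrow>
      (\<forall>p\<in>space M. has_wirtinger (\<lambda>w. \<phi> w p) (A (z + of_real h * v) p) (B (z + of_real h * v) p) (z + of_real h * v)) \<and>
      (\<forall>p\<in>space M. norm (v * A (z + of_real h * v) p + cnj v * B (z + of_real h * v) p) \<le> D p) \<and>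
      integrable M (\<phi> (z + of_real h * v))"
    unfolding eventually_nhds_metric by (auto simp: dist_norm)
  have "((\<lambda>h. LINT p|M. \<phi> (z + of_real h * v) p) has_vector_derivative
      (LINT p|M. v * A (z + of_real 0 * v) p + cnj v * B (z + of_real 0 * v) p)) (at 0)"
  proof (rule has_vector_derivative_lebesgue_integral[OF e])
    fix h p assume h: "\<bar>h\<bar> < e" and p: "p \<in> space M"
    show "((\<lambda>h. \<phi> (z + of_real h * v) p) has_vector_derivative
       v * A (z + of_real h * v) p + cnj v * B (z + of_real h * v) p) (at h)"
      by (rule has_wirtingerD[where f = "\<lambda>w. \<phi> w p"]) (use E[OF h] p in blast)
  qed (use E D meas in auto)
  then show "((\<lambda>h. LINT p|M. \<phi> (z + of_real h * v) p) has_vector_derivative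
      v * (LINT p|M. A z p) + cnj v * (LINT p|M. B z p)) (at 0)"
    using dom[THEN dominated_near_integrable] meas by simp
qed

abbreviation theta_term_dz where
  "theta_term_dz a b z x p \<equiv>
     of_nat a / (2 * \<i> * of_real (Im z)) * (theta_term a b z x p - theta_term (a - 1) (b + 1) z x p)
       - \<i> * of_real (pi * exp x / (2 * (Im z)\<^sup>2)) * theta_term a (b + 2) z x p"

abbreviation theta_term_dzb where
  "theta_term_dzb a b z x p \<equiv>
     - of_nat b / (2 * \<i> * of_real (Im z)) * (theta_term a b z x p - theta_term (a + 1) (b - 1) z x p)
       + \<i> * of_real (pi * exp x / (2 * (Im z)\<^sup>2)) * theta_term (a + 2) b z x p"

text \<open>The integer m is eliminated through m = (u - cnj u) / (2 i y). In the exponent this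
  makes the z-derivative of u cnj u / y equal to i (cnj u)^2 / (2 y^2), so derivatives remain
  combinations of \<open>theta_term\<close>. Where \<open>a - 1\<close> or \<open>b - 1\<close> is
  truncated at 0, its coefficient \<open>of_nat a\<close> or \<open>of_nat b\<close>
  vanishes.\<close>

lemma theta_term_wirtinger:
  assumes "Im z > 0"
  shows "has_wirtinger (\<lambda>z. theta_term a b z x p)
    (theta_term_dz a b z x p) (theta_term_dzb a b z x p) z"
  unfolding has_wirtinger_def
proof
  fix v :: complex
  define u where "u = lattice_pt z p"
  define w where "w = cnj u"
  define y where "y = complex_of_real (Im z)"
  define m where "m = (of_int (fst p) :: complex)"
  define E where "E = exp (- (of_real (pi * exp x) * (u * w / y)))"
  have y: "y \<noteq> 0" using assms by (simp add: y_def)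
  have m: "m = (u - w) / (2 * \<i> * y)"
  proof -
    have "m * (2 * \<i> * y) = u - w"
      unfolding m_def u_def w_def y_def lattice_pt_def by (simp add: complex_eq_iff)
    then show ?thesis using y by (simp add: eq_divide_eq)
  qed
  have imv: "complex_of_real (Im v) = (v - cnj v) / (2 * \<i>)"
    by (simp add: complex_eq_iff)
  have tt: "theta_term a b (z + of_real h * v) x p =
     (u + of_real h * (m * v)) ^ a * (w + of_real h * (m * cnj v)) ^ b *
      exp (- (of_real (pi * exp x) * ((u + of_real h * (m * v)) * (w + of_real h * (m * cnj v)) / (y + of_real h * of_real (Im v)))))"
    for a b and h :: real
  proof -
    have 1: "lattice_pt (z + of_real h * v) p = u + of_real h * (m * v)"
      unfolding u_def m_def lattice_pt_def by (simp add: algebra_simps)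
    have 2: "cnj (u + of_real h * (m * v)) = w + of_real h * (m * cnj v)"
      unfolding w_def m_def by simp
    have 3: "complex_of_real (qform (z + of_real h * v) p) =
        (u + of_real h * (m * v)) * (w + of_real h * (m * cnj v)) / (y + of_real h * of_real (Im v))"
      unfolding qform_def of_real_divide complex_norm_square 1 2 by (simp add: y_def)
    have "complex_of_real (exp (- (pi * exp x * qform (z + of_real h * v) p))) =
        exp (- (of_real (pi * exp x) * complex_of_real (qform (z + of_real h * v) p)))"
      by (simp add: exp_of_real [symmetric])
    then show ?thesis
      unfolding theta_term_def 1 2 3 by simp
  qed
  have tt0: "theta_term a b z x p = u ^ a * w ^ b * E" for a b
    using tt[of a b 0] by (simp add: E_def)
  \<comment> \<open>Along a line u, \<open>cnj u\<close> and y are affine in h. Reading h as a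
    complex variable gives a function differentiable in the complex sense, in spite of the
    conjugation, and it is then restricted to real h.\<close>
  let ?f = "\<lambda>h. (u + h * (m * v)) ^ a * (w + h * (m * cnj v)) ^ b *
      exp (- (of_real (pi * exp x) * ((u + h * (m * v)) * (w + h * (m * cnj v)) / (y + h * of_real (Im v)))))"
  let ?D = "of_nat a * u ^ (a - 1) * (m * v) * w ^ b * E + u ^ a * (of_nat b * w ^ (b - 1) * (m * cnj v)) * E
     - u ^ a * w ^ b * E * (of_real (pi * exp x) * (((m * v * w + u * (m * cnj v)) * y - u * w * of_real (Im v)) / y\<^sup>2))"
  have "(?f has_field_derivative ?D) (at (of_real 0))"
    using y by (auto intro!: derivative_eq_intros simp: E_def power2_eq_square) (simp add: algebra_simps)
  then have "((\<lambda>h::real. ?f (of_real h)) has_vector_derivative ?D) (at 0)"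
    by (rule has_vector_derivative_real_field)
  moreover have "?D = v * (of_nat a / (2 * \<i> * y) * (u ^ a * w ^ b * E - u ^ (a - 1) * w ^ (b + 1) * E)
       - pi * \<i> * exp x / (2 * y\<^sup>2) * (u ^ a * w ^ (b + 2) * E)) +
       cnj v * (- of_nat b / (2 * \<i> * y) * (u ^ a * w ^ b * E - u ^ (a + 1) * w ^ (b - 1) * E)
       + pi * \<i> * exp x / (2 * y\<^sup>2) * (u ^ (a + 2) * w ^ b * E))"
  proof -
    have 1: "of_nat a * u ^ (a - 1) * (m * v) * w ^ b * E =
        v * (of_nat a / (2 * \<i> * y) * (u ^ a * w ^ b * E - u ^ (a - 1) * w ^ (b + 1) * E))"
      unfolding m by (cases a) (simp_all add: algebra_simps diff_divide_distrib)
    have 2: "u ^ a * (of_nat b * w ^ (b - 1) * (m * cnj v)) * E =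
        cnj v * (- of_nat b / (2 * \<i> * y) * (u ^ a * w ^ b * E - u ^ (a + 1) * w ^ (b - 1) * E))"
      unfolding m by (cases b) (simp_all add: algebra_simps diff_divide_distrib add_divide_distrib)
    have 3: "(m * v * w + u * (m * cnj v)) * y - u * w * of_real (Im v) = (cnj v * u\<^sup>2 - v * w\<^sup>2) / (2 * \<i>)"
      unfolding m imv using y by (simp add: field_simps power2_eq_square)
    have 4: "u ^ a * w ^ b * E * (of_real (pi * exp x) * ((cnj v * u\<^sup>2 - v * w\<^sup>2) / (2 * \<i>) / y\<^sup>2)) =
       v * (pi * \<i> * exp x / (2 * y\<^sup>2) * (u ^ a * w ^ (b + 2) * E)) -
       cnj v * (pi * \<i> * exp x / (2 * y\<^sup>2) * (u ^ (a + 2) * w ^ b * E))"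
      using y by (simp add: field_simps power_add power2_eq_square)
    show ?thesis unfolding 1 2 3 4 by (simp add: algebra_simps)
  qed
  ultimately show "((\<lambda>h. theta_term a b (z + of_real h * v) x p) has_vector_derivative
     v * theta_term_dz a b z x p + cnj v * theta_term_dzb a b z x p) (at 0)"
    unfolding tt tt0 by (simp add: y_def mult_ac)
qed

lemma has_wirtinger_cong:
  assumes "has_wirtinger f A B z" "Im z > 0" "\<And>w. Im w > 0 \<Longrightarrow> f w = g w"
  shows "has_wirtinger g A B z"
  unfolding has_wirtinger_def
proof
  fix v
  have "((\<lambda>h. f (z + complex_of_real h * v)) has_vector_derivative v * A + cnj v * B) (at 0)"
    using assms(1) unfolding has_wirtinger_def by blast
  moreover have "open {h::real. Im (z + of_real h * v) > 0}"
    by (intro open_Collect_less continuous_intros)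
  ultimately show "((\<lambda>h. g (z + complex_of_real h * v)) has_vector_derivative v * A + cnj v * B) (at 0)"
    by (rule has_vector_derivative_transform_within_open) (use assms in auto)
qed

lemma theta_wirtinger:
  assumes z: "Im z > 0"
  shows "has_wirtinger (\<lambda>z. theta a b z x)
    (of_nat a / (2 * \<i> * of_real (Im z)) * (theta a b z x - theta (a - 1) (b + 1) z x)
       - \<i> * of_real (pi * exp x / (2 * (Im z)\<^sup>2)) * theta a (b + 2) z x)
    (- of_nat b / (2 * \<i> * of_real (Im z)) * (theta a b z x - theta (a + 1) (b - 1) z x)
       + \<i> * of_real (pi * exp x / (2 * (Im z)\<^sup>2)) * theta (a + 2) b z x) z"
proof -
  let ?M = "count_space lattice"
  have dom: "dominated_near ?M z (\<lambda>w p. theta_term a b w x p)" for a b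
  proof -
    obtain K \<delta> where \<delta>: "\<delta> > 0" and "\<forall>\<^sub>F w in nhds z. \<forall>t\<ge>x. \<forall>p\<in>lattice.
         norm (theta_term a b w t p) \<le> K * exp (- (\<delta> * exp t)) * exp (- \<delta> * height p)"
      using theta_term_local_bound[OF z] .
    then have "\<forall>\<^sub>F w in nhds z. \<forall>p\<in>space ?M.
         norm (theta_term a b w x p) \<le> K * exp (- (\<delta> * exp x)) * exp (- \<delta> * height p)"
      by (elim eventually_mono) simp
    then show ?thesis
      unfolding dominated_near_def
      using integrable_count_space_real[OF summable_on_exp_height'[OF \<delta>]] by blast
  qed
  have int: "integrable ?M (theta_term a b w x)" "(LINT p|?M. theta_term a b w x p) = theta a b w x"
    if "Im w > 0" for a b w
    using integral_count_space_eq_infsum[OF theta_term_abs_summable[OF that]] by (simp_all add: theta_def)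
  have "has_wirtinger (\<lambda>w. LINT p|?M. theta_term a b w x p)
     (LINT p|?M. theta_term_dz a b z x p) (LINT p|?M. theta_term_dzb a b z x p) z"
  proof (rule has_wirtinger_lebesgue_integral[where A = "\<lambda>w. theta_term_dz a b w x" and B = "\<lambda>w. theta_term_dzb a b w x"])
    have "z \<noteq> 0 \<and> Im z \<noteq> 0" using z by auto
    then show "dominated_near ?M z (\<lambda>w. theta_term_dz a b w x)" "dominated_near ?M z (\<lambda>w. theta_term_dzb a b w x)"
      by (intro dominated_near_add dominated_near_diff dominated_near_mult dom continuous_intros; simp)+
    show "\<forall>\<^sub>F w in nhds z. \<forall>p\<in>space ?M. has_wirtinger (\<lambda>w. theta_term a b w x p)
        (theta_term_dz a b w x p) (theta_term_dzb a b w x p) w"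
      using eventually_upper_half[OF z] by eventually_elim (blast intro: theta_term_wirtinger)
    show "\<forall>\<^sub>F w in nhds z. integrable ?M (theta_term a b w x)"
      using eventually_upper_half[OF z] by eventually_elim (rule int)
  qed auto
  then have "has_wirtinger (\<lambda>w. LINT p|?M. theta_term a b w x p)
    (of_nat a / (2 * \<i> * of_real (Im z)) * (theta a b z x - theta (a - 1) (b + 1) z x)
       - \<i> * of_real (pi * exp x / (2 * (Im z)\<^sup>2)) * theta a (b + 2) z x)
    (- of_nat b / (2 * \<i> * of_real (Im z)) * (theta a b z x - theta (a + 1) (b - 1) z x)
       + \<i> * of_real (pi * exp x / (2 * (Im z)\<^sup>2)) * theta (a + 2) b z x) z"
    using int[OF z] by simp
  then show ?thesis by (rule has_wirtinger_cong[OF _ z int(2)])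
qed

lemma theta_has_vector_derivative:
  assumes z: "Im z > 0"
  shows "((\<lambda>x. theta a b z x) has_vector_derivative
     - (of_real (pi * exp x / Im z) * theta (a + 1) (b + 1) z x)) (at x)"
proof -
  have "\<exists>K \<delta>. \<delta> > 0 \<and> (\<forall>t p. t \<ge> x - 1 \<longrightarrow> p \<in> lattice \<longrightarrow>
      norm (theta_term a b z t p) \<le> K * exp (- \<delta> * height p))" for a b
  proof -
    obtain K \<delta> where \<delta>: "\<delta> > 0" and "\<forall>\<^sub>F w in nhds z. \<forall>t\<ge>x - 1. \<forall>p\<in>lattice.
         norm (theta_term a b w t p) \<le> K * exp (- (\<delta> * exp t)) * exp (- \<delta> * height p)"
      using theta_term_local_bound[OF z] .
    then have K: "norm (theta_term a b z t p) \<le> K * exp (- (\<delta> * exp t)) * exp (- \<delta> * height p)"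
      if "t \<ge> x - 1" "p \<in> lattice" for t p
      using that by (auto dest: eventually_nhds_x_imp_x)
    have "norm (theta_term a b z t p) \<le> \<bar>K\<bar> * exp (- \<delta> * height p)" if "t \<ge> x - 1" "p \<in> lattice" for t p
    proof -
      have "K * exp (- (\<delta> * exp t)) \<le> \<bar>K\<bar> * 1"
        using \<delta> by (intro mult_mono) auto
      then have "K * exp (- (\<delta> * exp t)) * exp (- \<delta> * height p) \<le> \<bar>K\<bar> * exp (- \<delta> * height p)"
        by (intro mult_right_mono) auto
      with K[OF that] show ?thesis by linarith
    qed
    with \<delta> show ?thesis by blast
  qed
  then obtain K \<delta> where \<delta>: "\<And>a b. \<delta> a b > 0"
    and K: "\<And>a b t p. t \<ge> x - 1 \<Longrightarrow> p \<in> lattice \<Longrightarrow> norm (theta_term a b z t p) \<le> K a b * exp (- \<delta> a b * height p)"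
    by metis
  let ?D = "\<lambda>t p. - (of_real (pi * exp t / Im z) * theta_term (a + 1) (b + 1) z t p)"
  have d: "((\<lambda>t. theta_term a b z t p) has_vector_derivative ?D t p) (at t)" for t p
  proof -
    have "((\<lambda>t. exp (- (pi * exp t * qform z p))) has_vector_derivative
       - (pi * exp t * qform z p * exp (- (pi * exp t * qform z p)))) (at t)"
      by (auto intro!: derivative_eq_intros simp flip: has_real_derivative_iff_has_vector_derivative)
    then have "((\<lambda>t. complex_of_real (exp (- (pi * exp t * qform z p)))) has_vector_derivative
       of_real (- (pi * exp t * qform z p * exp (- (pi * exp t * qform z p))))) (at t)"
      by (rule bounded_linear.has_vector_derivative[OF bounded_linear_of_real])
    then have "((\<lambda>t. theta_term a b z t p) has_vector_derivative
       lattice_pt z p ^ a * cnj (lattice_pt z p) ^ b *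
       of_real (- (pi * exp t * qform z p * exp (- (pi * exp t * qform z p))))) (at t)"
      unfolding theta_term_def by (rule has_vector_derivative_mult_right)
    moreover have "complex_of_real (qform z p) = lattice_pt z p * cnj (lattice_pt z p) / Im z"
      unfolding qform_def of_real_divide complex_norm_square ..
    ultimately show ?thesis by (simp add: theta_term_def mult_ac)
  qed
  have "((\<lambda>h. infsum (theta_term a b z (h + x)) lattice) has_vector_derivative
      infsum (?D (0 + x)) lattice) (at 0)"
  proof (rule has_vector_derivative_infsum[of 1])
    fix h :: real and p :: "int \<times> int"
    assume h: "\<bar>h\<bar> < 1" and p: "p \<in> lattice"
    have "((\<lambda>t. theta_term a b z t p) \<circ> (\<lambda>h. h + x) has_vector_derivative 1 *\<^sub>R ?D (h + x) p) (at h)"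
      by (intro vector_diff_chain_at d) (auto intro!: derivative_eq_intros)
    then show "((\<lambda>h. theta_term a b z (h + x) p) has_vector_derivative ?D (h + x) p) (at h)"
      by (simp add: o_def)
    show "norm (theta_term a b z (h + x) p) \<le> K a b * exp (- \<delta> a b * height p)"
      using h by (intro K p) auto
    have "norm (?D (h + x) p) = pi * exp (h + x) / Im z * norm (theta_term (a + 1) (b + 1) z (h + x) p)"
      unfolding norm_minus_cancel norm_mult norm_of_real using z by simp
    also have "\<dots> \<le> pi * exp (x + 1) / Im z * (K (a + 1) (b + 1) * exp (- \<delta> (a + 1) (b + 1) * height p))"
      using h z by (intro mult_mono K p divide_right_mono mult_left_mono) auto
    finally show "norm (?D (h + x) p) \<le> pi * exp (x + 1) / Im z * K (a + 1) (b + 1) * exp (- \<delta> (a + 1) (b + 1) * height p)"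
      by (simp add: mult_ac)
  qed (rule zero_less_one summable_on_exp_height'[OF \<delta>])+
  then have "((\<lambda>h. theta a b z (h + x)) has_vector_derivative
      - (of_real (pi * exp x / Im z) * theta (a + 1) (b + 1) z x)) (at (x - x))"
    unfolding theta_def infsum_uminus infsum_cmult_right' by simp
  then have "((\<lambda>h. theta a b z (h + x)) \<circ> (\<lambda>t. t - x) has_vector_derivative
      1 *\<^sub>R - (of_real (pi * exp x / Im z) * theta (a + 1) (b + 1) z x)) (at x)"
    by (intro vector_diff_chain_at) (auto intro!: derivative_eq_intros)
  then show ?thesis by (simp add: o_def)
qed

lemma continuous_on_theta: "Im z > 0 \<Longrightarrow> continuous_on S (theta a b z)"
  using theta_has_vector_derivative
  by (meson continuous_at_imp_continuous_on has_vector_derivative_continuous)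

section \<open>Wirtinger calculus\<close>

lemma has_wirtinger_const: "has_wirtinger (\<lambda>_. c) 0 0 z"
  by (simp add: has_wirtinger_def)

lemma has_wirtinger_add:
  "has_wirtinger f A B z \<Longrightarrow> has_wirtinger g A' B' z \<Longrightarrow> has_wirtinger (\<lambda>z. f z + g z) (A + A') (B + B') z"
  unfolding has_wirtinger_def
proof
  fix v assume "\<forall>v. ((\<lambda>h. f (z + complex_of_real h * v)) has_vector_derivative v * A + cnj v * B) (at 0)"
    "\<forall>v. ((\<lambda>h. g (z + complex_of_real h * v)) has_vector_derivative v * A' + cnj v * B') (at 0)"
  then have "((\<lambda>h. f (z + complex_of_real h * v) + g (z + complex_of_real h * v)) has_vector_derivative
      (v * A + cnj v * B) + (v * A' + cnj v * B')) (at 0)"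
    by (intro has_vector_derivative_add) auto
  then show "((\<lambda>h. f (z + complex_of_real h * v) + g (z + complex_of_real h * v)) has_vector_derivative
      v * (A + A') + cnj v * (B + B')) (at 0)"
    by (simp add: algebra_simps)
qed

lemma has_wirtinger_mult:
  "has_wirtinger f A B z \<Longrightarrow> has_wirtinger g A' B' z \<Longrightarrow>
     has_wirtinger (\<lambda>z. f z * g z) (f z * A' + A * g z) (f z * B' + B * g z) z"
  unfolding has_wirtinger_def
proof
  fix v assume "\<forall>v. ((\<lambda>h. f (z + complex_of_real h * v)) has_vector_derivative v * A + cnj v * B) (at 0)"
    "\<forall>v. ((\<lambda>h. g (z + complex_of_real h * v)) has_vector_derivative v * A' + cnj v * B') (at 0)"
  then have "((\<lambda>h. f (z + complex_of_real h * v) * g (z + complex_of_real h * v)) has_vector_derivative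
      f (z + complex_of_real 0 * v) * (v * A' + cnj v * B') + (v * A + cnj v * B) * g (z + complex_of_real 0 * v)) (at 0)"
    by (intro has_vector_derivative_mult) auto
  then show "((\<lambda>h. f (z + complex_of_real h * v) * g (z + complex_of_real h * v)) has_vector_derivative
      v * (f z * A' + A * g z) + cnj v * (f z * B' + B * g z)) (at 0)"
    by (simp add: algebra_simps)
qed

lemma has_wirtinger_cmult:
  "has_wirtinger f A B z \<Longrightarrow> has_wirtinger (\<lambda>z. c * f z) (c * A) (c * B) z"
  using has_wirtinger_mult[OF has_wirtinger_const[of c]] by simp

lemma has_wirtinger_sum:
  "(\<And>i. i \<in> I \<Longrightarrow> has_wirtinger (f i) (A i) (B i) z) \<Longrightarrow>
     has_wirtinger (\<lambda>z. \<Sum>i\<in>I. f i z) (\<Sum>i\<in>I. A i) (\<Sum>i\<in>I. B i) z"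
  by (induction I rule: infinite_finite_induct)
     (auto intro: has_wirtinger_const has_wirtinger_add)

lemma has_wirtinger_cnj:
  assumes "has_wirtinger f A B z"
  shows "has_wirtinger (\<lambda>z. cnj (f z)) (cnj B) (cnj A) z"
  unfolding has_wirtinger_def
proof
  fix v
  have "((\<lambda>h. f (z + complex_of_real h * v)) has_vector_derivative v * A + cnj v * B) (at 0)"
    using assms unfolding has_wirtinger_def by blast
  then have "((\<lambda>h. cnj (f (z + complex_of_real h * v))) has_vector_derivative cnj (v * A + cnj v * B)) (at 0)"
    by (rule bounded_linear.has_vector_derivative[OF bounded_linear_cnj])
  then show "((\<lambda>h. cnj (f (z + complex_of_real h * v))) has_vector_derivative v * cnj B + cnj v * cnj A) (at 0)"
    by (simp add: add.commute)
qed

text \<open>The directions 1 and i determine A + B and A - B. The lemma serves to differentiate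
  identities: two evaluations of the same derivative may be equated.\<close>

lemma has_wirtinger_unique:
  assumes "has_wirtinger f A B z" "has_wirtinger f A' B' z"
  shows "A = A'" "B = B'"
proof -
  have eq: "v * A + cnj v * B = v * A' + cnj v * B'" for v
    using assms unfolding has_wirtinger_def by (metis vector_derivative_unique_at)
  from eq[of 1] eq[of \<i>] have s: "A + B = A' + B'" and "\<i> * (A - B) = \<i> * (A' - B')"
    by (simp_all add: algebra_simps)
  then have d: "A - B = A' - B'" by simp
  have "2 * A = (A + B) + (A - B)" by simp
  also have "\<dots> = 2 * A'" unfolding s d by simp
  finally show "A = A'" by simp
  with s show "B = B'" by simp
qed



lemma has_wirtinger_Im_power:
  assumes "Im z > 0"
  shows "has_wirtinger (\<lambda>z. of_real (1 / Im z ^ k))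
     (of_nat k * \<i> / 2 * of_real (1 / Im z ^ (k + 1))) (- (of_nat k * \<i> / 2 * of_real (1 / Im z ^ (k + 1)))) z"
  unfolding has_wirtinger_def
proof
  fix v
  have "((\<lambda>h. 1 / Im (z + complex_of_real h * v) ^ k) has_real_derivative
      - (real k * Im v / Im z ^ (k + 1))) (at 0)"
  proof -
    have "((\<lambda>h. 1 / (Im z + h * Im v) ^ k) has_real_derivative - (real k * Im v / Im z ^ (k + 1))) (at 0)"
    proof -
      have "((\<lambda>h. inverse (Im z + h * Im v)) has_real_derivative - (inverse (Im z) * Im v * inverse (Im z))) (at 0)"
        using assms by (auto intro!: derivative_eq_intros)
      from DERIV_power[OF this, of k]
      have "((\<lambda>h. inverse (Im z + h * Im v) ^ k) has_real_derivative
          real k * (- (inverse (Im z) * Im v * inverse (Im z)) * inverse (Im z) ^ (k - Suc 0))) (at 0)"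
        by simp
      moreover have "real k * (- (inverse (Im z) * Im v * inverse (Im z)) * inverse (Im z) ^ (k - Suc 0)) =
          - (real k * Im v / Im z ^ (k + 1))"
        using assms by (cases k) (simp_all add: field_simps)
      ultimately have "((\<lambda>h. inverse (Im z + h * Im v) ^ k) has_real_derivative
          - (real k * Im v / Im z ^ (k + 1))) (at 0)"
        by (simp only:)
      then show ?thesis by (simp add: inverse_eq_divide power_one_over)
    qed
    then show ?thesis by simp
  qed
  then have "((\<lambda>h. complex_of_real (1 / Im (z + complex_of_real h * v) ^ k)) has_vector_derivative
      of_real (- (real k * Im v / Im z ^ (k + 1)))) (at 0)"
    unfolding has_real_derivative_iff_has_vector_derivative
    by (rule bounded_linear.has_vector_derivative[OF bounded_linear_of_real])
  moreover have "complex_of_real (- (real k * Im v / Im z ^ (k + 1))) =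
      v * (of_nat k * \<i> / 2 * of_real (1 / Im z ^ (k + 1))) + cnj v * (- (of_nat k * \<i> / 2 * of_real (1 / Im z ^ (k + 1))))"
  proof -
    define X where "X = complex_of_real (1 / Im z ^ (k + 1))"
    have "complex_of_real (- (real k * Im v / Im z ^ (k + 1))) = - (of_nat k * of_real (Im v) * X)"
      by (simp add: X_def)
    also have "\<dots> = (2 * \<i> * of_real (Im v)) * (of_nat k * \<i> / 2 * X)"
      by (simp add: complex_eq_iff)
    also have "2 * \<i> * of_real (Im v) = v - cnj v"
      by (simp add: complex_eq_iff)
    finally show ?thesis
      unfolding X_def [symmetric] by (simp only: left_diff_distrib mult_minus_right add_uminus_conv_diff)
  qed
  ultimately show "((\<lambda>h. complex_of_real (1 / Im (z + complex_of_real h * v) ^ k)) has_vector_derivative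
      v * (of_nat k * \<i> / 2 * of_real (1 / Im z ^ (k + 1))) + cnj v * (- (of_nat k * \<i> / 2 * of_real (1 / Im z ^ (k + 1))))) (at 0)"
    by (simp only:)
qed

text \<open>The family \<open>ntheta\<close> below is closed, up to linear combinations with constant
  coefficients, under both Wirtinger derivatives.\<close>

definition ntheta :: "nat \<Rightarrow> nat \<Rightarrow> nat \<Rightarrow> nat \<Rightarrow> complex \<Rightarrow> real \<Rightarrow> complex" where
  "ntheta k j a b z x = of_real (1 / Im z ^ k) * (of_real ((pi * exp x) ^ j) * theta a b z x)"

lemma ntheta_wirtinger:
  assumes "Im z > 0"
  shows "has_wirtinger (\<lambda>z. ntheta k j a b z x)
    (of_nat k * \<i> / 2 * ntheta (k + 1) j a b z x
       + of_nat a / (2 * \<i>) * (ntheta (k + 1) j a b z x - ntheta (k + 1) j (a - 1) (b + 1) z x)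
       - \<i> / 2 * ntheta (k + 2) (j + 1) a (b + 2) z x)
    (- (of_nat k * \<i> / 2 * ntheta (k + 1) j a b z x)
       - of_nat b / (2 * \<i>) * (ntheta (k + 1) j a b z x - ntheta (k + 1) j (a + 1) (b - 1) z x)
       + \<i> / 2 * ntheta (k + 2) (j + 1) (a + 2) b z x) z"
proof -
  define e where "e = complex_of_real ((pi * exp x) ^ j)"
  define c where "c = complex_of_real (pi * exp x)"
  define s where "s n = complex_of_real (1 / Im z ^ n)" for n
  have s1: "s (k + 1) = s k * s 1" and s2: "s (k + 2) = s k * s 2"
    unfolding s_def of_real_mult [symmetric] by (simp_all add: power2_eq_square)
  have y1: "1 / complex_of_real (Im z) = s 1" and y2: "complex_of_real (pi * exp x / (2 * (Im z)\<^sup>2)) = c / 2 * s 2"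
    by (simp_all add: s_def c_def)
  have n1: "ntheta (k + 1) j a' b' z x = s k * s 1 * (e * theta a' b' z x)" for a' b'
    unfolding ntheta_def s_def [symmetric] e_def [symmetric] s1 ..
  have n2: "ntheta (k + 2) (j + 1) a' b' z x = s k * s 2 * (e * c * theta a' b' z x)" for a' b'
    unfolding ntheta_def s_def [symmetric] s2 by (simp add: e_def c_def mult_ac)
  have d: "w / (2 * \<i> * of_real (Im z)) = w / (2 * \<i>) * s 1" for w
    unfolding y1 [symmetric] by (simp only: times_divide_times_eq mult_1_right)
  note w = has_wirtinger_mult[OF has_wirtinger_Im_power[OF assms, of k]
      has_wirtinger_cmult[OF theta_wirtinger[OF assms, of a b x], of e]]
  have "ntheta k j a b = (\<lambda>z x. of_real (1 / Im z ^ k) * (of_real ((pi * exp x) ^ j) * theta a b z x))"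
    by (simp add: ntheta_def fun_eq_iff)
  then have f: "(\<lambda>z. of_real (1 / Im z ^ k) * (e * theta a b z x)) = (\<lambda>z. ntheta k j a b z x)"
    by (simp add: e_def)
  show ?thesis
    using w unfolding f s_def [symmetric] n1 n2 d y2 unfolding s1
    by (simp add: algebra_simps)
qed

lemma theta_eq_ntheta: "theta a b z x = ntheta 0 0 a b z x"
  by (simp add: ntheta_def)

text \<open>Doubly exponential decay beats every power of exp x. The rate N is free, so any weight
  of exponential growth can be compensated, uniformly for z near z0.\<close>

lemma ntheta_local_bound:
  assumes "Im z0 > 0"
  obtains C where "C \<ge> 0" "\<forall>\<^sub>F z in nhds z0. \<forall>x\<ge>0. norm (ntheta k j a b z x) \<le> C * exp (- (real N * x))"
proof -
  obtain K \<delta> where \<delta>: "\<delta> > 0"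
    and K: "\<forall>\<^sub>F z in nhds z0. \<forall>x\<ge>0. norm (theta a b z x) \<le> K * exp (- (\<delta> * exp x))"
    using theta_local_bound[OF assms, where ?x0.0 = 0] .
  define D where "D = fact (N + j) * (2 / \<delta>) ^ (N + j)"
  have D: "exp x ^ (N + j) * exp (- (\<delta> * exp x)) \<le> D" for x
  proof -
    have "exp x ^ (N + j) * exp (- (\<delta> * exp x)) \<le> D * exp (- (\<delta> / 2 * exp x))"
      unfolding D_def by (rule power_mult_exp_le) (use \<delta> in auto)
    also have "\<dots> \<le> D * 1" using \<delta> by (intro mult_left_mono) (auto simp: D_def)
    finally show ?thesis by simp
  qed
  let ?C = "(2 / Im z0) ^ k * pi ^ j * \<bar>K\<bar> * D"
  have half: "\<forall>\<^sub>F z in nhds z0. Im z > Im z0 / 2"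
    using assms by (intro order_tendstoD(1)[of Im "Im z0"] tendsto_intros filterlim_ident) auto
  have "\<forall>\<^sub>F z in nhds z0. \<forall>x\<ge>0. norm (ntheta k j a b z x) \<le> ?C * exp (- (real N * x))"
    using K half
  proof eventually_elim
    case (elim z)
    have iz: "Im z > 0" using elim assms by simp
    show ?case
    proof (intro allI impI)
      fix x :: real assume "x \<ge> 0"
      then have "norm (theta a b z x) \<le> K * exp (- (\<delta> * exp x))" using elim by blast
      also have "\<dots> \<le> \<bar>K\<bar> * exp (- (\<delta> * exp x))" by (intro mult_right_mono) auto
      finally have th: "norm (theta a b z x) \<le> \<bar>K\<bar> * exp (- (\<delta> * exp x))" .
      have "1 / Im z \<le> 2 / Im z0" using elim assms iz by (simp add: field_simps)
      then have "1 / Im z ^ k \<le> (2 / Im z0) ^ k"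
        using iz power_mono[of "1 / Im z" "2 / Im z0" k] by (simp add: power_one_over)
      then have "norm (ntheta k j a b z x) \<le> (2 / Im z0) ^ k * ((pi * exp x) ^ j * (\<bar>K\<bar> * exp (- (\<delta> * exp x))))"
        unfolding ntheta_def norm_mult norm_of_real using iz th assms
        by (intro mult_mono) (auto simp: abs_mult)
      also have "\<dots> = (2 / Im z0) ^ k * pi ^ j * \<bar>K\<bar> * (exp x ^ (N + j) * exp (- (\<delta> * exp x))) * exp (- (real N * x))"
      proof -
        have "exp x ^ (N + j) * exp (- (real N * x)) = exp x ^ j"
          by (simp add: power_add exp_minus exp_of_nat_mult)
        then show ?thesis by (simp add: power_mult_distrib mult_ac)
      qed
      also have "\<dots> \<le> ?C * exp (- (real N * x))"
        using D assms by (intro mult_right_mono mult_left_mono) auto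
      finally show "norm (ntheta k j a b z x) \<le> ?C * exp (- (real N * x))" .
    qed
  qed
  moreover have "?C \<ge> 0" using assms \<delta> by (simp add: D_def)
  ultimately show ?thesis by (intro that)
qed

lemma continuous_on_ntheta: "Im z > 0 \<Longrightarrow> continuous_on S (ntheta k j a b z)"
  unfolding ntheta_def [abs_def] by (intro continuous_intros continuous_on_theta)

section \<open>Weights of exponential growth and rapidly decaying functions\<close>

definition weight :: "(real \<Rightarrow> real) \<Rightarrow> bool" where
  "weight W \<longleftrightarrow> continuous_on UNIV W \<and> (\<exists>C N. C \<ge> 0 \<and> (\<forall>x\<ge>0. \<bar>W x\<bar> \<le> C * exp (real N * x)))"

text \<open>In t = e^x this is decay faster than every power of 1/t. Decay is asked for x \<ge> 0
  only, because functional equations fold negative x onto positive x.\<close>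

definition rapid :: "(real \<Rightarrow> complex) \<Rightarrow> bool" where
  "rapid g \<longleftrightarrow> continuous_on UNIV g \<and> (\<forall>N. \<exists>C\<ge>0. \<forall>x\<ge>0. norm (g x) \<le> C * exp (- (real N * x)))"

lemma rapid_ntheta:
  assumes "Im z > 0"
  shows "rapid (ntheta k j a b z)"
  unfolding rapid_def
proof (intro conjI allI)
  fix N
  obtain C where "C \<ge> 0" "\<forall>\<^sub>F w in nhds z. \<forall>x\<ge>0. norm (ntheta k j a b w x) \<le> C * exp (- (real N * x))"
    using ntheta_local_bound[OF assms] .
  then show "\<exists>C\<ge>0. \<forall>x\<ge>0. norm (ntheta k j a b z x) \<le> C * exp (- (real N * x))"
    by (blast dest: eventually_nhds_x_imp_x)
qed (rule continuous_on_ntheta[OF assms])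

text \<open>In t = e^x this is the measure dt/t on t > 1.\<close>

abbreviation half_line :: "real measure" where
  "half_line \<equiv> restrict_space lborel {0<..}"

definition wintegral :: "(real \<Rightarrow> real) \<Rightarrow> (real \<Rightarrow> complex) \<Rightarrow> complex" where
  "wintegral W g = (LINT x|half_line. of_real (W x) * g x)"

lemma integrable_exp_half_line: "integrable half_line (\<lambda>x. C * exp (- x))"
  using integrable_I0i_exp_mscale[of 1] by (simp add: set_integrable_eq)

lemma continuous_measurable_half_line:
  "continuous_on UNIV f \<Longrightarrow> f \<in> borel_measurable half_line"
  by (intro measurable_restrict_space1) (simp add: borel_measurable_continuous_onI)

text \<open>\<open>D\<close> and \<open>N\<close> depend on the weight alone. This order of
  quantifiers makes the majorant uniform in z when the lemma is combined with
  \<open>ntheta_local_bound\<close>.\<close>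

lemma weight_decay:
  assumes "weight W"
  obtains D N where "\<And>y C x. x \<ge> 0 \<Longrightarrow> norm (y :: complex) \<le> C * exp (- (real N * x)) \<Longrightarrow>
    norm (of_real (W x) * y) \<le> D * C * exp (- x)"
proof -
  obtain D N where W: "D \<ge> 0" "\<And>x. x \<ge> 0 \<Longrightarrow> \<bar>W x\<bar> \<le> D * exp (real N * x)"
    using assms unfolding weight_def by metis
  have "norm (of_real (W x) * y) \<le> D * C * exp (- x)"
    if x: "x \<ge> 0" and y: "norm y \<le> C * exp (- (real (N + 1) * x))" for x C and y :: complex
  proof -
    have "norm (of_real (W x) * y) \<le> (D * exp (real N * x)) * (C * exp (- (real (N + 1) * x)))"
      unfolding norm_mult using W x y by (intro mult_mono) auto
    also have "\<dots> = D * C * exp (- x)"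
      by (simp add: exp_add [symmetric] algebra_simps)
    finally show ?thesis .
  qed
  then show ?thesis by (rule that)
qed

lemma weight_rapid_bound:
  assumes "weight W" "rapid g"
  obtains C where "\<And>x. x \<ge> 0 \<Longrightarrow> norm (of_real (W x) * g x) \<le> C * exp (- x)"
proof -
  obtain D N where "\<And>y C x. x \<ge> 0 \<Longrightarrow> norm (y :: complex) \<le> C * exp (- (real N * x)) \<Longrightarrow>
      norm (of_real (W x) * y) \<le> D * C * exp (- x)"
    by (rule weight_decay[OF assms(1)]) blast
  moreover obtain C where "\<And>x. x \<ge> 0 \<Longrightarrow> norm (g x) \<le> C * exp (- (real N * x))"
    using assms(2) unfolding rapid_def by blast
  ultimately show ?thesis by (intro that[of "D * C"]) blast
qed

lemma rapid_weighted_integrable: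
  assumes W: "weight W" and g: "rapid g"
  shows "integrable half_line (\<lambda>x. of_real (W x) * g x)"
proof -
  obtain C where C: "\<And>x. x \<ge> 0 \<Longrightarrow> norm (of_real (W x) * g x) \<le> C * exp (- x)"
    by (rule weight_rapid_bound[OF assms]) blast
  show ?thesis
  proof (rule Bochner_Integration.integrable_bound[OF integrable_exp_half_line[of C]])
    show "(\<lambda>x. of_real (W x) * g x) \<in> borel_measurable half_line"
      using assms by (intro continuous_measurable_half_line continuous_intros) (auto simp: weight_def rapid_def)
    show "AE x in half_line. norm (of_real (W x) * g x) \<le> norm (C * exp (- x))"
      by (intro AE_I2 order_trans[OF C]) (auto simp: space_restrict_space)
  qed
qed

lemma ntheta_integrable:
  "weight W \<Longrightarrow> Im z > 0 \<Longrightarrow> integrable half_line (\<lambda>x. of_real (W x) * ntheta k j a b z x)"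
  by (intro rapid_weighted_integrable rapid_ntheta)

definition moment :: "(real \<Rightarrow> real) \<Rightarrow> nat \<Rightarrow> nat \<Rightarrow> nat \<Rightarrow> nat \<Rightarrow> complex \<Rightarrow> complex" where
  "moment W k j a b z = wintegral W (ntheta k j a b z)"

text \<open>The weight does not involve z, so the formula is that of \<open>ntheta_wirtinger\<close>
  with every \<open>ntheta\<close> replaced by its moment.\<close>

lemma moment_wirtinger:
  assumes W: "weight W" and z: "Im z > 0"
  shows "has_wirtinger (moment W k j a b)
    (of_nat k * \<i> / 2 * moment W (k + 1) j a b z
       + of_nat a / (2 * \<i>) * (moment W (k + 1) j a b z - moment W (k + 1) j (a - 1) (b + 1) z)
       - \<i> / 2 * moment W (k + 2) (j + 1) a (b + 2) z)
    (- (of_nat k * \<i> / 2 * moment W (k + 1) j a b z)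
       - of_nat b / (2 * \<i>) * (moment W (k + 1) j a b z - moment W (k + 1) j (a + 1) (b - 1) z)
       + \<i> / 2 * moment W (k + 2) (j + 1) (a + 2) b z) z"
proof -
  let ?I = "\<lambda>k j a b w x. of_real (W x) * ntheta k j a b w x"
  define c where "c k = of_nat k * \<i> / 2" for k :: nat
  define d where "d k = of_nat k / (2 * \<i>)" for k :: nat
  let ?A = "\<lambda>w x. c k * ?I (k + 1) j a b w x
       + d a * (?I (k + 1) j a b w x - ?I (k + 1) j (a - 1) (b + 1) w x)
       - \<i> / 2 * ?I (k + 2) (j + 1) a (b + 2) w x"
  let ?B = "\<lambda>w x. - (c k * ?I (k + 1) j a b w x)
       - d b * (?I (k + 1) j a b w x - ?I (k + 1) j (a + 1) (b - 1) w x)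
       + \<i> / 2 * ?I (k + 2) (j + 1) (a + 2) b w x"
  have dom: "dominated_near half_line z (?I k j a b)" for k j a b
  proof -
    obtain D N where D: "\<And>y C x. x \<ge> 0 \<Longrightarrow> norm (y :: complex) \<le> C * exp (- (real N * x)) \<Longrightarrow>
        norm (of_real (W x) * y) \<le> D * C * exp (- x)"
      by (rule weight_decay[OF W]) blast
    obtain C where "\<forall>\<^sub>F w in nhds z. \<forall>x\<ge>0. norm (ntheta k j a b w x) \<le> C * exp (- (real N * x))"
      using ntheta_local_bound[OF z, where k = k and j = j and a = a and b = b and N = N] by blast
    then have "\<forall>\<^sub>F w in nhds z. \<forall>x\<in>space half_line. norm (?I k j a b w x) \<le> D * C * exp (- x)"
      by (elim eventually_mono) (auto simp: space_restrict_space intro!: D)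
    then show ?thesis
      unfolding dominated_near_def using integrable_exp_half_line by blast
  qed
  note int = ntheta_integrable[OF W]
  have "has_wirtinger (\<lambda>w. LINT x|half_line. ?I k j a b w x)
     (LINT x|half_line. ?A z x) (LINT x|half_line. ?B z x) z"
  proof (rule has_wirtinger_lebesgue_integral)
    show "dominated_near half_line z ?A" "dominated_near half_line z ?B"
      by (intro dominated_near_add dominated_near_diff dominated_near_minus dominated_near_mult dom continuous_const)+
    have "has_wirtinger (\<lambda>w. ?I k j a b w x) (?A w x) (?B w x) w" if "Im w > 0" for w x
      using has_wirtinger_cmult[OF ntheta_wirtinger[OF that, of k j a b x], of "of_real (W x)"]
      unfolding c_def d_def by (simp add: algebra_simps)
    then show "\<forall>\<^sub>F w in nhds z. \<forall>x\<in>space half_line. has_wirtinger (\<lambda>w. ?I k j a b w x) (?A w x) (?B w x) w"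
      using eventually_upper_half[OF z] by (auto elim: eventually_mono)
    show "\<forall>\<^sub>F w in nhds z. integrable half_line (?I k j a b w)"
      using eventually_upper_half[OF z] by eventually_elim (rule int)
    have "integrable half_line (?A z)" "integrable half_line (?B z)"
      by (intro Bochner_Integration.integrable_add Bochner_Integration.integrable_diff
          Bochner_Integration.integrable_minus integrable_mult_right int z)+
    then show "?A z \<in> borel_measurable half_line" "?B z \<in> borel_measurable half_line" by simp_all
  qed
  then show ?thesis
    unfolding moment_def [abs_def] wintegral_def c_def d_def using int[OF z] by (simp del: ex_simps)
qed

lemma theta_cnj: "cnj (theta a b z x) = theta b a z x"
  unfolding theta_def infsum_cnj [symmetric]
  by (intro infsum_cong) (simp add: theta_term_def mult_ac)

text \<open>The weight is real. In particular moments with a = b are real, which is what lets the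
  conjugation inside the xi-operators be undone later.\<close>

lemma moment_cnj: "cnj (moment W k j a b z) = moment W k j b a z"
proof -
  have "cnj (moment W k j a b z) = (LINT x|half_line. cnj (of_real (W x) * ntheta k j a b z x))"
    unfolding moment_def wintegral_def by (rule Bochner_Integration.integral_cnj [symmetric])
  also have "\<dots> = moment W k j b a z"
    unfolding moment_def wintegral_def by (simp add: ntheta_def theta_cnj)
  finally show ?thesis .
qed

section \<open>Functional equations and integration by parts\<close>

lemma qform_zero [simp]: "qform z (0, 0) = 0"
  by (simp add: qform_def lattice_pt_def)

text \<open>\<open>theta_inversion\<close> with t = e^x, so that t -> 1/t becomes x -> -x. The
  summand 1 is the lattice point (0,0), which \<open>theta\<close> leaves out.\<close>

lemma theta_functional_equation:
  assumes z: "Im z > 0"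
  shows "theta 0 0 z (- x) + 1 = of_real (exp x) * (theta 0 0 z x + 1)"
proof -
  have full: "(\<Sum>\<^sub>\<infinity>p. complex_of_real (exp (- (pi * exp x * qform z p)))) = theta 0 0 z x + 1" for x
  proof -
    have "(\<Sum>\<^sub>\<infinity>p\<in>{(0, 0)} \<union> lattice. theta_term 0 0 z x p) =
       (\<Sum>\<^sub>\<infinity>p\<in>{(0, 0)}. theta_term 0 0 z x p) + (\<Sum>\<^sub>\<infinity>p\<in>lattice. theta_term 0 0 z x p)"
      using theta_term_summable[OF z] by (intro infsum_Un_disjoint) auto
    moreover have "theta_term 0 0 z x = (\<lambda>p. of_real (exp (- (pi * exp x * qform z p))))"
      by (simp add: theta_term_def fun_eq_iff)
    ultimately show ?thesis by (simp add: theta_def)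
  qed
  have "theta 0 0 z (- x) + 1 = of_real (1 / exp (- x)) * (\<Sum>\<^sub>\<infinity>p. complex_of_real (exp (- (pi * (1 / exp (- x)) * qform z p))))"
    unfolding full [symmetric] by (rule theta_inversion[OF z]) simp
  also have "1 / exp (- x) = exp x" by (simp add: exp_minus inverse_eq_divide)
  finally show ?thesis unfolding full .
qed

text \<open>The z-derivative of \<open>theta_functional_equation\<close>. Differentiation removes
  the summand 1, which is why the weight 2 integral has neither polar terms nor a constant
  1/2.\<close>

lemma theta_0_2_functional_equation:
  assumes z: "Im z > 0"
  shows "ntheta 2 1 0 2 z (- x) = of_real (exp x) * ntheta 2 1 0 2 z x"
proof -
  have w: "has_wirtinger (\<lambda>z. theta 0 0 z x) (- (\<i> / 2 * ntheta 2 1 0 2 z x)) (\<i> / 2 * ntheta 2 1 2 0 z x) z" for x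
    using ntheta_wirtinger[OF z, of 0 0 0 0 x] by (simp add: theta_eq_ntheta numeral_2_eq_2)
  have "has_wirtinger (\<lambda>z. of_real (exp x) * (theta 0 0 z x + 1) + (- 1))
      (of_real (exp x) * (- (\<i> / 2 * ntheta 2 1 0 2 z x) + 0) + 0) (of_real (exp x) * (\<i> / 2 * ntheta 2 1 2 0 z x + 0) + 0) z"
    by (intro has_wirtinger_add has_wirtinger_cmult has_wirtinger_const w)
  then have "has_wirtinger (\<lambda>z. theta 0 0 z (- x))
      (of_real (exp x) * (- (\<i> / 2 * ntheta 2 1 0 2 z x) + 0) + 0) (of_real (exp x) * (\<i> / 2 * ntheta 2 1 2 0 z x + 0) + 0) z"
    by (rule has_wirtinger_cong[OF _ z]) (use theta_functional_equation in \<open>simp flip: theta_functional_equation\<close>)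
  from has_wirtinger_unique(1)[OF w this] show ?thesis by simp
qed

lemma ntheta_has_vector_derivative:
  assumes z: "Im z > 0"
  shows "(ntheta k j a b z has_vector_derivative
     of_nat j * ntheta k j a b z x - ntheta (k + 1) (j + 1) (a + 1) (b + 1) z x) (at x)"
proof -
  have "((\<lambda>x. (pi * exp x) ^ j) has_real_derivative real j * (pi * exp x) ^ j) (at x)"
  proof -
    have "((\<lambda>x. pi * exp x) has_real_derivative pi * exp x) (at x)"
      by (auto intro!: derivative_eq_intros)
    from DERIV_power[OF this, of j] show ?thesis by (cases j) simp_all
  qed
  then have "((\<lambda>x. complex_of_real ((pi * exp x) ^ j)) has_vector_derivative of_real (real j * (pi * exp x) ^ j)) (at x)"
    unfolding has_real_derivative_iff_has_vector_derivative
    by (rule bounded_linear.has_vector_derivative[OF bounded_linear_of_real])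
  from has_vector_derivative_mult_right[OF has_vector_derivative_mult[OF this theta_has_vector_derivative[OF z, of a b x]], of "of_real (1 / Im z ^ k)"]
  show ?thesis unfolding ntheta_def [abs_def]
    by (simp add: algebra_simps)
qed

text \<open>The functional equation differentiated at its fixed point x = 0;
  \<open>ntheta 1 1 1 1\<close> is minus the x-derivative of theta. It evaluates the boundary term
  of the integration by parts.\<close>

lemma theta_derivative_at_0:
  assumes z: "Im z > 0"
  shows "2 * ntheta 1 1 1 1 z 0 = ntheta 0 0 0 0 z 0 + 1"
proof -
  have d: "((\<lambda>x. theta 0 0 z x) has_vector_derivative - ntheta 1 1 1 1 z x) (at x)" for x
    using ntheta_has_vector_derivative[OF z, of 0 0 0 0 x] unfolding theta_eq_ntheta by simp
  have "((\<lambda>x. theta 0 0 z x) \<circ> (\<lambda>x. - x) has_vector_derivative (- 1) *\<^sub>R (- ntheta 1 1 1 1 z (- 0))) (at 0)"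
    by (intro vector_diff_chain_at d) (auto intro!: derivative_eq_intros)
  then have "((\<lambda>x. theta 0 0 z (- x) + 1) has_vector_derivative ntheta 1 1 1 1 z 0 + 0) (at 0)"
    by (intro has_vector_derivative_add has_vector_derivative_const) (simp add: o_def)
  moreover have "((\<lambda>x. complex_of_real (exp x) * (theta 0 0 z x + 1)) has_vector_derivative
      of_real (exp 0) * (- ntheta 1 1 1 1 z 0 + 0) + of_real (exp 0) * (theta 0 0 z 0 + 1)) (at 0)"
  proof (intro has_vector_derivative_mult has_vector_derivative_add has_vector_derivative_const d)
    have "(exp has_vector_derivative exp (0::real)) (at 0)"
      unfolding has_real_derivative_iff_has_vector_derivative [symmetric] by (rule DERIV_exp)
    then show "((\<lambda>x. complex_of_real (exp x)) has_vector_derivative of_real (exp 0)) (at 0)"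
      by (rule bounded_linear.has_vector_derivative[OF bounded_linear_of_real])
  qed
  ultimately have "ntheta 1 1 1 1 z 0 + 0 = of_real (exp 0) * (- ntheta 1 1 1 1 z 0 + 0) + of_real (exp 0) * (theta 0 0 z 0 + 1)"
    unfolding theta_functional_equation[OF z] by (rule vector_derivative_unique_at)
  then show ?thesis by (simp add: theta_eq_ntheta algebra_simps)
qed

section \<open>The weights in use and integration by parts\<close>

lemma weightI:
  assumes "continuous_on UNIV W" "C \<ge> 0" "\<And>x. x \<ge> 0 \<Longrightarrow> \<bar>W x\<bar> \<le> C * exp (real N * x)"
  shows "weight W"
  using assms unfolding weight_def by blast

lemma weight_const: "weight (\<lambda>_. c)"
  by (rule weightI[of _ "\<bar>c\<bar>" 0]) auto

lemma weight_exp: "weight exp"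
  by (rule weightI[of _ 1 1]) (auto intro!: continuous_intros)

lemma weight_add:
  assumes "weight V" "weight W"
  shows "weight (\<lambda>x. V x + W x)"
proof -
  obtain C N where V: "C \<ge> 0" "\<And>x. x \<ge> 0 \<Longrightarrow> \<bar>V x\<bar> \<le> C * exp (real N * x)" "continuous_on UNIV V"
    using assms(1) unfolding weight_def by metis
  obtain D M where W: "D \<ge> 0" "\<And>x. x \<ge> 0 \<Longrightarrow> \<bar>W x\<bar> \<le> D * exp (real M * x)" "continuous_on UNIV W"
    using assms(2) unfolding weight_def by metis
  show ?thesis
  proof (rule weightI[of _ "C + D" "N + M"])
    fix x :: real assume x: "x \<ge> 0"
    have "C * exp (real N * x) \<le> C * exp (real (N + M) * x)" "D * exp (real M * x) \<le> D * exp (real (N + M) * x)"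
      using V(1) W(1) x by (auto intro!: mult_left_mono mult_right_mono)
    then show "\<bar>V x + W x\<bar> \<le> (C + D) * exp (real (N + M) * x)"
      using V(2)[OF x] W(2)[OF x] unfolding distrib_right by linarith
  qed (use V W in \<open>auto intro!: continuous_intros\<close>)
qed

lemma weight_mult:
  assumes "weight V" "weight W"
  shows "weight (\<lambda>x. V x * W x)"
proof -
  obtain C N where V: "C \<ge> 0" "\<And>x. x \<ge> 0 \<Longrightarrow> \<bar>V x\<bar> \<le> C * exp (real N * x)" "continuous_on UNIV V"
    using assms(1) unfolding weight_def by metis
  obtain D M where W: "D \<ge> 0" "\<And>x. x \<ge> 0 \<Longrightarrow> \<bar>W x\<bar> \<le> D * exp (real M * x)" "continuous_on UNIV W"
    using assms(2) unfolding weight_def by metis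
  show ?thesis
  proof (rule weightI[of _ "C * D" "N + M"])
    fix x :: real assume x: "x \<ge> 0"
    have "\<bar>V x * W x\<bar> \<le> (C * exp (real N * x)) * (D * exp (real M * x))"
      unfolding abs_mult using V(1,2) W(1,2) x by (intro mult_mono) auto
    also have "\<dots> = C * D * exp (real (N + M) * x)"
      by (simp add: exp_add [symmetric] algebra_simps)
    finally show "\<bar>V x * W x\<bar> \<le> C * D * exp (real (N + M) * x)" .
  qed (use V W in \<open>auto intro!: continuous_intros\<close>)
qed

text \<open>Taylor coefficients are indexed with a shift by two, so that \<open>divpow n\<close>
  is \<open>x\<^sup>m/m!\<close> with \<open>m = n - 2\<close>, read as \<open>0\<close> for negative \<open>m\<close>.\<close>

definition divpow :: "nat \<Rightarrow> real \<Rightarrow> real" where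
  "divpow n x = (if n < 2 then 0 else x ^ (n - 2) / fact (n - 2))"

lemma divpow_deriv: "(divpow (Suc n) has_real_derivative divpow n x) (at x)"
proof (cases "n < 2")
  case True
  then have "n = 0 \<or> n = 1" by auto
  then show ?thesis by (auto simp: divpow_def [abs_def])
next
  case False
  then obtain m where n: "n = m + 2" by (metis add.commute le_Suc_ex not_less)
  have eq: "divpow (Suc n) = (\<lambda>x. x ^ Suc m / fact (Suc m))"
    by (simp add: divpow_def fun_eq_iff n)
  have "((\<lambda>x. x ^ Suc m / fact (Suc m)) has_real_derivative real (Suc m) * x ^ m / fact (Suc m)) (at x)"
    using DERIV_cdivide[OF DERIV_pow[of "Suc m" x UNIV], of "fact (Suc m)"]
    by (simp only: diff_Suc_Suc diff_zero)
  also have "real (Suc m) * x ^ m / fact (Suc m) = divpow n x"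
    by (simp add: divpow_def n fact_Suc del: of_nat_Suc)
  finally show ?thesis unfolding eq .
qed

lemma weight_divpow: "weight (divpow n)"
proof (rule weightI[of _ 1 1])
  show "continuous_on UNIV (divpow n)"
    by (cases "n < 2") (auto simp: divpow_def [abs_def] intro!: continuous_intros)
  fix x :: real assume x: "x \<ge> 0"
  have "x ^ m / fact m \<le> exp x" for m
  proof -
    have "x ^ m * exp (- (2 * x)) * exp (2 * x) \<le> fact m * exp (- x) * exp (2 * x)"
      using power_mult_exp_le[of x 2 m] x by (intro mult_right_mono) auto
    then have "x ^ m \<le> fact m * exp x"
      by (simp add: mult.assoc exp_add [symmetric])
    then show ?thesis by (simp add: field_simps)
  qed
  then show "\<bar>divpow n x\<bar> \<le> 1 * exp (real 1 * x)"
    using x by (auto simp: divpow_def)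
qed auto

text \<open>For n \<ge> 2 this is the coefficient of s^(n-2) in exp (s x) + exp ((1 - s) x), the
  kernel of the symmetrised Mellin integral.\<close>

definition tweight :: "nat \<Rightarrow> real \<Rightarrow> real" where
  "tweight n x = divpow n x * (1 + (- 1) ^ n * exp x)"

lemma weight_tweight: "weight (tweight n)"
  unfolding tweight_def [abs_def]
  by (intro weight_mult weight_add weight_divpow weight_const weight_exp)

text \<open>Expressed by x-derivatives of theta, the integrand on the left is W (theta'' + theta'),
  and the formal adjoint of the operator sends W to W'' - W'.\<close>

lemma theta_integration_by_parts:
  assumes z: "Im z > 0"
    and W: "weight W" "weight W1" "weight W2"
    and W1: "\<And>x. (W has_real_derivative W1 x) (at x)" and W2: "\<And>x. (W1 has_real_derivative W2 x) (at x)"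
  shows "moment W 2 2 2 2 z - 2 * moment W 1 1 1 1 z = moment (\<lambda>x. W2 x - W1 x) 0 0 0 0 z
     + of_real (W 0) * (ntheta 1 1 1 1 z 0 - ntheta 0 0 0 0 z 0) + of_real (W1 0) * ntheta 0 0 0 0 z 0"
proof -
  let ?th = "ntheta 0 0 0 0 z" and ?n1 = "ntheta 1 1 1 1 z" and ?n2 = "ntheta 2 2 2 2 z"
  \<comment> \<open>This is W theta' - W' theta + W theta. Its derivative is W (theta'' + theta') -
    (W'' - W') theta, the function \<open>f\<close>.\<close>
  define \<Phi> where "\<Phi> x = - (of_real (W x) * ?n1 x) - of_real (W1 x) * ?th x + of_real (W x) * ?th x" for x
  define f where "f x = of_real (W x) * ?n2 x - 2 * (of_real (W x) * ?n1 x) - of_real (W2 x - W1 x) * ?th x" for x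
  have dW: "((\<lambda>x. complex_of_real (W x)) has_vector_derivative of_real (W1 x)) (at x)"
    and dW1: "((\<lambda>x. complex_of_real (W1 x)) has_vector_derivative of_real (W2 x)) (at x)" for x
    using W1 W2 unfolding has_real_derivative_iff_has_vector_derivative
    by (auto intro: bounded_linear.has_vector_derivative[OF bounded_linear_of_real])
  have dth: "(?th has_vector_derivative - ?n1 x) (at x)" and dn1: "(?n1 has_vector_derivative ?n1 x - ?n2 x) (at x)" for x
    using ntheta_has_vector_derivative[OF z, of 0 0 0 0 x] ntheta_has_vector_derivative[OF z, of 1 1 1 1 x]
    by (simp_all add: numeral_2_eq_2)
  have d\<Phi>: "(\<Phi> has_vector_derivative f x) (at x)" for x
  proof -
    have "(\<Phi> has_vector_derivative - (of_real (W x) * (?n1 x - ?n2 x) + of_real (W1 x) * ?n1 x)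
        - (of_real (W1 x) * (- ?n1 x) + of_real (W2 x) * ?th x) + (of_real (W x) * (- ?n1 x) + of_real (W1 x) * ?th x)) (at x)"
      unfolding \<Phi>_def [abs_def]
      by (intro has_vector_derivative_add has_vector_derivative_diff has_vector_derivative_minus has_vector_derivative_mult
          dW dW1 dth dn1)
    then show ?thesis unfolding f_def by (simp add: algebra_simps)
  qed
  have Wd: "weight (\<lambda>x. W2 x - W1 x)"
    using weight_add[OF W(3) weight_mult[OF weight_const[of "-1"] W(2)]] by simp
  note int = ntheta_integrable[OF W(1) z, of 2 2 2 2] ntheta_integrable[OF W(1) z, of 1 1 1 1]
    ntheta_integrable[OF Wd z, of 0 0 0 0]
  have intf: "integrable half_line f"
    unfolding f_def
    by (intro Bochner_Integration.integrable_diff integrable_mult_right int)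
  have Wc: "continuous_on UNIV W" "continuous_on UNIV W1" "continuous_on UNIV W2"
    using W by (auto simp: weight_def)
  have fc: "continuous_on UNIV f"
    unfolding f_def by (intro continuous_intros Wc continuous_on_ntheta z)
  have \<Phi>c: "continuous_on UNIV \<Phi>"
    unfolding \<Phi>_def by (intro continuous_intros Wc continuous_on_ntheta z)
  have decay: "((\<lambda>x. of_real (V x) * ntheta k j a b z x) \<longlongrightarrow> 0) at_top" if "weight V" for V k j a b
  proof -
    obtain C where "\<And>x. x \<ge> 0 \<Longrightarrow> norm (of_real (V x) * ntheta k j a b z x) \<le> C * exp (- x)"
      by (rule weight_rapid_bound[OF \<open>weight V\<close> rapid_ntheta[OF z]]) blast
    then have "\<forall>\<^sub>F x in at_top. norm (of_real (V x) * ntheta k j a b z x) \<le> C * exp (- x)"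
      by (intro eventually_mono[OF eventually_ge_at_top[of 0]])
    moreover have "((\<lambda>x::real. C * exp (- x)) \<longlongrightarrow> C * 0) at_top"
      by (intro tendsto_intros filterlim_compose[OF exp_at_bot filterlim_uminus_at_bot_at_top])
    then have "((\<lambda>x::real. C * exp (- x)) \<longlongrightarrow> 0) at_top" by simp
    ultimately show ?thesis by (rule Lim_null_comparison)
  qed
  have lim: "(\<Phi> \<longlongrightarrow> 0) at_top"
  proof -
    have "(\<Phi> \<longlongrightarrow> - 0 - 0 + 0) at_top"
      unfolding \<Phi>_def [abs_def] by (intro tendsto_intros decay W)
    then show ?thesis by simp
  qed
  have "(LBINT x=0..\<infinity>. f x) = 0 - \<Phi> 0"
  proof (rule interval_integral_FTC_integrable[where F = \<Phi>])
    show "set_integrable lborel (einterval 0 \<infinity>) f"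
      using intf unfolding zero_ereal_def einterval_eq by (simp add: set_integrable_eq)
    show "isCont f x" for x using fc by (simp add: continuous_on_eq_continuous_at)
    have "(\<Phi> \<longlongrightarrow> \<Phi> 0) (at_right 0)"
      using \<Phi>c by (metis continuous_on_def UNIV_I tendsto_within_subset subset_UNIV)
    then show "((\<Phi> \<circ> real_of_ereal) \<longlongrightarrow> \<Phi> 0) (at_right 0)"
      unfolding zero_ereal_def ereal_tendsto_simps1 .
    show "((\<Phi> \<circ> real_of_ereal) \<longlongrightarrow> 0) (at_left \<infinity>)"
      unfolding ereal_tendsto_simps1 by (rule lim)
  qed (use d\<Phi> in auto)
  moreover have "(LBINT x=0..\<infinity>. f x) = (LINT x|half_line. f x)"
    unfolding interval_lebesgue_integral_0_infty set_lebesgue_integral_def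
    by (subst integral_restrict_space) auto
  moreover have "(LINT x|half_line. f x) = moment W 2 2 2 2 z - 2 * moment W 1 1 1 1 z - moment (\<lambda>x. W2 x - W1 x) 0 0 0 0 z"
    unfolding f_def moment_def wintegral_def using int by simp
  ultimately show ?thesis
    unfolding \<Phi>_def by (simp add: algebra_simps)
qed

section \<open>The Taylor coefficients as functions on the half plane\<close>

definition theta_coeff :: "nat \<Rightarrow> complex \<Rightarrow> complex" where
  "theta_coeff n z = moment (tweight n) 0 0 0 0 z / 2"

text \<open>The value of \<open>xiBF 0\<close> on \<open>theta_coeff n\<close> in the upper half
  plane, as \<open>theta_coeff_wirtinger\<close> shows.\<close>

definition xi_coeff :: "nat \<Rightarrow> complex \<Rightarrow> complex" where
  "xi_coeff n z = moment (tweight n) 2 1 0 2 z / 2"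

text \<open>This will turn out to be \<open>F n\<close>. It is named before the Mellin transform is
  available, so that the second-order identity can be stated for theta integrals.\<close>

definition theta_coeff_diff :: "nat \<Rightarrow> complex \<Rightarrow> complex" where
  "theta_coeff_diff n z = theta_coeff n z - theta_coeff (n + 1) z + (if n = 0 then 1 / 2 else 0)"

lemma theta_coeff_real: "cnj (theta_coeff n z) = theta_coeff n z"
  by (simp add: theta_coeff_def moment_cnj)

lemma theta_coeff_wirtinger:
  assumes "Im z > 0"
  shows "has_wirtinger (theta_coeff n) (- (\<i> / 2) * xi_coeff n z) (\<i> / 2 * cnj (xi_coeff n z)) z"
  using has_wirtinger_cmult[OF moment_wirtinger[OF weight_tweight[of n] assms, of 0 0 0 0], of "1 / 2"]
  by (simp add: theta_coeff_def [abs_def] xi_coeff_def moment_cnj numeral_2_eq_2)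

lemma moment_shift:
  "moment W (k + m) j a b z = of_real (1 / Im z ^ m) * moment W k j a b z"
proof -
  have "of_real (W x) * ntheta (k + m) j a b z x = of_real (1 / Im z ^ m) * (of_real (W x) * ntheta k j a b z x)" for x
    by (simp add: ntheta_def power_add)
  then show ?thesis by (simp add: moment_def wintegral_def)
qed

lemma moment_weight_diff:
  assumes "weight V" "weight W" "Im z > 0"
  shows "moment (\<lambda>x. V x - W x) k j a b z = moment V k j a b z - moment W k j a b z"
  using ntheta_integrable[OF assms(1,3), of k j a b] ntheta_integrable[OF assms(2,3), of k j a b]
  by (simp add: moment_def wintegral_def left_diff_distrib)

text \<open>Both exp (s x) and exp ((1 - s) x) solve W'' - W' = s(s-1) W. Comparing coefficients of
  s^n gives W'' - W' = \<open>tweight n\<close> - \<open>tweight (n + 1)\<close> for W =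
  \<open>tweight (n + 2)\<close>; the boundary terms supply the constant 1/2.\<close>

lemma tweight_by_parts:
  assumes z: "Im z > 0"
  shows "moment (tweight (n + 2)) 2 2 2 2 z - 2 * moment (tweight (n + 2)) 1 1 1 1 z = 2 * theta_coeff_diff n z"
proof -
  define s where "s = (- 1 :: real) ^ n"
  have tweight: "tweight (n + 2) = (\<lambda>x. divpow (Suc (Suc n)) x * (1 + s * exp x))"
    by (simp add: tweight_def s_def fun_eq_iff)
  define W1 where "W1 x = divpow (Suc n) x * (1 + s * exp x) + divpow (Suc (Suc n)) x * (s * exp x)" for x
  define W2 where "W2 x = divpow n x * (1 + s * exp x) + 2 * (divpow (Suc n) x * (s * exp x))
     + divpow (Suc (Suc n)) x * (s * exp x)" for x
  note w = weight_add weight_mult weight_divpow weight_const weight_exp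
  have W: "weight W1" "weight W2" unfolding W1_def [abs_def] W2_def [abs_def] by (intro w)+
  have e: "((\<lambda>x. 1 + s * exp x) has_real_derivative s * exp x) (at x)"
    "((\<lambda>x. s * exp x) has_real_derivative s * exp x) (at x)" for x
    by (auto intro!: derivative_eq_intros)
  have d1: "(tweight (n + 2) has_real_derivative W1 x) (at x)" for x
    unfolding tweight W1_def using DERIV_mult[OF divpow_deriv[of "Suc n" x] e(1)] by (simp add: algebra_simps)
  have d2: "(W1 has_real_derivative W2 x) (at x)" for x
    unfolding W1_def [abs_def] W2_def
    using DERIV_add[OF DERIV_mult[OF divpow_deriv[of n x] e(1)] DERIV_mult[OF divpow_deriv[of "Suc n" x] e(2)]]
    by (simp add: algebra_simps)
  have diff: "(\<lambda>x. W2 x - W1 x) = (\<lambda>x. tweight n x - tweight (n + 1) x)"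
    by (simp add: W1_def W2_def tweight_def s_def fun_eq_iff algebra_simps)
  \<comment> \<open>For n = 0 the boundary contribution is
    \<open>2 * ntheta 1 1 1 1 z 0 - ntheta 0 0 0 0 z 0\<close>, which is 1 by
    \<open>theta_derivative_at_0\<close>. For n = 1 the value \<open>W1 0\<close> vanishes because 1
    + s = 0.\<close>
  have b: "tweight (n + 2) 0 = (if n = 0 then 2 else 0)" "W1 0 = (if n = 0 then 1 else 0)"
  proof -
    have t0: "tweight (n + 2) 0 = divpow (Suc (Suc n)) 0 * (1 + s)"
      unfolding tweight by simp
    consider "n = 0" | "n = 1" | "n \<ge> 2" by linarith
    then show "tweight (n + 2) 0 = (if n = 0 then 2 else 0)" "W1 0 = (if n = 0 then 1 else 0)"
      unfolding t0 by (cases; simp add: W1_def s_def divpow_def power_0_left)+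
  qed
  show ?thesis
    using theta_integration_by_parts[OF z weight_tweight W d1 d2] theta_derivative_at_0[OF z]
    unfolding diff b moment_weight_diff[OF weight_tweight weight_tweight z] theta_coeff_diff_def theta_coeff_def
    by (auto simp: algebra_simps)
qed

text \<open>\<open>C2_wirtinger f A B\<close> records enough second-order information to evaluate \<open>Lap\<close>:
  the two mixed second Wirtinger derivatives exist and agree.\<close>

definition C2_wirtinger ::
  "(complex \<Rightarrow> complex) \<Rightarrow> (complex \<Rightarrow> complex) \<Rightarrow> (complex \<Rightarrow> complex) \<Rightarrow> bool" where
  "C2_wirtinger f A B \<longleftrightarrow> (\<forall>z. Im z > 0 \<longrightarrow> has_wirtinger f (A z) (B z) z \<and>
     (\<exists>S X T. has_wirtinger A S X z \<and> has_wirtinger B X T z))"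

lemma C2_wirtinger_add:
  assumes "C2_wirtinger f A B" "C2_wirtinger g A' B'"
  shows "C2_wirtinger (\<lambda>z. f z + g z) (\<lambda>z. A z + A' z) (\<lambda>z. B z + B' z)"
  using assms unfolding C2_wirtinger_def by (blast intro: has_wirtinger_add)

lemma C2_wirtinger_cmult:
  assumes "C2_wirtinger f A B"
  shows "C2_wirtinger (\<lambda>z. c * f z) (\<lambda>z. c * A z) (\<lambda>z. c * B z)"
  using assms unfolding C2_wirtinger_def by (blast intro: has_wirtinger_cmult)

lemma C2_wirtinger_zero: "C2_wirtinger (\<lambda>_. 0) (\<lambda>_. 0) (\<lambda>_. 0)"
  unfolding C2_wirtinger_def by (blast intro: has_wirtinger_const)

lemma C2_wirtinger_sum:
  "(\<And>i. i \<in> I \<Longrightarrow> C2_wirtinger (f i) (A i) (B i)) \<Longrightarrow>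
     C2_wirtinger (\<lambda>z. \<Sum>i\<in>I. f i z) (\<lambda>z. \<Sum>i\<in>I. A i z) (\<lambda>z. \<Sum>i\<in>I. B i z)"
  by (induction I rule: infinite_finite_induct)
     (auto intro: C2_wirtinger_zero C2_wirtinger_add)

lemma C2_wirtinger_cong:
  assumes "C2_wirtinger f A B" "\<And>z. Im z > 0 \<Longrightarrow> f z = g z" "\<And>z. Im z > 0 \<Longrightarrow> B z = B' z"
  shows "C2_wirtinger g A B'"
  unfolding C2_wirtinger_def
proof (intro allI impI)
  fix z assume z: "Im z > 0"
  obtain S X T where *: "has_wirtinger f (A z) (B z) z" "has_wirtinger A S X z" "has_wirtinger B X T z"
    using assms(1) z unfolding C2_wirtinger_def by blast
  show "has_wirtinger g (A z) (B' z) z \<and> (\<exists>S X T. has_wirtinger A S X z \<and> has_wirtinger B' X T z)"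
    using has_wirtinger_cong[OF *(1) z assms(2)] has_wirtinger_cong[OF *(3) z assms(3)] *(2) assms(3)[OF z]
    by auto
qed

text \<open>As \<open>xi_coeff\<close> is 2 i times the z-derivative of \<open>theta_coeff\<close>,
  its conjugate derivative is i / (2 y^2) times the Laplacian of \<open>theta_coeff\<close>, which
  \<open>tweight_by_parts\<close> evaluates.\<close>

lemma xi_coeff_C2:
  "\<exists>A. C2_wirtinger (xi_coeff (n + 2)) A (\<lambda>z. \<i> / 2 * (of_real (1 / (Im z)\<^sup>2) * theta_coeff_diff n z))"
proof -
  define V where "V = moment (tweight (n + 2))"
  note w = moment_wirtinger[OF weight_tweight[of "n + 2"], folded V_def]
  define A where "A z = \<i> * V 3 1 0 2 z - \<i> / 2 * V 4 2 0 4 z" for z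
  define B where "B z = - \<i> * V 3 1 1 1 z + \<i> / 2 * V 4 2 2 2 z" for z
  have "C2_wirtinger (V 2 1 0 2) A B"
    unfolding C2_wirtinger_def
  proof (intro allI impI)
    fix z assume z: "Im z > 0"
    \<comment> \<open>The conjugate derivative of \<open>A\<close> in the form produced by
      \<open>moment_wirtinger\<close>. The z-derivative of \<open>B\<close> reduces to the same
      expression, which is the required equality of mixed derivatives.\<close>
    define X where "X = \<i> * (- (3 * \<i> / 2) * V 4 1 0 2 z + \<i> * (V 4 1 0 2 z - V 4 1 1 1 z) + \<i> / 2 * V 5 2 2 2 z)
       - \<i> / 2 * (- (2 * \<i>) * V 5 2 0 4 z + 2 * \<i> * (V 5 2 0 4 z - V 5 2 1 3 z) + \<i> / 2 * V 6 3 2 4 z)"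
    have 1: "has_wirtinger (V 2 1 0 2) (A z) (B z) z"
      using w[OF z, of 2 1 0 2] by (simp add: A_def B_def algebra_simps numeral_eq_Suc)
    have "has_wirtinger (\<lambda>z. \<i> * V 3 1 0 2 z + (- (\<i> / 2)) * V 4 2 0 4 z) (\<i> * (3 * \<i> / 2 * V 4 1 0 2 z - \<i> / 2 * V 5 2 0 4 z) +
        (- (\<i> / 2)) * (2 * \<i> * V 5 2 0 4 z - \<i> / 2 * V 6 3 0 6 z)) X z"
      using has_wirtinger_add[OF has_wirtinger_cmult[OF w[OF z, of 3 1 0 2], of \<i>]
          has_wirtinger_cmult[OF w[OF z, of 4 2 0 4], of "- (\<i> / 2)"]]
      unfolding X_def by (simp add: algebra_simps numeral_eq_Suc)
    then have 2: "\<exists>S. has_wirtinger A S X z" unfolding A_def [abs_def] by (auto simp: algebra_simps)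
    have "\<exists>T. has_wirtinger (\<lambda>z. - \<i> * V 3 1 1 1 z + \<i> / 2 * V 4 2 2 2 z) X T z"
      using has_wirtinger_add[OF has_wirtinger_cmult[OF w[OF z, of 3 1 1 1], of "- \<i>"]
          has_wirtinger_cmult[OF w[OF z, of 4 2 2 2], of "\<i> / 2"]]
      unfolding X_def by (intro exI) (simp add: algebra_simps numeral_eq_Suc)
    then have 3: "\<exists>T. has_wirtinger B X T z" unfolding B_def [abs_def] .
    show "has_wirtinger (V 2 1 0 2) (A z) (B z) z \<and> (\<exists>S X T. has_wirtinger A S X z \<and> has_wirtinger B X T z)"
      using 1 2 3 by blast
  qed
  then have "C2_wirtinger (\<lambda>z. 1 / 2 * V 2 1 0 2 z) (\<lambda>z. 1 / 2 * A z) (\<lambda>z. 1 / 2 * B z)"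
    by (rule C2_wirtinger_cmult)
  then have "C2_wirtinger (xi_coeff (n + 2)) (\<lambda>z. 1 / 2 * A z) (\<lambda>z. \<i> / 2 * (of_real (1 / (Im z)\<^sup>2) * theta_coeff_diff n z))"
  proof (rule C2_wirtinger_cong)
    fix z assume z: "Im z > 0"
    show "1 / 2 * V 2 1 0 2 z = xi_coeff (n + 2) z" by (simp add: xi_coeff_def V_def)
    have "V 3 1 1 1 z = of_real (1 / (Im z)\<^sup>2) * V 1 1 1 1 z" "V 4 2 2 2 z = of_real (1 / (Im z)\<^sup>2) * V 2 2 2 2 z"
      unfolding V_def using moment_shift[of _ 1 2] moment_shift[of _ 2 2] by (simp_all add: numeral_eq_Suc)
    then have "1 / 2 * B z = \<i> / 4 * (of_real (1 / (Im z)\<^sup>2) * (V 2 2 2 2 z - 2 * V 1 1 1 1 z))"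
      unfolding B_def by (simp add: algebra_simps)
    also have "V 2 2 2 2 z - 2 * V 1 1 1 1 z = 2 * theta_coeff_diff n z"
      unfolding V_def by (rule tweight_by_parts[OF z])
    finally show "1 / 2 * B z = \<i> / 2 * (of_real (1 / (Im z)\<^sup>2) * theta_coeff_diff n z)" by simp
  qed
  then show ?thesis by blast
qed

section \<open>Mellin transforms\<close>

lemma exp_of_real_mult_powr:
  "t > 0 \<Longrightarrow> exp (s * of_real (ln t)) = complex_of_real t powr s"
  by (simp add: powr_def Ln_of_real)

text \<open>Euler's integral under the substitution t = e^x.\<close>

lemma gamma_exp_integral_1:
  assumes s: "Re s > 0"
  shows "has_bochner_integral lborel (\<lambda>x. exp (s * of_real x) * of_real (exp (- exp x))) (Gamma s)"
proof -
  define \<sigma> where "\<sigma> = Re s"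
  let ?g = "\<lambda>t. complex_of_real t powr (s - 1) / of_real (exp t)"
  let ?F = "\<lambda>x::real. exp (s * of_real x) * complex_of_real (exp (- exp x))"
  have abs: "set_integrable lebesgue {0<..} ?g"
    by (rule absolutely_integrable_Gamma_integral'[OF s])
  have gc: "continuous_on {0<..} ?g"
    by (intro continuous_intros) auto
  have gi: "set_integrable lborel {0<..} ?g"
  proof -
    have "(\<lambda>x. indicator {0<..} x *\<^sub>R ?g x) \<in> borel_measurable lborel"
      using borel_measurable_continuous_on_indicator[OF _ gc] by simp
    then show ?thesis
      using abs unfolding set_integrable_def by (subst (asm) integrable_completion) auto
  qed
  have lim: "((ereal \<circ> ln \<circ> real_of_ereal) \<longlongrightarrow> -\<infinity>) (at_right 0)"
       "((ereal \<circ> ln \<circ> real_of_ereal) \<longlongrightarrow> \<infinity>) (at_left \<infinity>)"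
    unfolding zero_ereal_def ereal_tendsto_simps1 ereal_tendsto_simps2
    by (rule ln_at_0 ln_at_top)+
  have dln: "(ln has_real_derivative inverse x) (at x)" if "0 < ereal x" for x
    using that by (auto intro!: derivative_eq_intros simp: inverse_eq_divide)
  have sub: "inverse t *\<^sub>R ?F (ln t) = ?g t" if "t > 0" for t
  proof -
    have "?F (ln t) = complex_of_real t powr s / of_real (exp t)"
      using that by (simp add: exp_of_real_mult_powr exp_minus field_simps flip: of_real_inverse)
    moreover have "complex_of_real t powr s = complex_of_real t powr (s - 1) * of_real t"
      using that by (simp add: powr_diff)
    ultimately show ?thesis using that by (simp add: scaleR_conv_of_real)
  qed
  \<comment> \<open>The substitution rule for complex integrands presupposes integrability on both
    sides. The side in x is obtained first, by the rule for nonnegative functions applied to the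
    norm.\<close>
  have "set_integrable lborel (einterval (-\<infinity>) \<infinity>) (\<lambda>x. norm (?F x))"
  proof (rule interval_integral_substitution_nonneg(1)[where g = ln and g' = inverse and a = 0 and b = \<infinity>])
    have "set_integrable lborel {0<..} (\<lambda>t. norm (?g t))"
      using gi by (rule set_integrable_norm)
    moreover have "norm (?g t) = norm (?F (ln t)) * inverse t" if "t \<in> {0<..}" for t
      using sub[of t] that by (simp add: norm_mult flip: sub)
    ultimately show "set_integrable lborel (einterval 0 \<infinity>) (\<lambda>t. norm (?F (ln t)) * inverse t)"
      unfolding zero_ereal_def einterval_eq by (subst set_integrable_cong[OF refl refl, of _ _ "\<lambda>t. norm (?g t)"]) auto
  qed (use lim dln in \<open>auto intro!: continuous_intros simp: zero_ereal_def\<close>)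
  then have nF: "integrable lborel (\<lambda>x. norm (?F x))"
    by (simp add: set_integrable_def)
  have "?F \<in> borel_measurable borel"
    by (intro borel_measurable_continuous_onI continuous_intros)
  then have F: "integrable lborel ?F"
    using nF by (subst (asm) integrable_norm_iff) auto
  have "(LBINT x=-\<infinity>..\<infinity>. ?F x) = (LBINT t=0..\<infinity>. inverse t *\<^sub>R ?F (ln t))"
  proof (rule interval_integral_substitution_integrable)
    have "set_integrable lborel {0<..} (\<lambda>t. inverse t *\<^sub>R ?F (ln t))"
      using gi sub by (subst set_integrable_cong[OF refl refl, of _ _ ?g]) auto
    then show "set_integrable lborel (einterval 0 \<infinity>) (\<lambda>t. inverse t *\<^sub>R ?F (ln t))"
      unfolding zero_ereal_def einterval_eq .
    show "set_integrable lborel (einterval (-\<infinity>) \<infinity>) ?F"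
      using F by (simp add: set_integrable_def)
  qed (use lim dln in \<open>auto intro!: continuous_intros simp: zero_ereal_def\<close>)
  also have "\<dots> = (LINT t:{0<..}|lborel. ?g t)"
    unfolding interval_lebesgue_integral_0_infty
    by (rule set_lebesgue_integral_cong) (use sub in auto)
  also have "\<dots> = integral {0<..} ?g"
    by (rule set_borel_integral_eq_integral(2)[OF gi])
  also have "\<dots> = Gamma s"
    using Gamma_integral_complex'[OF s] by (rule integral_unique)
  finally have "(LINT x|lborel. ?F x) = Gamma s"
    by (simp add: interval_lebesgue_integral_def set_lebesgue_integral_def)
  with F show ?thesis by (simp add: has_bochner_integral_iff)
qed

lemma gamma_exp_integral:
  assumes s: "Re s > 0" and q: "q > 0"
  shows "has_bochner_integral lborel (\<lambda>x. exp (s * of_real x) * of_real (exp (- (q * exp x))))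
     (Gamma s * exp (- s * of_real (ln q)))"
proof -
  have "has_bochner_integral lborel (\<lambda>x. exp (s * of_real (ln q + 1 * x)) * complex_of_real (exp (- exp (ln q + 1 * x)))) (Gamma s /\<^sub>R \<bar>1\<bar>)"
    using gamma_exp_integral_1[OF s]
    by (subst lborel_has_bochner_integral_real_affine_iff[of 1 _ _ "ln q", symmetric]) auto
  then have "has_bochner_integral lborel (\<lambda>x. exp (- s * of_real (ln q)) * (exp (s * of_real (ln q + 1 * x)) * complex_of_real (exp (- exp (ln q + 1 * x)))))
     (exp (- s * of_real (ln q)) * (Gamma s /\<^sub>R \<bar>1\<bar>))"
    by (rule has_bochner_integral_mult_right[rotated])
  moreover have "exp (- s * of_real (ln q)) * (exp (s * of_real (ln q + 1 * x)) * complex_of_real (exp (- exp (ln q + 1 * x)))) =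
      exp (s * of_real x) * of_real (exp (- (q * exp x)))" for x
  proof -
    have "exp (- s * of_real (ln q)) * exp (s * of_real (ln q + 1 * x)) = exp (s * of_real x)"
      by (simp add: exp_add [symmetric] algebra_simps)
    moreover have "exp (ln q + 1 * x) = q * exp x" using q by (simp add: exp_add)
    ultimately show ?thesis by (simp only: mult.assoc [symmetric])
  qed
  ultimately show ?thesis by (simp add: mult.commute)
qed

text \<open>Fubini for counting measure times Lebesgue measure. The integral of the norm of a
  summand is again a Gamma integral, now at Re s, so \<open>summ\<close> controls the double
  integral.\<close>

lemma mellin_lattice_sum:
  fixes c :: "'a \<Rightarrow> complex" and q :: "'a \<Rightarrow> real"
  assumes A: "countable A" and q: "\<And>p. p \<in> A \<Longrightarrow> q p > 0" and s: "Re s > 0"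
    and summ: "(\<lambda>p. norm (c p * exp (- s * of_real (ln (q p))))) summable_on A"
    and inner: "\<And>x. (\<lambda>p. norm (c p * of_real (exp (- (q p * exp x))))) summable_on A"
  shows "has_bochner_integral lborel (\<lambda>x. exp (s * of_real x) * (\<Sum>\<^sub>\<infinity>p\<in>A. c p * of_real (exp (- (q p * exp x)))))
     (Gamma s * (\<Sum>\<^sub>\<infinity>p\<in>A. c p * exp (- s * of_real (ln (q p)))))"
proof -
  let ?E = "\<lambda>p x. exp (s * of_real x) * complex_of_real (exp (- (q p * exp x)))"
  let ?h = "\<lambda>p x. c p * ?E p x"
  let ?C = "count_space A"
  interpret sigma_finite_measure ?C by (rule sigma_finite_measure_count_space_countable[OF A])
  interpret pair_sigma_finite ?C lborel ..
  have E: "has_bochner_integral lborel (?E p) (Gamma s * exp (- s * of_real (ln (q p))))" if "p \<in> A" for p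
    by (rule gamma_exp_integral[OF s q[OF that]])
  have hint: "has_bochner_integral lborel (?h p) (c p * (Gamma s * exp (- s * of_real (ln (q p)))))" if "p \<in> A" for p
    by (rule has_bochner_integral_mult_right[OF E[OF that]])
  have nh: "(LINT x|lborel. norm (?h p x)) = norm (c p * exp (- s * of_real (ln (q p)))) * Re (Gamma (of_real (Re s)))" if "p \<in> A" for p
  proof -
    have *: "has_bochner_integral lborel (\<lambda>x. exp (of_real (Re s) * of_real x) * complex_of_real (exp (- (q p * exp x))))
       (Gamma (of_real (Re s)) * exp (- of_real (Re s) * of_real (ln (q p))))"
      using gamma_exp_integral[of "of_real (Re s)" "q p"] s q[OF that] by simp
    have eq: "exp (of_real (Re s) * of_real x) * complex_of_real (exp (- (q p * exp x))) = of_real (norm (?E p x))" for x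
      by (simp add: norm_mult exp_of_real [symmetric])
    have "has_bochner_integral lborel (\<lambda>x. Re (complex_of_real (norm (?E p x)))) (Re (Gamma (of_real (Re s)) * exp (- of_real (Re s) * of_real (ln (q p)))))"
      using * unfolding eq by (rule has_bochner_integral_Re)
    then have "(LINT x|lborel. norm (?E p x)) = Re (Gamma (of_real (Re s)) * exp (- of_real (Re s) * of_real (ln (q p))))"
      by (simp add: has_bochner_integral_iff)
    also have "exp (- of_real (Re s) * of_real (ln (q p))) = complex_of_real (norm (exp (- s * of_real (ln (q p)))))"
      by (simp add: exp_of_real [symmetric])
    finally show ?thesis by (simp add: norm_mult mult_ac)
  qed
  have int: "integrable (?C \<Otimes>\<^sub>M lborel) (case_prod ?h)"
  proof (rule Fubini_integrable)
    show "case_prod ?h \<in> borel_measurable (?C \<Otimes>\<^sub>M lborel)"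
    proof (rule measurable_pair_measure_countable1[OF A])
      fix p assume "p \<in> A"
      show "(\<lambda>x. case_prod ?h (p, x)) \<in> borel_measurable lborel"
        using hint[OF \<open>p \<in> A\<close>] by (auto simp: has_bochner_integral_iff)
    qed
    have "integrable ?C (\<lambda>p. complex_of_real (norm (c p * exp (- s * of_real (ln (q p))))))"
      using summ by (intro integral_count_space_eq_infsum(1)) simp
    then have "integrable ?C (\<lambda>p. norm (c p * exp (- s * of_real (ln (q p)))))"
      by (simp only: complex_of_real_integrable_eq)
    then have "integrable ?C (\<lambda>p. norm (c p * exp (- s * of_real (ln (q p)))) * Re (Gamma (of_real (Re s))))"
      by (rule integrable_mult_left[rotated])
    then show "integrable ?C (\<lambda>p. LINT x|lborel. norm (case_prod ?h (p, x)))"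
      by (subst Bochner_Integration.integrable_cong[OF refl, where g = "\<lambda>p. norm (c p * exp (- s * of_real (ln (q p)))) * Re (Gamma (of_real (Re s)))"])
         (use nh in auto)
    show "AE p in ?C. integrable lborel (\<lambda>x. case_prod ?h (p, x))"
      using hint by (intro AE_I2) (auto simp: has_bochner_integral_iff)
  qed
  have sum: "(LINT p|?C. ?h p x) = exp (s * of_real x) * (\<Sum>\<^sub>\<infinity>p\<in>A. c p * of_real (exp (- (q p * exp x))))" for x
  proof -
    have "(LINT p|?C. exp (s * of_real x) * (c p * of_real (exp (- (q p * exp x))))) = exp (s * of_real x) * (LINT p|?C. c p * of_real (exp (- (q p * exp x))))"
      by simp
    also have "(LINT p|?C. c p * of_real (exp (- (q p * exp x)))) = (\<Sum>\<^sub>\<infinity>p\<in>A. c p * of_real (exp (- (q p * exp x))))"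
      by (rule integral_count_space_eq_infsum(2)[OF inner])
    finally show ?thesis by (simp add: mult_ac)
  qed
  have "(LINT x|lborel. LINT p|?C. ?h p x) = (LINT p|?C. LINT x|lborel. ?h p x)"
    by (rule Fubini_integral[OF int])
  also have "\<dots> = (LINT p|?C. Gamma s * (c p * exp (- s * of_real (ln (q p)))))"
    by (rule Bochner_Integration.integral_cong[OF refl]) (use hint in \<open>auto simp: has_bochner_integral_iff\<close>)
  also have "\<dots> = Gamma s * (\<Sum>\<^sub>\<infinity>p\<in>A. c p * exp (- s * of_real (ln (q p))))"
    using integral_count_space_eq_infsum(2)[OF summ] by simp
  finally have "(LINT x|lborel. LINT p|?C. ?h p x) = Gamma s * (\<Sum>\<^sub>\<infinity>p\<in>A. c p * exp (- s * of_real (ln (q p))))" .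
  moreover have "integrable lborel (\<lambda>x. LINT p|?C. ?h p x)"
    using integrable_snd[OF int] by simp
  ultimately show ?thesis unfolding sum by (simp add: has_bochner_integral_iff)
qed

lemma integral_lborel_split:
  fixes h :: "real \<Rightarrow> complex"
  assumes "continuous_on UNIV h" "integrable half_line h" "integrable half_line (\<lambda>x. h (- x))"
  shows "has_bochner_integral lborel h ((LINT x|half_line. h x) + (LINT x|half_line. h (- x)))"
proof -
  have 1: "integrable lborel (\<lambda>x. indicator {0<..} x *\<^sub>R h x)" "integrable lborel (\<lambda>x. indicator {0<..} x *\<^sub>R h (- x))"
    using assms(2,3) by (simp_all add: integrable_restrict_space)
  have 2: "has_bochner_integral lborel (\<lambda>x. indicator {0<..} (- x) *\<^sub>R h x) (LINT x|half_line. h (- x))"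
  proof -
    have "has_bochner_integral lborel (\<lambda>x. indicator {0<..} x *\<^sub>R h (- x)) (LINT x|half_line. h (- x))"
      using 1(2) by (simp add: has_bochner_integral_iff integral_restrict_space)
    from lborel_has_bochner_integral_real_affine_iff[of "-1" "\<lambda>x. indicator {0<..} x *\<^sub>R h (- x)" _ 0, THEN iffD1, OF _ this]
    show ?thesis by simp
  qed
  have "has_bochner_integral lborel (\<lambda>x. indicator {0<..} x *\<^sub>R h x) (LINT x|half_line. h x)"
    using 1(1) by (simp add: has_bochner_integral_iff integral_restrict_space)
  from has_bochner_integral_add[OF this 2]
  have 3: "has_bochner_integral lborel (\<lambda>x. indicator {0<..} x *\<^sub>R h x + indicator {0<..} (- x) *\<^sub>R h x)
     ((LINT x|half_line. h x) + (LINT x|half_line. h (- x)))" .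
  show ?thesis
  proof (rule has_bochner_integral_cong_AE[THEN iffD1, OF _ _ _ 3])
    show "AE x in lborel. indicator {0<..} x *\<^sub>R h x + indicator {0<..} (- x) *\<^sub>R h x = h x"
    proof -
      have "AE x in lborel. x \<noteq> (0::real)" by (rule AE_lborel_singleton)
      then show ?thesis by eventually_elim (auto simp: indicator_def)
    qed
    show "h \<in> borel_measurable lborel"
      using borel_measurable_continuous_onI[OF assms(1)] by simp
  qed (use 3 in \<open>auto dest: borel_measurable_has_bochner_integral\<close>)
qed

lemma exp_half_line_integral:
  assumes a: "Re a > 0"
  shows "has_bochner_integral half_line (\<lambda>x. exp (- (a * of_real x))) (1 / a)"
proof -
  have a0: "a \<noteq> 0" using a by auto
  have int: "integrable half_line (\<lambda>x. exp (- (a * of_real x)))"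
  proof (rule Bochner_Integration.integrable_bound)
    show "integrable half_line (\<lambda>x. exp (- (x * Re a)))"
      using integrable_I0i_exp_mscale[OF a] by (simp add: set_integrable_eq)
    show "(\<lambda>x. exp (- (a * of_real x))) \<in> borel_measurable half_line"
      by (intro continuous_measurable_half_line continuous_intros)
  qed (auto simp: mult.commute)
  have "(LBINT x=0..\<infinity>. exp (- (a * of_real x))) = 0 - (- (exp (- (a * of_real 0)) / a))"
  proof (rule interval_integral_FTC_integrable[where F = "\<lambda>x. - (exp (- (a * of_real x)) / a)"])
    show "((\<lambda>x. - (exp (- (a * of_real x)) / a)) has_vector_derivative exp (- (a * of_real x))) (at x)" for x
    proof -
      have "((\<lambda>z. - (exp (- (a * z)) / a)) has_field_derivative exp (- (a * of_real x))) (at (of_real x))"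
        using a0 by (auto intro!: derivative_eq_intros)
      then show ?thesis by (rule has_vector_derivative_real_field)
    qed
    show "isCont (\<lambda>x. exp (- (a * complex_of_real x))) x" for x
      by (intro continuous_intros)
    show "set_integrable lborel (einterval 0 \<infinity>) (\<lambda>x. exp (- (a * complex_of_real x)))"
      using int unfolding zero_ereal_def einterval_eq by (simp add: set_integrable_eq)
    have "((\<lambda>x. - (exp (- (a * complex_of_real x)) / a)) \<longlongrightarrow> - (exp (- (a * of_real 0)) / a)) (at_right 0)"
      using a0 by (intro tendsto_intros) auto
    then show "(((\<lambda>x. - (exp (- (a * complex_of_real x)) / a)) \<circ> real_of_ereal) \<longlongrightarrow> - (exp (- (a * of_real 0)) / a)) (at_right 0)"
      unfolding zero_ereal_def ereal_tendsto_simps1 .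
    have "((\<lambda>x. - (exp (- (a * complex_of_real x)) / a)) \<longlongrightarrow> 0) at_top"
    proof (rule Lim_null_comparison)
      show "eventually (\<lambda>x. norm (- (exp (- (a * complex_of_real x)) / a)) \<le> exp (- (Re a * x)) / norm a) at_top"
        by (simp add: norm_divide)
      have "((\<lambda>x. exp (- (Re a * x)) / norm a) \<longlongrightarrow> 0 / norm a) at_top"
        using a a0 by (intro tendsto_divide tendsto_const filterlim_compose[OF exp_at_bot]
            filterlim_compose[OF filterlim_uminus_at_bot_at_top] filterlim_tendsto_pos_mult_at_top[OF tendsto_const _ filterlim_ident]) auto
      then show "((\<lambda>x. exp (- (Re a * x)) / norm a) \<longlongrightarrow> 0) at_top" by simp
    qed
    then show "(((\<lambda>x. - (exp (- (a * complex_of_real x)) / a)) \<circ> real_of_ereal) \<longlongrightarrow> 0) (at_left \<infinity>)"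
      unfolding ereal_tendsto_simps1 .
  qed auto
  moreover have "(LBINT x=0..\<infinity>. exp (- (a * complex_of_real x))) = (LINT x|half_line. exp (- (a * of_real x)))"
    unfolding interval_lebesgue_integral_0_infty set_lebesgue_integral_def
    by (subst integral_restrict_space) auto
  ultimately show ?thesis using int by (simp add: has_bochner_integral_iff)
qed

section \<open>Entire Mellin integrals and their Taylor series\<close>

lemma weight_exp_mult: "weight (\<lambda>x. exp (c * x))"
proof (rule weightI[of _ 1 "nat \<lceil>\<bar>c\<bar>\<rceil>"])
  fix x :: real assume "x \<ge> 0"
  have "c \<le> real (nat \<lceil>\<bar>c\<bar>\<rceil>)" by linarith
  then show "\<bar>exp (c * x)\<bar> \<le> 1 * exp (real (nat \<lceil>\<bar>c\<bar>\<rceil>) * x)"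
    using \<open>x \<ge> 0\<close> by (simp add: mult_right_mono)
qed (auto intro!: continuous_intros)

lemma rapid_exp_integrable:
  assumes "rapid g"
  shows "integrable half_line (\<lambda>x. exp (s * of_real x) * g x)"
proof (rule Bochner_Integration.integrable_bound[OF rapid_weighted_integrable[OF weight_exp_mult[of "Re s"] assms]])
  have "continuous_on UNIV g" using assms by (simp add: rapid_def)
  then show "(\<lambda>x. exp (s * of_real x) * g x) \<in> borel_measurable half_line"
    by (intro continuous_measurable_half_line continuous_intros)
qed (simp add: norm_mult)

text \<open>What remains of a Mellin integral over the line when x < 0 is folded onto x > 0 by a
  functional equation with factor exp x. For rapid g it converges for every s; it is symmetric under
  s -> 1 - s.\<close>

definition sym_mellin :: "(real \<Rightarrow> complex) \<Rightarrow> complex \<Rightarrow> complex" where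
  "sym_mellin g s = (LINT x|half_line. exp (s * of_real x) * g x) + (LINT x|half_line. exp ((1 - s) * of_real x) * g x)"

lemma exp_sums_powers:
  fixes w :: complex and x :: real
  shows "(\<lambda>j. of_real (x ^ j / fact j) * w ^ j) sums exp (w * of_real x)"
proof -
  have "(\<lambda>n. (w * of_real x) ^ n /\<^sub>R fact n) sums exp (w * of_real x)"
    by (rule exp_converges)
  then show ?thesis by (simp add: power_mult_distrib scaleR_conv_of_real divide_inverse mult_ac)
qed

text \<open>Both exponentials are expanded in powers of s; the sign (-1)^j in \<open>tweight\<close>
  comes from exp (- s x) in the second one.\<close>

lemma sym_mellin_sums:
  assumes g: "rapid g"
  shows "(\<lambda>j. wintegral (tweight (j + 2)) g * s ^ j) sums sym_mellin g s"
proof -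
  have gc: "continuous_on UNIV g" using g by (simp add: rapid_def)
  have dp: "divpow (j + 2) x = x ^ j / fact j" for j x by (simp add: divpow_def)
  define f where "f j x = of_real (tweight (j + 2) x) * g x * s ^ j" for j x
  \<comment> \<open>The moduli of the terms sum to at most exp (|s| x) (1 + exp x) |g x|, a weight
    times a rapid function, which justifies termwise integration.\<close>
  define W where "W x = exp (norm s * x) + exp (norm s * x) * exp (1 * x)" for x
  have W: "weight W" unfolding W_def by (intro weight_add weight_mult weight_exp_mult)
  have intf: "integrable half_line (f j)" for j
    unfolding f_def by (intro integrable_mult_left rapid_weighted_integrable weight_tweight g)
  have tweight_bound: "norm (f j x) \<le> (norm s * x) ^ j / fact j * (1 + exp x) * norm (g x)" if "x \<ge> 0" for j x
  proof -
    have "\<bar>(- 1) ^ j * exp x\<bar> = exp x" by (simp add: abs_mult power_abs)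
    then have "\<bar>1 + (- 1) ^ j * exp x\<bar> \<le> 1 + exp x"
      using abs_triangle_ineq[of 1 "(- 1) ^ j * exp x"] by simp
    then have "\<bar>tweight (j + 2) x\<bar> \<le> x ^ j / fact j * (1 + exp x)"
      using that unfolding tweight_def dp abs_mult by (intro mult_mono) auto
    then have "\<bar>tweight (j + 2) x\<bar> * norm (g x) * norm s ^ j \<le> x ^ j / fact j * (1 + exp x) * norm (g x) * norm s ^ j"
      by (intro mult_right_mono) auto
    then show ?thesis by (simp add: f_def norm_mult norm_power power_mult_distrib mult_ac)
  qed
  have psum: "(\<Sum>j<n. norm (f j x)) \<le> norm (of_real (W x) * g x)" if "x \<ge> 0" for n x
  proof -
    have "(\<Sum>j<n. norm (f j x)) \<le> (\<Sum>j<n. (norm s * x) ^ j / fact j * (1 + exp x) * norm (g x))"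
      by (intro sum_mono tweight_bound that)
    also have "\<dots> = (\<Sum>j<n. (norm s * x) ^ j / fact j) * ((1 + exp x) * norm (g x))"
      by (simp add: sum_distrib_right mult.assoc)
    also have "\<dots> \<le> exp (norm s * x) * ((1 + exp x) * norm (g x))"
    proof (rule mult_right_mono)
      have "(\<Sum>j<n. (norm s * x) ^ j / fact j) \<le> (\<Sum>j. (norm s * x) ^ j / fact j)"
        using that summable_exp[of "norm s * x"] by (intro sum_le_suminf) (auto simp: divide_inverse mult.commute)
      also have "\<dots> = exp (norm s * x)" by (simp add: exp_def scaleR_conv_of_real divide_inverse mult.commute)
      finally show "(\<Sum>j<n. (norm s * x) ^ j / fact j) \<le> exp (norm s * x)" .
    qed (auto intro!: mult_nonneg_nonneg add_nonneg_nonneg)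
    also have "\<dots> = W x * norm (g x)" by (simp add: W_def algebra_simps)
    also have "\<dots> = norm (of_real (W x) * g x)"
      unfolding norm_mult norm_of_real by (simp add: W_def)
    finally show ?thesis .
  qed
  have sp: "x \<ge> 0" if "x \<in> space half_line" for x using that by (simp add: space_restrict_space)
  have "(\<lambda>j. integral\<^sup>L half_line (f j)) sums (LINT x|half_line. (\<Sum>j. f j x))"
  proof (rule sums_integral)
    show "AE x in half_line. summable (\<lambda>j. norm (f j x))"
    proof (rule AE_I2)
      fix x assume "x \<in> space half_line"
      then show "summable (\<lambda>j. norm (f j x))"
        using psum[OF sp] by (intro summableI_nonneg_bounded[of _ "norm (of_real (W x) * g x)"]) auto
    qed
    show "summable (\<lambda>j. LINT x|half_line. norm (f j x))"
    proof (rule summableI_nonneg_bounded)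
      show "(\<Sum>j<n. LINT x|half_line. norm (f j x)) \<le> (LINT x|half_line. norm (of_real (W x) * g x))" for n
      proof -
        have "(\<Sum>j<n. LINT x|half_line. norm (f j x)) = (LINT x|half_line. (\<Sum>j<n. norm (f j x)))"
          using intf by (subst Bochner_Integration.integral_sum) auto
        also have "\<dots> \<le> (LINT x|half_line. norm (of_real (W x) * g x))"
        proof (rule integral_mono)
          show "integrable half_line (\<lambda>x. \<Sum>j<n. norm (f j x))"
            using intf by (intro Bochner_Integration.integrable_sum integrable_norm)
          show "integrable half_line (\<lambda>x. norm (of_real (W x) * g x))"
            by (intro integrable_norm rapid_weighted_integrable W g)
        qed (use psum sp in blast)
        finally show ?thesis .
      qed
    qed simp
  qed (rule intf)
  moreover have "(\<Sum>j. f j x) = exp (s * of_real x) * g x + exp ((1 - s) * of_real x) * g x" for x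
  proof -
    have "(\<lambda>j. of_real (x ^ j / fact j) * s ^ j * g x) sums (exp (s * of_real x) * g x)"
      by (intro sums_mult2 exp_sums_powers)
    moreover have "(\<lambda>j. of_real (x ^ j / fact j) * (- s) ^ j * (of_real (exp x) * g x)) sums (exp (- s * of_real x) * (of_real (exp x) * g x))"
      by (intro sums_mult2 exp_sums_powers)
    ultimately have "(\<lambda>j. of_real (x ^ j / fact j) * s ^ j * g x + of_real (x ^ j / fact j) * (- s) ^ j * (of_real (exp x) * g x))
       sums (exp (s * of_real x) * g x + exp (- s * of_real x) * (of_real (exp x) * g x))"
      by (rule sums_add)
    moreover have "of_real (x ^ j / fact j) * s ^ j * g x + of_real (x ^ j / fact j) * (- s) ^ j * (of_real (exp x) * g x) = f j x" for j
      unfolding f_def tweight_def dp power_minus[of s] by (simp add: algebra_simps)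
    moreover have "exp (- s * of_real x) * (of_real (exp x) * g x) = exp ((1 - s) * of_real x) * g x"
      by (simp add: exp_of_real [symmetric] mult.assoc [symmetric] exp_add [symmetric] algebra_simps)
    ultimately show ?thesis by (simp add: sums_iff)
  qed
  moreover have "integral\<^sup>L half_line (f j) = wintegral (tweight (j + 2)) g * s ^ j" for j
    unfolding f_def wintegral_def by simp
  ultimately show ?thesis
    unfolding sym_mellin_def using rapid_exp_integrable[OF g, of s] rapid_exp_integrable[OF g, of "1 - s"] by simp
qed

text \<open>Multiplication by s^2 - s shifts the series by two and by one. \<open>tweight 0\<close>
  and \<open>tweight 1\<close> vanish, so the shifts leave no exceptional terms. The constant
  \<open>c\<close> is 1/2 in weight 0 and 0 in weight 2.\<close>

lemma completed_taylor_sums: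
  assumes "rapid g"
  shows "(\<lambda>n. ((wintegral (tweight n) g - wintegral (tweight (n + 1)) g) / 2 + (if n = 0 then c else 0)) * s ^ n) sums
     (s * (s - 1) / 2 * sym_mellin g s + c)"
proof -
  have tw0: "wintegral (tweight 0) g = 0" "wintegral (tweight (Suc 0)) g = 0"
    by (simp_all add: wintegral_def tweight_def [abs_def] divpow_def)
  have 1: "(\<lambda>j. wintegral (tweight (Suc (Suc j))) g * s ^ j) sums sym_mellin g s"
    using sym_mellin_sums[OF assms, of s] by simp
  have "(\<lambda>j. wintegral (tweight (Suc (Suc j))) g * s ^ Suc j) sums (s * sym_mellin g s)"
    using sums_mult[OF 1, of s] by (simp add: mult_ac)
  then have 2: "(\<lambda>n. wintegral (tweight (Suc n)) g * s ^ n) sums (s * sym_mellin g s)"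
    by (subst (asm) sums_Suc_iff) (simp add: tw0)
  have "(\<lambda>n. wintegral (tweight (Suc n)) g * s ^ Suc n) sums (s * (s * sym_mellin g s))"
    using sums_mult[OF 2, of s] by (simp add: mult_ac)
  then have 3: "(\<lambda>n. wintegral (tweight n) g * s ^ n) sums (s * (s * sym_mellin g s))"
    by (subst (asm) sums_Suc_iff) (simp add: tw0)
  have 4: "(\<lambda>n. (if n = 0 then c else 0) * s ^ n) sums c"
    using sums_single[of 0 "\<lambda>n. c * s ^ n"] by (simp add: if_distrib[of "\<lambda>x. x * _"] cong: if_cong)
  from sums_add[OF sums_divide[OF sums_diff[OF 3 2], of 2] 4]
  show ?thesis by (simp add: algebra_simps diff_divide_distrib)
qed

section \<open>Taylor coefficients and uniqueness of the continuation\<close>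

lemma entire_power_series:
  fixes H :: "complex \<Rightarrow> complex"
  assumes "\<And>s. (\<lambda>n. a n * s ^ n) sums H s"
  shows "H holomorphic_on UNIV" "(deriv ^^ n) H 0 / of_nat (fact n) = a n"
proof -
  have "H field_differentiable at w" for w
  proof -
    have "H holomorphic_on ball 0 (norm w + 1)"
      by (rule power_series_holomorphic[of _ _ a]) (use assms in simp)
    then show ?thesis
      by (rule holomorphic_on_imp_differentiable_at) auto
  qed
  then show "H holomorphic_on UNIV"
    by (auto simp: holomorphic_on_def field_differentiable_at_within)
  have "H has_fps_expansion Abs_fps a"
    by (rule has_fps_expansionI) (use assms in simp)
  from fps_nth_fps_expansion[OF this, of n]
  show "(deriv ^^ n) H 0 / of_nat (fact n) = a n" by simp
qed

text \<open>The description in \<open>EEhat\<close> admits only one function, by the identity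
  theorem on the nonempty open half plane Re (2 s + k) > 2.\<close>

lemma EEhat_eqI:
  assumes g: "g holomorphic_on UNIV" "\<And>s. Re (2 * s + of_int k) > 2 \<Longrightarrow> g s = EEhat_series k z s"
  shows "EEhat k z = g"
  unfolding EEhat_def
proof (rule the_equality)
  fix f assume f: "f holomorphic_on UNIV \<and> (\<forall>s. Re (2 * s + of_int k) > 2 \<longrightarrow> f s = EEhat_series k z s)"
  let ?S = "{s::complex. Re (2 * s + of_int k) > 2}"
  show "f = g"
  proof
    fix s
    show "f s = g s"
    proof (rule analytic_continuation_open[of ?S UNIV f g])
      show "open ?S" by (intro open_Collect_less continuous_intros)
      have "complex_of_real (2 - of_int k / 2) \<in> ?S" by simp
      then show "?S \<noteq> {}" by blast
    qed (use f g in auto)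
  qed
qed (use g in auto)

lemma qform_pos:
  assumes "Im z > 0" "p \<in> lattice"
  shows "qform z p > 0"
proof -
  obtain r c B where "r > 0" "c > 0" and c: "\<And>w p. w \<in> ball z r \<Longrightarrow> c * height p \<le> qform w p"
    using lattice_local_bound[OF assms(1)] by metis
  have "height p \<ge> 1" using assms(2) by (intro height_ge_1) auto
  then have "c * height p > 0" using \<open>c > 0\<close> by simp
  with c[of z p] \<open>r > 0\<close> show ?thesis by simp
qed

text \<open>Folding x < 0 by \<open>theta_functional_equation\<close> leaves two pure exponentials
  from the summands 1; they integrate to 1/(s-1) and 1/s, the first of which needs Re s > 1.\<close>

lemma theta_mellin:
  assumes z: "Im z > 0" and s: "Re s > 1"
  shows "has_bochner_integral lborel (\<lambda>x. exp (s * of_real x) * theta 0 0 z x)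
     (sym_mellin (theta 0 0 z) s + 1 / (s - 1) - 1 / s)"
proof -
  let ?h = "\<lambda>x. exp (s * of_real x) * theta 0 0 z x"
  have g: "rapid (theta 0 0 z)" using rapid_ntheta[OF z, of 0 0 0 0] by (simp add: ntheta_def [abs_def])
  have hm: "?h (- x) = exp ((1 - s) * of_real x) * theta 0 0 z x + exp (- ((s - 1) * of_real x)) - exp (- (s * of_real x))" for x
  proof -
    have "theta 0 0 z (- x) = exp (of_real x) * (theta 0 0 z x + 1) - 1"
      using theta_functional_equation[OF z, of x] by (simp add: exp_of_real eq_diff_eq)
    moreover have "exp (- (s * of_real x)) * exp (of_real x) = exp ((1 - s) * of_real x)"
      by (simp add: exp_add [symmetric] algebra_simps)
    moreover have "(1 - s) * of_real x = - ((s - 1) * of_real x)" by (simp add: algebra_simps)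
    moreover have "exp (s * of_real (- x)) * (exp (of_real x) * (theta 0 0 z x + 1) - 1) =
       (exp (- (s * of_real x)) * exp (of_real x)) * theta 0 0 z x + exp (- (s * of_real x)) * exp (of_real x) - exp (- (s * of_real x))"
      by (simp add: algebra_simps)
    ultimately show ?thesis by simp
  qed
  have e1: "has_bochner_integral half_line (\<lambda>x. exp (- ((s - 1) * of_real x))) (1 / (s - 1))"
    and e2: "has_bochner_integral half_line (\<lambda>x. exp (- (s * of_real x))) (1 / s)"
    using s by (intro exp_half_line_integral; simp)+
  have "has_bochner_integral half_line (\<lambda>x. exp ((1 - s) * of_real x) * theta 0 0 z x) (LINT x|half_line. exp ((1 - s) * of_real x) * theta 0 0 z x)"
    using rapid_exp_integrable[OF g] by (simp add: has_bochner_integral_iff)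
  from has_bochner_integral_diff[OF has_bochner_integral_add[OF this e1] e2]
  have m: "has_bochner_integral half_line (\<lambda>x. ?h (- x)) ((LINT x|half_line. exp ((1 - s) * of_real x) * theta 0 0 z x) + 1 / (s - 1) - 1 / s)"
    unfolding hm .
  have "has_bochner_integral lborel ?h ((LINT x|half_line. ?h x) + (LINT x|half_line. ?h (- x)))"
  proof (rule integral_lborel_split)
    show "continuous_on UNIV ?h" using g by (intro continuous_intros) (simp add: rapid_def)
    show "integrable half_line ?h" by (rule rapid_exp_integrable[OF g])
    show "integrable half_line (\<lambda>x. ?h (- x))" using m by (simp add: has_bochner_integral_iff)
  qed
  then show ?thesis
    using m by (simp add: has_bochner_integral_iff sym_mellin_def algebra_simps)
qed

text \<open>Convergence of the lattice series follows from theta itself: a finite partial sum times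
  Gamma \<sigma> is the integral of finitely many positive terms of the theta series, hence at most
  its Mellin integral from \<open>theta_mellin\<close>.\<close>

lemma qform_powers_summable:
  assumes z: "Im z > 0" and s: "\<sigma> > 1"
  shows "(\<lambda>p. exp (- \<sigma> * ln (pi * qform z p))) summable_on lattice"
proof (rule nonneg_bdd_above_summable_on)
  let ?E = "\<lambda>p x. exp (\<sigma> * x) * exp (- (pi * qform z p * exp x))"
  have G: "has_bochner_integral lborel (?E p) (Gamma \<sigma> * exp (- \<sigma> * ln (pi * qform z p)))" if "p \<in> lattice" for p
  proof -
    have "has_bochner_integral lborel (\<lambda>x. exp (of_real \<sigma> * of_real x) * complex_of_real (exp (- (pi * qform z p * exp x))))
       (Gamma (of_real \<sigma>) * exp (- of_real \<sigma> * of_real (ln (pi * qform z p))))"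
      using s qform_pos[OF z that] by (intro gamma_exp_integral) auto
    from has_bochner_integral_Re[OF this] show ?thesis
      by (simp add: Gamma_complex_of_real exp_of_real flip: of_real_mult of_real_minus)
  qed
  have T: "has_bochner_integral lborel (\<lambda>x. Re (exp (of_real \<sigma> * of_real x) * theta 0 0 z x))
      (Re (sym_mellin (theta 0 0 z) \<sigma> + 1 / (\<sigma> - 1) - 1 / \<sigma>))"
    using theta_mellin[OF z, of "of_real \<sigma>"] s by (intro has_bochner_integral_Re) simp
  have le: "(\<Sum>p\<in>F. ?E p x) \<le> Re (exp (of_real \<sigma> * of_real x) * theta 0 0 z x)" if F: "F \<subseteq> lattice" "finite F" for F x
  proof -
    have tt: "theta_term 0 0 z x = (\<lambda>p. of_real (exp (- (pi * qform z p * exp x))))"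
      by (simp add: theta_term_def fun_eq_iff mult_ac)
    have sm: "(\<lambda>p. exp (- (pi * qform z p * exp x))) summable_on lattice"
      using theta_term_abs_summable[OF z, of 0 0 x] unfolding tt by simp
    then have "theta 0 0 z x = of_real (\<Sum>\<^sub>\<infinity>p\<in>lattice. exp (- (pi * qform z p * exp x)))"
      unfolding theta_def tt by (intro infsumI has_sum_of_real has_sum_infsum)
    moreover have "(\<Sum>p\<in>F. exp (- (pi * qform z p * exp x))) \<le> (\<Sum>\<^sub>\<infinity>p\<in>lattice. exp (- (pi * qform z p * exp x)))"
      using sm F by (intro finite_sum_le_infsum) auto
    ultimately show ?thesis
      by (simp add: sum_distrib_left [symmetric] exp_of_real flip: of_real_mult)
  qed
  show "bdd_above (sum (\<lambda>p. exp (- \<sigma> * ln (pi * qform z p))) ` {F. F \<subseteq> lattice \<and> finite F})"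
  proof (rule bdd_aboveI2)
    fix F assume "F \<in> {F. F \<subseteq> lattice \<and> finite F}"
    then have F: "F \<subseteq> lattice" "finite F" by auto
    have S: "has_bochner_integral lborel (\<lambda>x. \<Sum>p\<in>F. ?E p x) (\<Sum>p\<in>F. Gamma \<sigma> * exp (- \<sigma> * ln (pi * qform z p)))"
      using F by (intro has_bochner_integral_sum G) auto
    have "(\<Sum>p\<in>F. Gamma \<sigma> * exp (- \<sigma> * ln (pi * qform z p))) \<le> Re (sym_mellin (theta 0 0 z) \<sigma> + 1 / (\<sigma> - 1) - 1 / \<sigma>)"
      using S T le[OF F] integral_mono[of lborel "\<lambda>x. \<Sum>p\<in>F. ?E p x" "\<lambda>x. Re (exp (of_real \<sigma> * of_real x) * theta 0 0 z x)"]
      unfolding has_bochner_integral_iff by auto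
    then show "(\<Sum>p\<in>F. exp (- \<sigma> * ln (pi * qform z p))) \<le> Re (sym_mellin (theta 0 0 z) \<sigma> + 1 / (\<sigma> - 1) - 1 / \<sigma>) / Gamma \<sigma>"
      using s Gamma_real_pos[of \<sigma>] by (simp add: sum_distrib_left [symmetric] field_simps)
  qed
qed simp

section \<open>Analytic continuation of the Eisenstein series\<close>

lemma ln_qform:
  assumes z: "Im z > 0" and "p \<in> lattice"
  shows "cmod (lattice_pt z p) > 0" "ln (pi * qform z p) = ln pi + 2 * ln (cmod (lattice_pt z p)) - ln (Im z)"
proof -
  show "cmod (lattice_pt z p) > 0" using qform_pos[OF assms] z by (auto simp: qform_def)
  then show "ln (pi * qform z p) = ln pi + 2 * ln (cmod (lattice_pt z p)) - ln (Im z)"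
    using z by (simp add: qform_def ln_mult ln_div ln_realpow)
qed

text \<open>The terms pi^(-s) y^s / |mz + n|^(2s) equal exp (- s ln (pi q)), so the completed series
  is half the Mellin integral of theta.\<close>

lemma EEhat_series_0:
  assumes z: "Im z > 0" and s: "Re s > 1"
  shows "EEhat_series 0 z s = s * (s - 1) / 2 * sym_mellin (theta 0 0 z) s + 1 / 2"
proof -
  note u = ln_qform(1)[OF z] and L = ln_qform(2)[OF z]
  have summ: "(\<lambda>p. norm (1 * exp (- s * of_real (ln (pi * qform z p))))) summable_on lattice"
    using qform_powers_summable[OF z s] by simp
  have tt: "theta_term 0 0 z x = (\<lambda>p. 1 * of_real (exp (- (pi * qform z p * exp x))))" for x
    by (simp add: theta_term_def fun_eq_iff mult_ac)
  have "has_bochner_integral lborel (\<lambda>x. exp (s * of_real x) * (\<Sum>\<^sub>\<infinity>p\<in>lattice. 1 * of_real (exp (- (pi * qform z p * exp x)))))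
     (Gamma s * (\<Sum>\<^sub>\<infinity>p\<in>lattice. 1 * exp (- s * of_real (ln (pi * qform z p)))))"
  proof (rule mellin_lattice_sum[OF _ _ _ summ])
    show "(\<lambda>p. norm (1 * complex_of_real (exp (- (pi * qform z p * exp x))))) summable_on lattice" for x
      using theta_term_abs_summable[OF z, of 0 0 x] unfolding tt .
  qed (use qform_pos[OF z] s in auto)
  then have "has_bochner_integral lborel (\<lambda>x. exp (s * of_real x) * theta 0 0 z x)
     (Gamma s * (\<Sum>\<^sub>\<infinity>p\<in>lattice. 1 * exp (- s * of_real (ln (pi * qform z p)))))"
    unfolding theta_def tt .
  from has_bochner_integral_eq[OF this theta_mellin[OF z s]]
  have M: "Gamma s * (\<Sum>\<^sub>\<infinity>p\<in>lattice. exp (- s * of_real (ln (pi * qform z p)))) = sym_mellin (theta 0 0 z) s + 1 / (s - 1) - 1 / s"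
    by simp
  have E: "of_real pi powr (- s) * Eis 0 z s = (\<Sum>\<^sub>\<infinity>p\<in>lattice. exp (- s * of_real (ln (pi * qform z p)))) / 2"
  proof -
    have "of_real pi powr (- s) * (case p of (m, n) \<Rightarrow> of_real (Im z) powr s /
      ((of_int m * z + of_int n) powi 0 * of_real (cmod (of_int m * z + of_int n)) powr (2 * s))) =
      exp (- s * of_real (ln (pi * qform z p)))" if "p \<in> lattice" for p
    proof -
      obtain m n where p: "p = (m, n)" by force
      have lp: "lattice_pt z p = of_int m * z + of_int n" by (simp add: p lattice_pt_def)
      have "of_real pi powr (- s) * (of_real (Im z) powr s / of_real (cmod (lattice_pt z p)) powr (2 * s)) =
         exp (- s * of_real (ln pi) + s * of_real (ln (Im z)) - 2 * s * of_real (ln (cmod (lattice_pt z p))))"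
        by (simp only: exp_of_real_mult_powr[OF pi_gt_zero, symmetric] exp_of_real_mult_powr[OF z, symmetric]
            exp_of_real_mult_powr[OF u[OF that], symmetric] exp_diff exp_add times_divide_eq_right)
      also have "- s * of_real (ln pi) + s * of_real (ln (Im z)) - 2 * s * of_real (ln (cmod (lattice_pt z p))) =
         - s * of_real (ln (pi * qform z p))"
        unfolding L[OF that] by (simp add: algebra_simps)
      finally show ?thesis by (simp add: p lattice_pt_def)
    qed
    then have "(\<Sum>\<^sub>\<infinity>p\<in>lattice. of_real pi powr (- s) * (case p of (m, n) \<Rightarrow> of_real (Im z) powr s /
      ((of_int m * z + of_int n) powi 0 * of_real (cmod (of_int m * z + of_int n)) powr (2 * s)))) =
      (\<Sum>\<^sub>\<infinity>p\<in>lattice. exp (- s * of_real (ln (pi * qform z p))))"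
      by (rule infsum_cong)
    then show ?thesis unfolding infsum_cmult_right' Eis_def by simp
  qed
  have "EEhat_series 0 z s = s * (s - 1) * (Gamma s * (of_real pi powr (- s) * Eis 0 z s))"
    by (simp add: EEhat_series_def mult_ac)
  also have "\<dots> = s * (s - 1) * (sym_mellin (theta 0 0 z) s + 1 / (s - 1) - 1 / s) / 2"
    unfolding E using M by simp
  \<comment> \<open>The factor s (s - 1) cancels the polar terms, s (s - 1) (1/(s-1) - 1/s) = 1;
    with the 1/2 of \<open>Eis\<close> this is the constant 1/2.\<close>
  also have "\<dots> = s * (s - 1) / 2 * sym_mellin (theta 0 0 z) s + 1 / 2"
  proof -
    have "s \<noteq> 0" "s - 1 \<noteq> 0" using s by auto
    then have "s * (s - 1) * (1 / (s - 1) - 1 / s) = 1" by (simp add: field_simps)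
    moreover have "s * (s - 1) * (K + 1 / (s - 1) - 1 / s) = s * (s - 1) * K + s * (s - 1) * (1 / (s - 1) - 1 / s)" for K
      by (simp add: algebra_simps)
    ultimately show ?thesis by (simp add: add_divide_distrib)
  qed
  finally show ?thesis .
qed

text \<open>Writing 1/u^2 = (cnj u)^2 / |u|^4 makes the series a Mellin integral of
  \<open>theta 0 2\<close> at exponent w + 2. The factor exp x inside \<open>ntheta 2 1 0 2\<close>
  lowers the exponent to w + 1, and folding produces the pair w + 1, -w, that is,
  \<open>sym_mellin\<close> at -w.\<close>

lemma EEhat_series_2:
  assumes z: "Im z > 0" and w: "Re w > 0"
  shows "EEhat_series 2 z w = (- w) * (- w - 1) / 2 * sym_mellin (ntheta 2 1 0 2 z) (- w)"
proof -
  let ?u = "\<lambda>p. lattice_pt z p"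
  note u = ln_qform(1)[OF z] and L = ln_qform(2)[OF z]
  define c where "c p = cnj (?u p) ^ 2" for p
  \<comment> \<open>The numerator has modulus |u|^2 = y q and costs one power of q; the remaining
    exponent Re w + 1 exceeds 1.\<close>
  have summ: "(\<lambda>p. norm (c p * exp (- (w + 2) * of_real (ln (pi * qform z p))))) summable_on lattice"
  proof -
    have "(\<lambda>p. Im z / pi * exp (- (Re w + 1) * ln (pi * qform z p))) summable_on lattice"
      using w by (intro summable_on_cmult_right qform_powers_summable z) simp
    moreover have "norm (c p * exp (- (w + 2) * of_real (ln (pi * qform z p)))) = Im z / pi * exp (- (Re w + 1) * ln (pi * qform z p))"
      if "p \<in> lattice" for p
    proof -
      have q: "pi * qform z p > 0" using qform_pos[OF z that] by simp
      have "norm (c p) = Im z / pi * exp (ln (pi * qform z p))"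
        using z q by (simp add: c_def norm_power qform_def)
      moreover have "norm (exp (- (w + 2) * of_real (ln (pi * qform z p)))) = exp (- (Re w + 2) * ln (pi * qform z p))"
        by simp
      moreover have "exp (ln (pi * qform z p)) * exp (- (Re w + 2) * ln (pi * qform z p)) = exp (- (Re w + 1) * ln (pi * qform z p))"
        unfolding exp_add [symmetric] by (simp add: algebra_simps)
      ultimately show ?thesis unfolding norm_mult by (metis mult.assoc)
    qed
    ultimately show ?thesis by (subst summable_on_cong) auto
  qed
  have tt: "theta_term 0 2 z x = (\<lambda>p. c p * of_real (exp (- (pi * qform z p * exp x))))" for x
    by (simp add: theta_term_def c_def fun_eq_iff mult_ac)
  have "has_bochner_integral lborel (\<lambda>x. exp ((w + 2) * of_real x) * (\<Sum>\<^sub>\<infinity>p\<in>lattice. c p * of_real (exp (- (pi * qform z p * exp x)))))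
     (Gamma (w + 2) * (\<Sum>\<^sub>\<infinity>p\<in>lattice. c p * exp (- (w + 2) * of_real (ln (pi * qform z p)))))"
  proof (rule mellin_lattice_sum[OF _ _ _ summ])
    show "(\<lambda>p. norm (c p * complex_of_real (exp (- (pi * qform z p * exp x))))) summable_on lattice" for x
      using theta_term_abs_summable[OF z, of 0 2 x] unfolding tt .
  qed (use qform_pos[OF z] w in auto)
  then have 1: "has_bochner_integral lborel (\<lambda>x. exp ((w + 2) * of_real x) * theta 0 2 z x)
     (Gamma (w + 2) * (\<Sum>\<^sub>\<infinity>p\<in>lattice. c p * exp (- (w + 2) * of_real (ln (pi * qform z p)))))"
    unfolding theta_def tt .
  let ?h = "\<lambda>x. exp ((w + 1) * of_real x) * ntheta 2 1 0 2 z x"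
  define k where "k = complex_of_real (pi / (Im z)\<^sup>2)"
  have h: "?h x = k * (exp ((w + 2) * of_real x) * theta 0 2 z x)" for x
  proof -
    have "exp ((w + 2) * of_real x) = exp ((w + 1) * of_real x) * of_real (exp x)"
      by (simp add: exp_of_real [symmetric] exp_add [symmetric] algebra_simps)
    then show ?thesis by (simp add: ntheta_def k_def)
  qed
  have 2: "has_bochner_integral lborel ?h
     (k * (Gamma (w + 2) * (\<Sum>\<^sub>\<infinity>p\<in>lattice. c p * exp (- (w + 2) * of_real (ln (pi * qform z p))))))"
    unfolding h by (rule has_bochner_integral_mult_right[OF 1])
  have g: "rapid (ntheta 2 1 0 2 z)" by (rule rapid_ntheta[OF z])
  have hm: "?h (- x) = exp (- w * of_real x) * ntheta 2 1 0 2 z x" for x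
  proof -
    have "exp ((w + 1) * of_real (- x)) * of_real (exp x) = exp (- w * of_real x)"
      by (simp add: exp_of_real [symmetric] exp_add [symmetric] algebra_simps)
    then show ?thesis unfolding theta_0_2_functional_equation[OF z] by (simp only: mult.assoc [symmetric])
  qed
  have "has_bochner_integral lborel ?h ((LINT x|half_line. ?h x) + (LINT x|half_line. ?h (- x)))"
  proof (rule integral_lborel_split)
    show "continuous_on UNIV ?h" using g by (intro continuous_intros) (simp add: rapid_def)
    show "integrable half_line ?h" by (rule rapid_exp_integrable[OF g])
    show "integrable half_line (\<lambda>x. ?h (- x))" unfolding hm by (rule rapid_exp_integrable[OF g])
  qed
  then have 3: "has_bochner_integral lborel ?h (sym_mellin (ntheta 2 1 0 2 z) (- w))"
    unfolding hm sym_mellin_def by (simp add: add.commute)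
  have M: "k * (Gamma (w + 2) * (\<Sum>\<^sub>\<infinity>p\<in>lattice. c p * exp (- (w + 2) * of_real (ln (pi * qform z p))))) = sym_mellin (ntheta 2 1 0 2 z) (- w)"
    by (rule has_bochner_integral_eq[OF 2 3])
  have E: "of_real pi powr (- (w + 1)) * Eis 2 z w = k * (\<Sum>\<^sub>\<infinity>p\<in>lattice. c p * exp (- (w + 2) * of_real (ln (pi * qform z p)))) / 2"
  proof -
    have "of_real pi powr (- (w + 1)) * (case p of (m, n) \<Rightarrow> of_real (Im z) powr w /
      ((of_int m * z + of_int n) powi 2 * of_real (cmod (of_int m * z + of_int n)) powr (2 * w))) =
      k * (c p * exp (- (w + 2) * of_real (ln (pi * qform z p))))" if "p \<in> lattice" for p
    proof -
      obtain m n where p: "p = (m, n)" by force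
      have u0: "?u p \<noteq> 0" using u[OF that] by auto
      \<comment> \<open>All powers are written as exponentials of real logarithms, so the exponents
        can be compared by linear algebra.\<close>
      define lp ly lu where "lp = complex_of_real (ln pi)" and "ly = complex_of_real (ln (Im z))"
        and "lu = complex_of_real (ln (cmod (?u p)))"
      have e: "complex_of_real pi = exp lp" "complex_of_real (Im z) = exp ly" "complex_of_real (cmod (?u p)) = exp lu"
        using z u[OF that] by (simp_all add: lp_def ly_def lu_def exp_of_real)
      have "?u p * cnj (?u p) = exp lu ^ 2"
        unfolding e(3) [symmetric] by (simp add: complex_norm_square [symmetric])
      then have "(?u p * cnj (?u p)) ^ 2 = exp (4 * lu)"
        by (simp add: exp_of_nat_mult [symmetric] power_mult [symmetric])
      then have cp: "c p = exp (4 * lu) / ?u p ^ 2"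
        using u0 by (simp add: c_def power_mult_distrib eq_divide_eq mult.commute)
      have kk: "k = exp (lp - 2 * ly)"
        unfolding k_def of_real_divide of_real_power e(1,2)
        by (simp add: exp_diff exp_double)
      have "k * (c p * exp (- (w + 2) * of_real (ln (pi * qform z p)))) =
         exp (lp - 2 * ly) * (exp (4 * lu) * exp (- (w + 2) * (lp + 2 * lu - ly))) / ?u p ^ 2"
        unfolding kk cp L[OF that] by (simp add: lp_def ly_def lu_def)
      also have "exp (lp - 2 * ly) * (exp (4 * lu) * exp (- (w + 2) * (lp + 2 * lu - ly))) =
         exp (- (w + 1) * lp + w * ly - 2 * w * lu)"
        unfolding exp_add [symmetric] by (simp add: algebra_simps)
      also have "\<dots> = of_real pi powr (- (w + 1)) * (of_real (Im z) powr w / of_real (cmod (?u p)) powr (2 * w))"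
        unfolding lp_def ly_def lu_def
        by (simp only: exp_of_real_mult_powr[OF pi_gt_zero, symmetric] exp_of_real_mult_powr[OF z, symmetric]
            exp_of_real_mult_powr[OF u[OF that], symmetric] exp_diff exp_add times_divide_eq_right)
      finally show ?thesis by (simp add: p lattice_pt_def mult_ac)
    qed
    then have "(\<Sum>\<^sub>\<infinity>p\<in>lattice. of_real pi powr (- (w + 1)) * (case p of (m, n) \<Rightarrow> of_real (Im z) powr w /
      ((of_int m * z + of_int n) powi 2 * of_real (cmod (of_int m * z + of_int n)) powr (2 * w)))) =
      (\<Sum>\<^sub>\<infinity>p\<in>lattice. k * (c p * exp (- (w + 2) * of_real (ln (pi * qform z p)))))"
      by (rule infsum_cong)
    then show ?thesis unfolding infsum_cmult_right' Eis_def by simp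
  qed
  have "EEhat_series 2 z w = (w + 1) * w * (Gamma (w + 2) * (of_real pi powr (- (w + 1)) * Eis 2 z w))"
    by (simp add: EEhat_series_def mult_ac add.commute)
  also have "\<dots> = (w + 1) * w * sym_mellin (ntheta 2 1 0 2 z) (- w) / 2"
    unfolding E M [symmetric] by (simp add: mult_ac)
  finally show ?thesis by (simp add: algebra_simps)
qed

lemma F_eq:
  assumes z: "Im z > 0"
  shows "F n z = theta_coeff n z - theta_coeff (n + 1) z + (if n = 0 then 1 / 2 else 0)"
proof -
  let ?H = "\<lambda>s. s * (s - 1) / 2 * sym_mellin (theta 0 0 z) s + 1 / 2"
  have g: "rapid (theta 0 0 z)" using rapid_ntheta[OF z, of 0 0 0 0] by (simp add: ntheta_def [abs_def])
  note H = entire_power_series[where H = ?H, OF completed_taylor_sums[OF g]]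
  have "EEhat 0 z = ?H"
    by (rule EEhat_eqI[OF H(1)]) (simp add: EEhat_series_0[OF z])
  then have "F n z = (deriv ^^ n) ?H 0 / of_nat (fact n)"
    by (simp add: F_def TaylorE_def)
  also have "\<dots> = (wintegral (tweight n) (theta 0 0 z) - wintegral (tweight (n + 1)) (theta 0 0 z)) / 2 + (if n = 0 then 1 / 2 else 0)"
    by (rule H(2))
  finally show ?thesis
    by (simp add: theta_coeff_def moment_def ntheta_def [abs_def] diff_divide_distrib)
qed

text \<open>The weight 2 continuation is \<open>completed_taylor_sums\<close> with c = 0 evaluated
  at -w, which produces the sign (-1)^n.\<close>

lemma G_eq:
  assumes z: "Im z > 0"
  shows "G n z = (- 1) ^ n * (xi_coeff n z - xi_coeff (n + 1) z)"
proof -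
  let ?g = "ntheta 2 1 0 2 z"
  let ?H = "\<lambda>w. (- w) * (- w - 1) / 2 * sym_mellin ?g (- w)"
  let ?a = "\<lambda>n. (wintegral (tweight n) ?g - wintegral (tweight (n + 1)) ?g) / 2"
  have g: "rapid ?g" by (rule rapid_ntheta[OF z])
  have "(\<lambda>n. ((- 1) ^ n * ?a n) * w ^ n) sums ?H w" for w
    using completed_taylor_sums[OF g, of 0 "- w"] by (simp add: power_minus[of w] mult_ac)
  note H = entire_power_series[where H = ?H, OF this]
  have "EEhat 2 z = ?H"
    by (rule EEhat_eqI[OF H(1)]) (simp add: EEhat_series_2[OF z])
  then have "G n z = (deriv ^^ n) ?H 0 / of_nat (fact n)"
    by (simp add: G_def TaylorE_def)
  also have "\<dots> = (- 1) ^ n * ?a n"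
    by (rule H(2))
  finally show ?thesis
    by (simp add: xi_coeff_def moment_def diff_divide_distrib)
qed

section \<open>The differential equations\<close>

lemma F_eq_theta_coeff_diff: "Im z > 0 \<Longrightarrow> F n z = theta_coeff_diff n z"
  by (simp add: F_eq theta_coeff_diff_def)

lemma F_real: "Im z > 0 \<Longrightarrow> cnj (F n z) = F n z"
  by (simp add: F_eq theta_coeff_real)

lemma F_wirtinger:
  assumes z: "Im z > 0"
  shows "has_wirtinger (F n) (- (\<i> / 2) * ((- 1) ^ n * G n z)) (\<i> / 2 * cnj ((- 1) ^ n * G n z)) z"
proof -
  have G: "(- 1) ^ n * G n z = xi_coeff n z - xi_coeff (n + 1) z"
    unfolding G_eq[OF z] mult.assoc [symmetric] power_add [symmetric] by simp
  have "has_wirtinger (\<lambda>z. theta_coeff n z + - 1 * theta_coeff (n + 1) z + (if n = 0 then 1 / 2 else 0))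
     (- (\<i> / 2) * xi_coeff n z + - 1 * (- (\<i> / 2) * xi_coeff (n + 1) z) + 0)
     (\<i> / 2 * cnj (xi_coeff n z) + - 1 * (\<i> / 2 * cnj (xi_coeff (n + 1) z)) + 0) z"
    by (intro has_wirtinger_add has_wirtinger_cmult has_wirtinger_const theta_coeff_wirtinger z)
  then have "has_wirtinger (F n)
     (- (\<i> / 2) * xi_coeff n z + - 1 * (- (\<i> / 2) * xi_coeff (n + 1) z) + 0)
     (\<i> / 2 * cnj (xi_coeff n z) + - 1 * (\<i> / 2 * cnj (xi_coeff (n + 1) z)) + 0) z"
    by (rule has_wirtinger_cong[OF _ z]) (simp add: F_eq)
  then show ?thesis unfolding G by (simp add: algebra_simps)
qed

text \<open>\<open>F\<close> with the same shift by two as \<open>divpow\<close>, extended by 0, so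
  that the recursion with F_(n-2) - F_(n-1) holds for every n.\<close>

definition Fshift :: "nat \<Rightarrow> complex \<Rightarrow> complex" where
  "Fshift n z = (if n < 2 then 0 else F (n - 2) z)"

lemma xi_coeff_C2_Fshift:
  "\<exists>A. C2_wirtinger (xi_coeff n) A (\<lambda>z. \<i> / 2 * (of_real (1 / (Im z)\<^sup>2) * Fshift n z))"
proof (cases "n < 2")
  case True
  then have "xi_coeff n = (\<lambda>_. 0)" and "Fshift n = (\<lambda>_. 0)"
    by (simp_all add: xi_coeff_def fun_eq_iff moment_def wintegral_def tweight_def divpow_def Fshift_def)
  then show ?thesis using C2_wirtinger_zero by auto
next
  case False
  then obtain m where n: "n = m + 2" by (metis add.commute le_Suc_ex not_less)
  obtain A where "C2_wirtinger (xi_coeff (m + 2)) A (\<lambda>z. \<i> / 2 * (of_real (1 / (Im z)\<^sup>2) * theta_coeff_diff m z))"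
    using xi_coeff_C2 by blast
  then have "C2_wirtinger (xi_coeff n) A (\<lambda>z. \<i> / 2 * (of_real (1 / (Im z)\<^sup>2) * Fshift n z))"
    by (rule C2_wirtinger_cong) (auto simp: n Fshift_def F_eq_theta_coeff_diff)
  then show ?thesis by blast
qed

text \<open>The difference \<open>Fshift n z - Fshift (n + 1) z\<close> is the Laplacian of
  \<open>F n\<close>; the lemma is this second-order equation seen from G_n = (-1)^n xi_0
  F_n.\<close>

lemma G_C2:
  "\<exists>A. C2_wirtinger (G n) A
     (\<lambda>z. \<i> / 2 * (of_real (1 / (Im z)\<^sup>2) * ((- 1) ^ n * (Fshift n z - Fshift (n + 1) z))))"
proof -
  obtain A where A: "\<And>n. C2_wirtinger (xi_coeff n) (A n) (\<lambda>z. \<i> / 2 * (of_real (1 / (Im z)\<^sup>2) * Fshift n z))"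
    using xi_coeff_C2_Fshift by metis
  have "C2_wirtinger (\<lambda>z. (- 1) ^ n * (xi_coeff n z + - 1 * xi_coeff (n + 1) z))
     (\<lambda>z. (- 1) ^ n * (A n z + - 1 * A (n + 1) z))
     (\<lambda>z. (- 1) ^ n * (\<i> / 2 * (of_real (1 / (Im z)\<^sup>2) * Fshift n z) + - 1 * (\<i> / 2 * (of_real (1 / (Im z)\<^sup>2) * Fshift (n + 1) z))))"
    by (intro C2_wirtinger_cmult C2_wirtinger_add A)
  then have "C2_wirtinger (G n) (\<lambda>z. (- 1) ^ n * (A n z + - 1 * A (n + 1) z))
     (\<lambda>z. \<i> / 2 * (of_real (1 / (Im z)\<^sup>2) * ((- 1) ^ n * (Fshift n z - Fshift (n + 1) z))))"
    by (rule C2_wirtinger_cong) (simp_all add: G_eq right_diff_distrib mult_ac)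
  then show ?thesis by blast
qed

section \<open>Binomial recombination of the recursions\<close>

lemma Ft_eq: "Ft n z = (- 1) ^ n * (\<Sum>l\<le>n. of_nat ((n + l) choose n) * F (n - l) z)"
  unfolding Ft_def atMost_atLeast0 by (simp add: sum.atLeast_Suc_atMost)

lemma Gt_eq: "Gt n z = (\<Sum>l\<le>n. ((- 1) ^ l * of_nat ((n + l) choose n)) * G (n - l) z)"
  unfolding Gt_def atMost_atLeast0 by (simp add: sum.atLeast_Suc_atMost)

text \<open>\<open>(n + l) choose n\<close> is the coefficient of s^l in (1-s)^(-n-1), and the
  differences of f are the coefficients of (1-s) f(s), so one factor 1-s cancels. On coefficients
  this is Pascal's rule; f 0 = f 1 = 0 disposes of the end terms.\<close>

lemma alternating_choose_sum:
  fixes f :: "nat \<Rightarrow> complex"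
  assumes "f 0 = 0" "f 1 = 0"
  shows "(\<Sum>l\<le>Suc m. of_nat ((Suc m + l) choose Suc m) * (f (Suc (Suc m) - l) - f (Suc m - l))) =
     (\<Sum>l\<le>m. of_nat ((m + l) choose m) * f (Suc (Suc m) - l))"
proof -
  let ?c = "\<lambda>l. of_nat ((Suc m + l) choose Suc m) :: complex"
  have "(\<Sum>l\<le>Suc m. ?c l * (f (Suc (Suc m) - l) - f (Suc m - l))) =
     (\<Sum>l\<le>Suc m. ?c l * f (Suc (Suc m) - l)) - (\<Sum>l\<le>Suc m. ?c l * f (Suc m - l))"
    by (simp add: right_diff_distrib sum_subtractf del: sum.atMost_Suc)
  also have "(\<Sum>l\<le>Suc m. ?c l * f (Suc (Suc m) - l)) = f (Suc (Suc m)) + (\<Sum>l\<le>m. ?c (Suc l) * f (Suc m - l))"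
    by (subst sum.atMost_Suc_shift) simp
  also have "(\<Sum>l\<le>Suc m. ?c l * f (Suc m - l)) = (\<Sum>l\<le>m. ?c l * f (Suc m - l))"
    using assms(1) by simp
  also have "f (Suc (Suc m)) + (\<Sum>l\<le>m. ?c (Suc l) * f (Suc m - l)) - (\<Sum>l\<le>m. ?c l * f (Suc m - l)) =
     f (Suc (Suc m)) + (\<Sum>l\<le>m. of_nat ((m + Suc l) choose m) * f (Suc m - l))"
  proof -
    have "?c (Suc l) - ?c l = of_nat ((m + Suc l) choose m)" for l
      by simp
    then have "(\<Sum>l\<le>m. ?c (Suc l) * f (Suc m - l)) - (\<Sum>l\<le>m. ?c l * f (Suc m - l)) = (\<Sum>l\<le>m. of_nat ((m + Suc l) choose m) * f (Suc m - l))"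
      by (simp only: sum_subtractf [symmetric] left_diff_distrib [symmetric])
    then show ?thesis by simp
  qed
  also have "\<dots> = (\<Sum>l\<le>Suc m. of_nat ((m + l) choose m) * f (Suc (Suc m) - l))"
    by (subst sum.atMost_Suc_shift) simp
  also have "\<dots> = (\<Sum>l\<le>m. of_nat ((m + l) choose m) * f (Suc (Suc m) - l))"
    using assms(2) by simp
  finally show ?thesis .
qed

text \<open>The signs (-1)^l and (-1)^(n-l) combine to (-1)^n, after which
  \<open>alternating_choose_sum\<close> applies. For n = 0 both sides vanish because
  \<open>Fshift\<close> is 0 below index 2.\<close>

lemma Ft_prev_eq:
  "Ft_prev n z = (\<Sum>l\<le>n. ((- 1) ^ l * of_nat ((n + l) choose n)) *
      ((- 1) ^ (n - l) * (Fshift (n - l) z - Fshift (n - l + 1) z)))"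
proof -
  have "(\<Sum>l\<le>n. ((- 1) ^ l * of_nat ((n + l) choose n)) * ((- 1) ^ (n - l) * (Fshift (n - l) z - Fshift (n - l + 1) z))) =
     (\<Sum>l\<le>n. (- 1) ^ n * (of_nat ((n + l) choose n) * (Fshift (n - l) z - Fshift (Suc n - l) z)))"
  proof (rule sum.cong[OF refl])
    fix l assume "l \<in> {..n}"
    then have "(- 1 :: complex) ^ n = (- 1) ^ l * (- 1) ^ (n - l)" "n - l + 1 = Suc n - l"
      by (simp_all add: power_add [symmetric] Suc_diff_le)
    then show "((- 1) ^ l * of_nat ((n + l) choose n)) * ((- 1) ^ (n - l) * (Fshift (n - l) z - Fshift (n - l + 1) z)) =
      (- 1) ^ n * (of_nat ((n + l) choose n) * (Fshift (n - l) z - Fshift (Suc n - l) z))"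
      by simp
  qed
  also have "\<dots> = Ft_prev n z"
  proof (cases n)
    case 0
    then show ?thesis by (simp add: Ft_prev_def Fshift_def)
  next
    case (Suc m)
    have "(\<Sum>l\<le>n. (- 1) ^ n * (of_nat ((n + l) choose n) * (Fshift (n - l) z - Fshift (Suc n - l) z))) =
      (- 1) ^ m * (\<Sum>l\<le>Suc m. of_nat ((Suc m + l) choose Suc m) * (Fshift (Suc (Suc m) - l) z - Fshift (Suc m - l) z))"
      unfolding Suc sum_distrib_left by (intro sum.cong) (auto simp: algebra_simps)
    also have "(\<Sum>l\<le>Suc m. of_nat ((Suc m + l) choose Suc m) * (Fshift (Suc (Suc m) - l) z - Fshift (Suc m - l) z)) =
      (\<Sum>l\<le>m. of_nat ((m + l) choose m) * Fshift (Suc (Suc m) - l) z)"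
      by (rule alternating_choose_sum) (simp_all add: Fshift_def)
    also have "\<dots> = (\<Sum>l\<le>m. of_nat ((m + l) choose m) * F (m - l) z)"
      by (intro sum.cong refl) (simp add: Fshift_def Suc_diff_le)
    finally show ?thesis by (simp add: Suc Ft_prev_def Ft_eq)
  qed
  finally show ?thesis ..
qed

text \<open>The sign (-1)^n of \<open>Ft\<close> and the sign (-1)^(n-l) from xi_0 F_(n-l) leave
  (-1)^l, exactly the sign in \<open>Gt\<close>. The two derivatives are conjugate, as befits a
  real-valued function.\<close>

lemma Ft_wirtinger:
  assumes z: "Im z > 0"
  shows "has_wirtinger (Ft n) (- (\<i> / 2) * Gt n z) (\<i> / 2 * cnj (Gt n z)) z"
proof -
  have s: "(- 1 :: complex) ^ n * (- 1) ^ (n - l) = (- 1) ^ l" if "l \<in> {..n}" for l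
  proof -
    have "(- 1 :: complex) ^ n = (- 1) ^ l * (- 1) ^ (n - l)"
      using that by (simp add: power_add [symmetric])
    then show ?thesis unfolding mult.assoc [symmetric] by (simp only: mult.assoc minus_one_mult_self mult_1_right)
  qed
  let ?c = "\<lambda>l. of_nat ((n + l) choose n) :: complex"
  have w: "has_wirtinger (\<lambda>z. (- 1) ^ n * (\<Sum>l\<le>n. ?c l * F (n - l) z))
     ((- 1) ^ n * (\<Sum>l\<le>n. ?c l * (- (\<i> / 2) * ((- 1) ^ (n - l) * G (n - l) z))))
     ((- 1) ^ n * (\<Sum>l\<le>n. ?c l * (\<i> / 2 * cnj ((- 1) ^ (n - l) * G (n - l) z)))) z"
    by (intro has_wirtinger_cmult has_wirtinger_sum F_wirtinger z)
  have t: "(- 1) ^ n * (c * (k * ((- 1) ^ (n - l) * g))) = k * ((- 1) ^ l * c * g)"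
    if "l \<in> {..n}" for l and c k g :: complex
  proof -
    have "(- 1) ^ n * (c * (k * ((- 1) ^ (n - l) * g))) = ((- 1) ^ n * (- 1) ^ (n - l)) * (k * (c * g))"
      by (simp only: mult_ac)
    then show ?thesis unfolding s[OF that] by (simp only: mult_ac)
  qed
  have A: "(- 1) ^ n * (\<Sum>l\<le>n. ?c l * (- (\<i> / 2) * ((- 1) ^ (n - l) * G (n - l) z))) = - (\<i> / 2) * Gt n z"
    unfolding Gt_eq sum_distrib_left by (intro sum.cong refl t)
  have B: "(- 1) ^ n * (\<Sum>l\<le>n. ?c l * (\<i> / 2 * cnj ((- 1) ^ (n - l) * G (n - l) z))) = \<i> / 2 * cnj (Gt n z)"
    unfolding Gt_eq cnj_sum sum_distrib_left complex_cnj_mult complex_cnj_power complex_cnj_minus complex_cnj_one complex_cnj_of_nat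
    by (intro sum.cong refl t)
  show ?thesis using w unfolding A B Ft_eq [abs_def] .
qed

lemma Gt_C2:
  "\<exists>A. C2_wirtinger (Gt n) A (\<lambda>z. \<i> / 2 * (of_real (1 / (Im z)\<^sup>2) * Ft_prev n z))"
proof -
  let ?B = "\<lambda>n z. \<i> / 2 * (of_real (1 / (Im z)\<^sup>2) * ((- 1) ^ n * (Fshift n z - Fshift (n + 1) z)))"
  obtain A where A: "\<And>n. C2_wirtinger (G n) (A n) (?B n)"
    using G_C2 by metis
  let ?c = "\<lambda>l. (- 1) ^ l * of_nat ((n + l) choose n) :: complex"
  have "C2_wirtinger (\<lambda>z. \<Sum>l\<le>n. ?c l * G (n - l) z) (\<lambda>z. \<Sum>l\<le>n. ?c l * A (n - l) z) (\<lambda>z. \<Sum>l\<le>n. ?c l * ?B (n - l) z)"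
    by (intro C2_wirtinger_sum C2_wirtinger_cmult A)
  then have "C2_wirtinger (Gt n) (\<lambda>z. \<Sum>l\<le>n. ?c l * A (n - l) z) (\<lambda>z. \<i> / 2 * (of_real (1 / (Im z)\<^sup>2) * Ft_prev n z))"
  proof (rule C2_wirtinger_cong)
    show "(\<Sum>l\<le>n. ?c l * ?B (n - l) z) = \<i> / 2 * (of_real (1 / (Im z)\<^sup>2) * Ft_prev n z)" for z
      unfolding Ft_prev_eq sum_distrib_left by (intro sum.cong refl) simp
  qed (simp add: Gt_eq)
  then show ?thesis by blast
qed

section \<open>From Wirtinger derivatives to the operators of the statement\<close>

lemma dX_wirtinger: "has_wirtinger f A B z \<Longrightarrow> dX f z = A + B"
  unfolding has_wirtinger_def dX_def by (drule spec[of _ 1]) (simp add: vector_derivative_at)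

lemma dY_wirtinger: "has_wirtinger f A B z \<Longrightarrow> dY f z = \<i> * (A - B)"
  unfolding has_wirtinger_def dY_def
  by (drule spec[of _ \<i>]) (simp add: vector_derivative_at mult.commute[of \<i>] right_diff_distrib)

lemma xiBF_wirtinger:
  assumes "has_wirtinger f A B z"
  shows "xiBF k f z = 2 * \<i> * of_real (Im z powi k) * cnj B"
proof -
  have "dX f z + \<i> * dY f z = 2 * B"
    unfolding dX_wirtinger[OF assms] dY_wirtinger[OF assms] by (simp add: mult.assoc [symmetric])
  then show ?thesis by (simp add: xiBF_def)
qed

text \<open>In Wirtinger form the operator is 4 y^2 times the mixed second derivative minus 2 i k y
  times the conjugate derivative. With a common mixed derivative X, the pure second derivatives S
  and T cancel in the sum of \<open>dX (dX f)\<close> and \<open>dY (dY f)\<close>.\<close>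

lemma Lap_wirtinger:
  assumes z: "Im z > 0" and f: "\<And>z. Im z > 0 \<Longrightarrow> has_wirtinger f (A z) (B z) z"
    and A: "has_wirtinger A S X z" and B: "has_wirtinger B X T z"
  shows "Lap k f z = 4 * of_real ((Im z)\<^sup>2) * X - 2 * \<i> * of_int k * of_real (Im z) * B z"
proof -
  have "has_wirtinger (dX f) (S + X) (X + T) z"
    by (rule has_wirtinger_cong[OF has_wirtinger_add[OF A B] z]) (use dX_wirtinger[OF f] in simp)
  from dX_wirtinger[OF this] have xx: "dX (dX f) z = S + 2 * X + T" by simp
  have "has_wirtinger (\<lambda>z. \<i> * (A z + - 1 * B z)) (\<i> * (S + - 1 * X)) (\<i> * (X + - 1 * T)) z"
    by (intro has_wirtinger_cmult has_wirtinger_add A B)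
  then have "has_wirtinger (dY f) (\<i> * (S + - 1 * X)) (\<i> * (X + - 1 * T)) z"
    by (rule has_wirtinger_cong[OF _ z]) (use dY_wirtinger[OF f] in simp)
  from dY_wirtinger[OF this] have yy: "dY (dY f) z = - (S - 2 * X + T)"
    by (simp add: algebra_simps)
  have "dX f z + \<i> * dY f z = 2 * B z"
    unfolding dX_wirtinger[OF f[OF z]] dY_wirtinger[OF f[OF z]] by (simp add: mult.assoc [symmetric])
  then show ?thesis unfolding Lap_def xx yy by (simp add: algebra_simps)
qed

theorem theorem1p3:
  fixes n :: nat and z :: complex
  assumes "Im z > 0"
  shows "Lap 0 (Ft n) z = Ft_prev n z \<and> xiBF 0 (Ft n) z = Gt n z \<and>
         Lap 2 (Gt n) z = Gt_prev n z \<and> xiBF 2 (Gt n) z = Ft_prev n z"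
proof -
  note z = assms
  define y where "y = complex_of_real (Im z)"
  have y: "y \<noteq> 0" using z by (simp add: y_def)

  \<comment> \<open>The operator \<open>xiBF\<close> conjugates; reality of \<open>Ft_prev\<close>
    is what removes the conjugation in weight 2.\<close>
  have real: "cnj (Ft_prev n z) = Ft_prev n z"
    by (simp add: Ft_prev_def Ft_eq F_real[OF z])
  obtain A where C2: "C2_wirtinger (Gt n) A (\<lambda>z. \<i> / 2 * (of_real (1 / (Im z)\<^sup>2) * Ft_prev n z))"
    using Gt_C2 by blast
  have Gt: "has_wirtinger (Gt n) (A z) (\<i> / 2 * (of_real (1 / (Im z)\<^sup>2) * Ft_prev n z)) z" if "Im z > 0" for z
    using C2 that unfolding C2_wirtinger_def by blast
  obtain S X T where A: "has_wirtinger A S X z"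
    and B: "has_wirtinger (\<lambda>z. \<i> / 2 * (of_real (1 / (Im z)\<^sup>2) * Ft_prev n z)) X T z"
    using C2 z unfolding C2_wirtinger_def by blast
  have "xiBF 0 (Ft n) z = Gt n z"
    unfolding xiBF_wirtinger[OF Ft_wirtinger[OF z]] by simp
  moreover have "xiBF 2 (Gt n) z = Ft_prev n z"
    unfolding xiBF_wirtinger[OF Gt[OF z]] using real z by simp
  moreover have "Lap 0 (Ft n) z = Ft_prev n z"
  proof -
    \<comment> \<open>The two first derivatives of \<open>Ft n\<close> are differentiated once more.
      Their mixed derivatives are conjugates of each other, and they coincide because
      \<open>Ft_prev\<close> is real.\<close>
    have "has_wirtinger (\<lambda>z. - (\<i> / 2) * Gt n z) (- (\<i> / 2) * A z) (1 / 4 * (1 / y\<^sup>2 * Ft_prev n z)) z"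
      using has_wirtinger_cmult[OF Gt[OF z], of "- (\<i> / 2)"] by (simp add: y_def)
    moreover have "has_wirtinger (\<lambda>z. \<i> / 2 * cnj (Gt n z)) (1 / 4 * (1 / y\<^sup>2 * Ft_prev n z)) (\<i> / 2 * cnj (A z)) z"
      using has_wirtinger_cmult[OF has_wirtinger_cnj[OF Gt[OF z]], of "\<i> / 2"] real by (simp add: y_def)
    ultimately have "Lap 0 (Ft n) z = 4 * of_real ((Im z)\<^sup>2) * (1 / 4 * (1 / y\<^sup>2 * Ft_prev n z)) -
        2 * \<i> * of_int 0 * of_real (Im z) * (\<i> / 2 * cnj (Gt n z))"
      by (intro Lap_wirtinger[OF z Ft_wirtinger])
    then show ?thesis using y by (simp add: y_def)
  qed
  moreover have "Lap 2 (Gt n) z = Gt_prev n z"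
  proof -
    \<comment> \<open>For n = 0 both \<open>Ft_prev\<close> and \<open>Gt_prev\<close> are the zero
      function and the rule for constants supplies the derivative.\<close>
    have "\<exists>B'. has_wirtinger (Ft_prev n) (- (\<i> / 2) * Gt_prev n z) B' z"
      using Ft_wirtinger[OF z, of "n - 1"] has_wirtinger_const[of 0 z]
      by (auto simp: Ft_prev_def Gt_prev_def)
    then obtain B' where "has_wirtinger (Ft_prev n) (- (\<i> / 2) * Gt_prev n z) B' z" ..
    \<comment> \<open>X is found by differentiating the explicit conjugate derivative of
      \<open>Gt n\<close> as a product. The contribution of 1 / y^2 cancels the first-order term of
      \<open>Lap 2\<close>.\<close>
    from has_wirtinger_unique(1)[OF B has_wirtinger_cmult[OF has_wirtinger_mult[OF has_wirtinger_Im_power[OF z, of 2] this], of "\<i> / 2"]]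
    have X: "X = \<i> / 2 * (1 / y\<^sup>2 * (- (\<i> / 2) * Gt_prev n z) + \<i> * (1 / y ^ 3) * Ft_prev n z)"
      by (simp add: y_def numeral_eq_Suc)
    have "Lap 2 (Gt n) z = 4 * y\<^sup>2 * X - 2 * \<i> * 2 * y * (\<i> / 2 * (1 / y\<^sup>2 * Ft_prev n z))"
      using Lap_wirtinger[OF z Gt A B, of 2] by (simp add: y_def)
    also have "\<dots> = Gt_prev n z"
      unfolding X using y by (simp add: field_simps power2_eq_square power3_eq_cube)
    finally show ?thesis .
  qed
  ultimately show ?thesis by blast
qed

end
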